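(* Let $\sigma,\sigma'\in i\mathbb{R}$ with $\sigma-\sigma'\in\mathbb{Z}$, and let $e_{kl},\overline{e}_{kl}$ ($1\le k,l\le4$) be the operators on $C_0^\infty(\mathrm{GL}_2(\mathbb{C}))$ by which the standard generators of the two summands of $\mathfrak{gl}_4(\mathbb{C})_{\mathbb{C}}\simeq\mathfrak{gl}_4(\mathbb{C})\oplus\mathfrak{gl}_4(\mathbb{C})$ act in the representation $U_{\sigma,\sigma'}$. For $F\in C_0^\infty(\mathrm{GL}_2(\mathbb{C}))$ let $K_F(t,s|\mu_1,\mu_1';\mu_2,\mu_2')$ be the kernel of the operator $T_{\mu_1,\mu_1';\mu_2,\mu_2'}(F)$ (the Fourier transform of $F$). Then for every $F\in C_0^\infty(\mathrm{GL}_2(\mathbb{C}))$ $$K_{e_{14}F}=E_{14}K_F,\quad K_{\overline{e}_{14}F}=\overline{E}_{14}K_F,\quad K_{e_{32}F}=E_{32}K_F,\quad K_{\overline{e}_{32}F}=\overline{E}_{32}K_F$$ (for all $t,s\in\mathbb{C}$ and all $(\mu_1,\mu_1';\mu_2,\mu_2')\in\Delta$ for which the denominators in the corresponding formula do not vanish), where $$E_{14}=\frac{-1/2-\sigma+\mu_1}{\mu_1-\mu_2}\frac{\partial}{\partial s}V_1^{-1}+\frac{-1/2-\sigma+\mu_2}{\mu_1-\mu_2}\frac{\partial}{\partial t}V_2^{-1},$$ $$\overline{E}_{14}=\frac{-1/2-\sigma'+\mu_1'}{\mu_1'-\mu_2'}\frac{\partial}{\partial\overline{s}}(V_1')^{-1}+\frac{-1/2-\sigma'+\mu_2'}{\mu_1'-\mu_2'}\frac{\partial}{\partial\overline{t}}(V_2')^{-1},$$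 $$E_{32}=\frac{1/2+\mu_1+\sigma}{\mu_1-\mu_2}\frac{\partial}{\partial t}V_1+\frac{1/2+\mu_2+\sigma}{\mu_1-\mu_2}\frac{\partial}{\partial s}V_2,$$ $$\overline{E}_{32}=\frac{1/2+\mu_1'+\sigma'}{\mu_1'-\mu_2'}\frac{\partial}{\partial\overline{t}}V_1'+\frac{1/2+\mu_2'+\sigma'}{\mu_1'-\mu_2'}\frac{\partial}{\partial\overline{s}}V_2'.$$
   Context: **Notation.** For $\nu,\nu'\in\mathbb{C}$ with $\nu-\nu'\in\mathbb{Z}$ and $z\in\mathbb{C}^\times$ put $z^{\nu\|\nu'}:=|z|^{2\nu}\,\overline{z}^{\,\nu'-\nu}$ (informally $z^\nu\overline{z}^{\nu'}$). $\partial/\partial z$, $\partial/\partial\overline{z}$ denote Wirtinger derivatives. Elements of $\mathrm{GL}_2(\mathbb{C})$ are written $X=\begin{pmatrix} x_{11} & x_{12} \\ x_{21} & x_{22} \end{pmatrix}$; the Haar measure is $|\det X|^{-4}\prod_{k,l}d\,\mathrm{Re}\,x_{kl}\,d\,\mathrm{Im}\,x_{kl}$. $C_0^\infty(\mathrm{GL}_2(\mathbb{C}))$ is the space of compactly supported smooth complex-valued functions on $\mathrm{GL}_2(\mathbb{C})$. **Principal series.** $\Delta$ is the set of $(\mu_1,\mu_1';\mu_2,\mu_2')\in\mathbb{C}^4$ with $\mu_1-\mu_1'\in\mathbb{Z}$, $\mu_2-\mu_2'\in\mathbb{Z}$. For such parameters $$T_{\mu_1,\mu_1';\mu_2,\mu_2'}(X)\phi(t)=\phi\Bigl(\frac{x_{12}+tx_{22}}{x_{11}+tx_{21}}\Bigr)(x_{11}+tx_{21})^{-1+\mu_1-\mu_2\|-1+\mu_1'-\mu_2'}(\det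 X)^{1/2+\mu_2\|1/2+\mu_2'},$$ acting in the space of $C^\infty$ functions $\phi$ on $\mathbb{C}$ such that $\phi(-t^{-1})t^{-1+\mu_1-\mu_2\|-1+\mu_1'-\mu_2'}$ is $C^\infty$-smooth at $0$. **Fourier transform and kernel.** For $F\in C_0^\infty(\mathrm{GL}_2(\mathbb{C}))$, $$T_{\mu_1,\mu_1';\mu_2,\mu_2'}(F)=\int_{\mathrm{GL}_2(\mathbb{C})}F(X)\,T_{\mu_1,\mu_1';\mu_2,\mu_2'}(X)\,|\det X|^{-4}\prod_{k,l=1,2}d\,\mathrm{Re}\,x_{kl}\,d\,\mathrm{Im}\,x_{kl},$$ and its kernel $K=K_F$ is defined by $T_{\mu_1,\mu_1';\mu_2,\mu_2'}(F)\phi(t)=\int_{\mathbb{C}}K(t,s|\mu_1,\mu_1';\mu_2,\mu_2')\phi(s)\,d\,\mathrm{Re}\,s\,d\,\mathrm{Im}\,s$. **Shift operators.** $V_1$ replaces $\mu_1$ by $\mu_1+1$ in $K(t,s|\mu_1,\mu_1';\mu_2,\mu_2')$ leaving the other arguments unchanged; $V_1'$ replaces $\mu_1'$ by $\mu_1'+1$; $V_2$ replaces $\mu_2$ by $\mu_2+1$; $V_2'$ replaces $\mu_2'$ by $\mu_2'+1$. Their inverses shift by $-1$. In the formulas the shift is applied first, then the derivative, then multiplication by the coefficient. **Overalgebra.** For $\sigma,\sigma'\in i\mathbb{R}$ (with $\sigma-\sigma'\in\mathbb{Z}$, so that the powers make sense), $U_{\sigma,\sigma'}$ is the unitary representation of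 $\mathrm{GL}_4(\mathbb{C})$ in $L^2(\mathrm{GL}_2(\mathbb{C}))$ given, for block matrices of size $2+2$, by $$U_{\sigma,\sigma'}\begin{pmatrix} A & B \\ C & D \end{pmatrix}F(X)=F\bigl((A+XC)^{-1}(B+XD)\bigr)\left(\frac{\det(A+XC)\det(B+XD)}{\det X\,\det\begin{pmatrix} A & B \\ C & D \end{pmatrix}}\right)^{-1+\sigma\|-1+\sigma'}.$$ The complexified Lie algebra is $\mathfrak{gl}_4(\mathbb{C})\oplus\mathfrak{gl}_4(\mathbb{C})$. With $M_{kl}$ the matrix units of size 4 and $\varepsilon\in\mathbb{C}$ a complex parameter, the standard generators of the first and second summands act by $e_{kl}F=\frac{\partial}{\partial\varepsilon}\big|_{\varepsilon=0}U_{\sigma,\sigma'}(1+\varepsilon M_{kl})F$ and $\overline{e}_{kl}F=\frac{\partial}{\partial\overline{\varepsilon}}\big|_{\varepsilon=0}U_{\sigma,\sigma'}(1+\varepsilon M_{kl})F$. Explicitly, with $\partial_{pq}=\partial/\partial x_{pq}$ and $\overline{\partial}_{pq}=\partial/\partial\overline{x}_{pq}$, $$e_{14}=\partial_{12}-(-1+\sigma)\frac{x_{21}}{\det X},\qquad e_{32}=-(x_{11}x_{21}\partial_{11}+x_{11}x_{22}\partial_{12}+x_{21}^2\partial_{21}+x_{21}x_{22}\partial_{22})+(-1+\sigma)x_{21},$$ and $\overline{e}_{14}$, $\overline{e}_{32}$ are obtained by replacing $x_{pq},\partial_{pq},\det X,\sigma$ with $\overline{x}_{pq},\overline{\partial}_{pq},\overline{\det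 X},\sigma'$. *)

theory Defs
  imports "HOL-Analysis.Analysis"
begin

text \<open>\<open>C\<^sup>k\<close> and \<open>C\<^sup>\<infinity>\<close> in the real sense, by iterated directional derivatives.  Intended for
  open \<open>S\<close> in a finite-dimensional space.\<close>

primrec Ck_on :: "nat \<Rightarrow> ('a::real_normed_vector \<Rightarrow> 'b::real_normed_vector) \<Rightarrow> 'a set \<Rightarrow> bool" where
  "Ck_on 0 f S \<longleftrightarrow> continuous_on S f"
| "Ck_on (Suc k) f S \<longleftrightarrow>
     f differentiable_on S \<and> (\<forall>v. Ck_on k (\<lambda>x. frechet_derivative f (at x) v) S)"

definition smooth_on :: "('a::real_normed_vector \<Rightarrow> 'b::real_normed_vector) \<Rightarrow> 'a set \<Rightarrow> bool" where
  "smooth_on f S \<longleftrightarrow> (\<forall>k. Ck_on k f S)"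

definition wirtinger :: "(complex \<Rightarrow> complex) \<Rightarrow> complex \<Rightarrow> complex" where
  "wirtinger f z =
     (frechet_derivative f (at z) 1 - \<i> * frechet_derivative f (at z) \<i>) / 2"

definition wirtinger_bar :: "(complex \<Rightarrow> complex) \<Rightarrow> complex \<Rightarrow> complex" where
  "wirtinger_bar f z =
     (frechet_derivative f (at z) 1 + \<i> * frechet_derivative f (at z) \<i>) / 2"

text \<open>\<open>bipow z \<nu> \<nu>'\<close> is \<open>z\<close> to the power \<open>\<nu>\<parallel>\<nu>'\<close>.  It is meant for \<open>z \<noteq> 0\<close> and
  \<open>\<nu> - \<nu>' \<in> \<int>\<close>; the floor only converts the integer \<open>\<nu>' - \<nu>\<close> to type \<open>int\<close>.\<close>

definition bipow :: "complex \<Rightarrow> complex \<Rightarrow> complex \<Rightarrow> complex" where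
  "bipow z \<nu> \<nu>' = of_real (norm z) powr (2 * \<nu>) * cnj z powi \<lfloor>Re (\<nu>' - \<nu>)\<rfloor>"

type_synonym mat2 = "complex^2^2"
type_synonym mat4 = "complex^4^4"

definition GL2 :: "mat2 set" where
  "GL2 = {X. invertible X}"

text \<open>Compactly supported smooth functions on the open set \<open>GL2\<close>, extended by zero to all
  matrices.\<close>

definition test_functions :: "(mat2 \<Rightarrow> complex) set" where
  "test_functions =
     {F. smooth_on F GL2 \<and> (\<exists>C. compact C \<and> C \<subseteq> GL2 \<and> (\<forall>X. X \<notin> C \<longrightarrow> F X = 0))}"

definition Delta :: "(complex \<times> complex \<times> complex \<times> complex) set" where
  "Delta = {(\<mu>1, \<mu>1', \<mu>2, \<mu>2'). \<mu>1 - \<mu>1' \<in> \<int> \<and> \<mu>2 - \<mu>2' \<in> \<int>}"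

definition ps_space ::
  "complex \<Rightarrow> complex \<Rightarrow> complex \<Rightarrow> complex \<Rightarrow> (complex \<Rightarrow> complex) set" where
  "ps_space \<mu>1 \<mu>1' \<mu>2 \<mu>2' =
     {\<phi>. smooth_on \<phi> UNIV \<and>
         (\<exists>\<psi>. smooth_on \<psi> UNIV \<and>
              (\<forall>t. t \<noteq> 0 \<longrightarrow> \<psi> t = \<phi> (- inverse t) * bipow t (-1 + \<mu>1 - \<mu>2) (-1 + \<mu>1' - \<mu>2')))}"

text \<open>The formula is meant for \<open>x\<^sub>1\<^sub>1 + t x\<^sub>2\<^sub>1 \<noteq> 0\<close> (elsewhere the operator is defined by continuity).
  For fixed \<open>t\<close> the exceptional matrices form a null set, so the value taken there does not
  affect \<open>ps_integrated\<close>.\<close>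

definition ps_op ::
  "complex \<Rightarrow> complex \<Rightarrow> complex \<Rightarrow> complex \<Rightarrow> mat2 \<Rightarrow> (complex \<Rightarrow> complex) \<Rightarrow> complex \<Rightarrow> complex" where
  "ps_op \<mu>1 \<mu>1' \<mu>2 \<mu>2' X \<phi> t =
     \<phi> ((X$1$2 + t * X$2$2) / (X$1$1 + t * X$2$1))
     * bipow (X$1$1 + t * X$2$1) (-1 + \<mu>1 - \<mu>2) (-1 + \<mu>1' - \<mu>2')
     * bipow (det X) (1/2 + \<mu>2) (1/2 + \<mu>2')"

definition ps_integrated ::
  "complex \<Rightarrow> complex \<Rightarrow> complex \<Rightarrow> complex \<Rightarrow> (mat2 \<Rightarrow> complex) \<Rightarrow>
     (complex \<Rightarrow> complex) \<Rightarrow> complex \<Rightarrow> complex" where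
  "ps_integrated \<mu>1 \<mu>1' \<mu>2 \<mu>2' F \<phi> t =
     (LINT X:GL2|lborel. F X * ps_op \<mu>1 \<mu>1' \<mu>2 \<mu>2' X \<phi> t / of_real (norm (det X) ^ 4))"

definition is_kernel ::
  "(complex \<Rightarrow> complex) set \<Rightarrow> ((complex \<Rightarrow> complex) \<Rightarrow> complex \<Rightarrow> complex) \<Rightarrow>
     (complex \<Rightarrow> complex \<Rightarrow> complex) \<Rightarrow> bool" where
  "is_kernel W A K \<longleftrightarrow>
     (\<forall>\<phi>\<in>W. \<forall>t. integrable lborel (\<lambda>s. K t s * \<phi> s) \<and> A \<phi> t = (LINT s|lborel. K t s * \<phi> s))"

type_synonym kernel =
  "complex \<Rightarrow> complex \<Rightarrow> complex \<Rightarrow> complex \<Rightarrow> complex \<Rightarrow> complex \<Rightarrow> complex"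

text \<open>\<open>K_F F t s \<mu>\<^sub>1 \<mu>\<^sub>1' \<mu>\<^sub>2 \<mu>\<^sub>2'\<close>.  The integral identity determines the kernel only almost
  everywhere in \<open>s\<close>; continuity singles out the representative for which pointwise values and
  derivatives make sense.\<close>

definition K_F :: "(mat2 \<Rightarrow> complex) \<Rightarrow> kernel" where
  "K_F F t s \<mu>1 \<mu>1' \<mu>2 \<mu>2' =
     (THE K. continuous_on UNIV (\<lambda>(t, s). K t s) \<and>
             is_kernel (ps_space \<mu>1 \<mu>1' \<mu>2 \<mu>2') (ps_integrated \<mu>1 \<mu>1' \<mu>2 \<mu>2' F) K) t s"

text \<open>Indices: in type \<open>2\<close> one has \<open>2 = 0\<close> and in type \<open>4\<close> one has \<open>4 = 0\<close>, so \<open>1, 2\<close> and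
  \<open>1, 2, 3, 4\<close> enumerate the types.\<close>

definition upper_index :: "2 \<Rightarrow> 4" where
  "upper_index i = (if i = 1 then 1 else 2)"

definition lower_index :: "2 \<Rightarrow> 4" where
  "lower_index i = (if i = 1 then 3 else 4)"

definition block :: "(2 \<Rightarrow> 4) \<Rightarrow> (2 \<Rightarrow> 4) \<Rightarrow> mat4 \<Rightarrow> mat2" where
  "block p q g = (\<chi> i j. g $ p i $ q j)"

definition U_rep :: "complex \<Rightarrow> complex \<Rightarrow> mat4 \<Rightarrow> (mat2 \<Rightarrow> complex) \<Rightarrow> mat2 \<Rightarrow> complex" where
  "U_rep \<sigma> \<sigma>' g F X =
     (let A = block upper_index upper_index g; B = block upper_index lower_index g;
          C = block lower_index upper_index g; D = block lower_index lower_index g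
      in F (matrix_inv (A + X ** C) ** (B + X ** D))
         * bipow (det (A + X ** C) * det (B + X ** D) / (det X * det g)) (-1 + \<sigma>) (-1 + \<sigma>'))"

definition one_plus_unit :: "4 \<Rightarrow> 4 \<Rightarrow> complex \<Rightarrow> mat4" where
  "one_plus_unit k l \<epsilon> = mat 1 + (\<chi> i j. if i = k \<and> j = l then \<epsilon> else 0)"

definition e_gen :: "complex \<Rightarrow> complex \<Rightarrow> 4 \<Rightarrow> 4 \<Rightarrow> (mat2 \<Rightarrow> complex) \<Rightarrow> mat2 \<Rightarrow> complex" where
  "e_gen \<sigma> \<sigma>' k l F X = wirtinger (\<lambda>\<epsilon>. U_rep \<sigma> \<sigma>' (one_plus_unit k l \<epsilon>) F X) 0"

definition e_gen_bar :: "complex \<Rightarrow> complex \<Rightarrow> 4 \<Rightarrow> 4 \<Rightarrow> (mat2 \<Rightarrow> complex) \<Rightarrow> mat2 \<Rightarrow> complex" where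
  "e_gen_bar \<sigma> \<sigma>' k l F X = wirtinger_bar (\<lambda>\<epsilon>. U_rep \<sigma> \<sigma>' (one_plus_unit k l \<epsilon>) F X) 0"

definition V1 :: "kernel \<Rightarrow> kernel" where
  "V1 K t s \<mu>1 \<mu>1' \<mu>2 \<mu>2' = K t s (\<mu>1 + 1) \<mu>1' \<mu>2 \<mu>2'"
definition V1' :: "kernel \<Rightarrow> kernel" where
  "V1' K t s \<mu>1 \<mu>1' \<mu>2 \<mu>2' = K t s \<mu>1 (\<mu>1' + 1) \<mu>2 \<mu>2'"
definition V2 :: "kernel \<Rightarrow> kernel" where
  "V2 K t s \<mu>1 \<mu>1' \<mu>2 \<mu>2' = K t s \<mu>1 \<mu>1' (\<mu>2 + 1) \<mu>2'"
definition V2' :: "kernel \<Rightarrow> kernel" where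
  "V2' K t s \<mu>1 \<mu>1' \<mu>2 \<mu>2' = K t s \<mu>1 \<mu>1' \<mu>2 (\<mu>2' + 1)"

definition V1_inv :: "kernel \<Rightarrow> kernel" where
  "V1_inv K t s \<mu>1 \<mu>1' \<mu>2 \<mu>2' = K t s (\<mu>1 - 1) \<mu>1' \<mu>2 \<mu>2'"
definition V1'_inv :: "kernel \<Rightarrow> kernel" where
  "V1'_inv K t s \<mu>1 \<mu>1' \<mu>2 \<mu>2' = K t s \<mu>1 (\<mu>1' - 1) \<mu>2 \<mu>2'"
definition V2_inv :: "kernel \<Rightarrow> kernel" where
  "V2_inv K t s \<mu>1 \<mu>1' \<mu>2 \<mu>2' = K t s \<mu>1 \<mu>1' (\<mu>2 - 1) \<mu>2'"
definition V2'_inv :: "kernel \<Rightarrow> kernel" where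
  "V2'_inv K t s \<mu>1 \<mu>1' \<mu>2 \<mu>2' = K t s \<mu>1 \<mu>1' \<mu>2 (\<mu>2' - 1)"

definition d_t :: "kernel \<Rightarrow> kernel" where
  "d_t K t s \<mu>1 \<mu>1' \<mu>2 \<mu>2' = wirtinger (\<lambda>t. K t s \<mu>1 \<mu>1' \<mu>2 \<mu>2') t"
definition d_s :: "kernel \<Rightarrow> kernel" where
  "d_s K t s \<mu>1 \<mu>1' \<mu>2 \<mu>2' = wirtinger (\<lambda>s. K t s \<mu>1 \<mu>1' \<mu>2 \<mu>2') s"
definition d_t_bar :: "kernel \<Rightarrow> kernel" where
  "d_t_bar K t s \<mu>1 \<mu>1' \<mu>2 \<mu>2' = wirtinger_bar (\<lambda>t. K t s \<mu>1 \<mu>1' \<mu>2 \<mu>2') t"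
definition d_s_bar :: "kernel \<Rightarrow> kernel" where
  "d_s_bar K t s \<mu>1 \<mu>1' \<mu>2 \<mu>2' = wirtinger_bar (\<lambda>s. K t s \<mu>1 \<mu>1' \<mu>2 \<mu>2') s"

definition E14 :: "complex \<Rightarrow> kernel \<Rightarrow> kernel" where
  "E14 \<sigma> K t s \<mu>1 \<mu>1' \<mu>2 \<mu>2' =
     (-1/2 - \<sigma> + \<mu>1) / (\<mu>1 - \<mu>2) * d_s (V1_inv K) t s \<mu>1 \<mu>1' \<mu>2 \<mu>2'
   + (-1/2 - \<sigma> + \<mu>2) / (\<mu>1 - \<mu>2) * d_t (V2_inv K) t s \<mu>1 \<mu>1' \<mu>2 \<mu>2'"

definition E14_bar :: "complex \<Rightarrow> kernel \<Rightarrow> kernel" where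
  "E14_bar \<sigma>' K t s \<mu>1 \<mu>1' \<mu>2 \<mu>2' =
     (-1/2 - \<sigma>' + \<mu>1') / (\<mu>1' - \<mu>2') * d_s_bar (V1'_inv K) t s \<mu>1 \<mu>1' \<mu>2 \<mu>2'
   + (-1/2 - \<sigma>' + \<mu>2') / (\<mu>1' - \<mu>2') * d_t_bar (V2'_inv K) t s \<mu>1 \<mu>1' \<mu>2 \<mu>2'"

definition E32 :: "complex \<Rightarrow> kernel \<Rightarrow> kernel" where
  "E32 \<sigma> K t s \<mu>1 \<mu>1' \<mu>2 \<mu>2' =
     (1/2 + \<mu>1 + \<sigma>) / (\<mu>1 - \<mu>2) * d_t (V1 K) t s \<mu>1 \<mu>1' \<mu>2 \<mu>2'
   + (1/2 + \<mu>2 + \<sigma>) / (\<mu>1 - \<mu>2) * d_s (V2 K) t s \<mu>1 \<mu>1' \<mu>2 \<mu>2'"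

definition E32_bar :: "complex \<Rightarrow> kernel \<Rightarrow> kernel" where
  "E32_bar \<sigma>' K t s \<mu>1 \<mu>1' \<mu>2 \<mu>2' =
     (1/2 + \<mu>1' + \<sigma>') / (\<mu>1' - \<mu>2') * d_t_bar (V1' K) t s \<mu>1 \<mu>1' \<mu>2 \<mu>2'
   + (1/2 + \<mu>2' + \<sigma>') / (\<mu>1' - \<mu>2') * d_s_bar (V2' K) t s \<mu>1 \<mu>1' \<mu>2 \<mu>2'"

end

theory Submission
  imports Defs
begin

text \<open>Fix \<open>t\<close> and put \<open>u = x\<^sub>1\<^sub>1 + t x\<^sub>2\<^sub>1\<close>, \<open>s = (x\<^sub>1\<^sub>2 + t x\<^sub>2\<^sub>2) / u\<close>, \<open>w = x\<^sub>2\<^sub>1\<close>, \<open>v = x\<^sub>2\<^sub>2 - s w\<close>.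
  Then \<open>X\<close> is the product of the unipotent upper triangular matrix with entry \<open>-t\<close>, the lower
  triangular matrix with diagonal \<open>u, v\<close> and corner \<open>w\<close>, and the unipotent upper triangular matrix
  with entry \<open>s\<close> (\<open>Phi\<close>); in particular \<open>det X = u v\<close>, and the Jacobian of the substitution is
  \<open>|u|\<^sup>2\<close>.  Since \<open>\<phi>\<close> is evaluated at \<open>s\<close>, the substitution exhibits the kernel:
  \<open>K\<^sub>F(t, s)\<close> is the integral over \<open>(u, v, w)\<close> of \<open>F(Phi)\<close> times
  \<open>u\<close> to the power \<open>\<mu>\<^sub>1 - 3/2 \<parallel> \<mu>\<^sub>1' - 3/2\<close> times \<open>v\<close> to the power \<open>\<mu>\<^sub>2 - 3/2 \<parallel> \<mu>\<^sub>2' - 3/2\<close>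
  (\<open>kernel_exists\<close>, \<open>K_F_eq\<close>).  The support of \<open>F\<close> stays away from singular matrices, so this
  integrand is compactly supported in \<open>u v \<noteq> 0\<close>, and everything that follows is calculus with
  compactly supported functions.

  Shifting \<open>\<mu>\<^sub>1\<close> or \<open>\<mu>\<^sub>2\<close> by one multiplies the integrand by \<open>u\<close> or \<open>v\<close> or divides it by them, and
  \<open>\<partial>/\<partial>t\<close>, \<open>\<partial>/\<partial>s\<close> act under the integral sign (\<open>wd_kernel_int\<close>).  By the chain rule
  \<open>\<partial>\<^sub>s F = u F\<^sub>1\<^sub>2 + w \<partial>\<^sub>v F\<close> and \<open>\<partial>\<^sub>t F = - v F\<^sub>1\<^sub>2 - w \<partial>\<^sub>u F\<close>.  Integrating by parts in \<open>u\<close> and \<open>v\<close>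
  turns the second terms into multiples of \<open>F\<close> whose coefficients are the exponents.  The
  coefficients of \<open>E\<^sub>1\<^sub>4\<close> and \<open>E\<^sub>3\<^sub>2\<close> are those for which the combination of the two derivatives
  reproduces the generator (\<open>kernel_int_gen14\<close>, \<open>kernel_int_gen32\<close>); for \<open>e\<^sub>3\<^sub>2\<close> the Euler field
  \<open>u \<partial>\<^sub>u + v \<partial>\<^sub>v + w \<partial>\<^sub>w\<close> appears and is integrated by parts as well.

  The kernel is defined as the unique continuous solution of an integral identity, so uniqueness is
  needed too.  Instead of bump functions, the proof uses explicit real-analytic sections of the
  principal series that concentrate at a point of the projective line (\<open>peak\<close>, \<open>kernel_unique\<close>).

  The holomorphic and antiholomorphic halves of the statement are treated together: a flag \<open>c\<close>
  selects \<open>z\<close> or its conjugate (\<open>cj\<close>) and the corresponding Wirtinger derivative (\<open>wd\<close>).\<close>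

section \<open>Lebesgue measure on complex matrices\<close>

text \<open>A linear bijection \<open>f\<close> with adjoint \<open>g\<close> that permutes the standard bases maps boxes to boxes of the
  same volume.  This identifies \<open>lborel\<close> on matrices with an iterated product of \<open>lborel\<close> on the
  complex plane, where Fubini applies.\<close>

lemma lborel_eq_distr_isometry:
  fixes f :: "'a::euclidean_space \<Rightarrow> 'b::euclidean_space" and g :: "'b \<Rightarrow> 'a"
  assumes inner: "\<And>x y. f x \<bullet> y = x \<bullet> g y"
    and fg: "\<And>y. f (g y) = y" and gf: "\<And>x. g (f x) = x"
    and gB: "\<And>b. b \<in> Basis \<Longrightarrow> g b \<in> Basis" and fB: "\<And>b. b \<in> Basis \<Longrightarrow> f b \<in> Basis"
    and [measurable]: "f \<in> borel_measurable borel"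
  shows "distr lborel borel f = lborel"
proof (rule lborel_eqI[symmetric])
  fix l u :: 'b assume le: "\<And>b. b \<in> Basis \<Longrightarrow> l \<bullet> b \<le> u \<bullet> b"
  have gi: "g x \<bullet> y = x \<bullet> f y" for x y
    by (metis inner inner_commute)
  have bij: "bij_betw g Basis Basis"
    by (rule bij_betwI[where g = f]) (auto simp: fg gf gB fB)
  have vim: "f -` box l u = box (g l) (g u)"
  proof (intro set_eqI iffI)
    fix x assume "x \<in> f -` box l u"
    then show "x \<in> box (g l) (g u)"
      by (auto simp: box_def inner gi) (metis fB gf)+
  next
    fix x assume "x \<in> box (g l) (g u)"
    then show "x \<in> f -` box l u"
      using gB by (auto simp: box_def inner gi) (metis fg gB)+
  qed
  have "emeasure (distr lborel borel f) (box l u) = emeasure lborel (box (g l) (g u))"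
    by (subst emeasure_distr) (auto simp: vim)
  also have "\<dots> = (\<Prod>b\<in>Basis. (g u - g l) \<bullet> b)"
    using le fB by (subst emeasure_lborel_box) (auto simp: gi)
  also have "(\<Prod>b\<in>Basis. (g u - g l) \<bullet> b) = (\<Prod>b\<in>Basis. (u - l) \<bullet> b)"
    by (subst prod.reindex_bij_betw[OF bij, symmetric]) (auto simp: inner_diff_left gi fg)
  finally show "emeasure (distr lborel borel f) (box l u) = (\<Prod>b\<in>Basis. (u - l) \<bullet> b)" .
qed simp

lemma nn_integral_complex_Complex:
  fixes f :: "complex \<Rightarrow> ennreal"
  assumes [measurable]: "f \<in> borel_measurable borel"
  shows "(\<integral>\<^sup>+z. f z \<partial>lborel) = (\<integral>\<^sup>+x. \<integral>\<^sup>+y. f (Complex x y) \<partial>lborel \<partial>lborel)"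
proof -
  have C[measurable]: "(\<lambda>(x, y). Complex x y) \<in> borel_measurable borel"
    by (intro borel_measurable_continuous_onI) (auto simp: Complex_eq case_prod_unfold intro!: continuous_intros)
  have [simp]: "Complex 1 0 = 1" "Complex 0 1 = \<i>" by (simp_all add: complex_eq_iff)
  have "distr lborel borel (\<lambda>(x, y). Complex x y) = lborel"
    by (rule lborel_eq_distr_isometry[where g = "\<lambda>z. (Re z, Im z)"])
       (auto simp: inner_complex_def Basis_complex_def Basis_prod_def)
  then have "(\<integral>\<^sup>+z. f z \<partial>lborel) = (\<integral>\<^sup>+z. f z \<partial>distr lborel borel (\<lambda>(x, y). Complex x y))"
    by simp
  also have "\<dots> = (\<integral>\<^sup>+z. f (Complex (fst z) (snd z)) \<partial>lborel)"
    using C by (subst nn_integral_distr) (auto simp: case_prod_unfold)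
  also have "\<dots> = (\<integral>\<^sup>+z. f (Complex (fst z) (snd z)) \<partial>(lborel \<Otimes>\<^sub>M lborel))"
    by (simp add: lborel_prod)
  also have "\<dots> = (\<integral>\<^sup>+x. \<integral>\<^sup>+y. f (Complex x y) \<partial>lborel \<partial>lborel)"
  proof -
    have "(\<lambda>z. f (Complex (fst z) (snd z))) \<in> borel_measurable (lborel \<Otimes>\<^sub>M lborel)"
      using measurable_compose[OF C assms] by (simp add: lborel_prod case_prod_unfold)
    from lborel.nn_integral_fst[OF this] show ?thesis by simp
  qed
  finally show ?thesis .
qed

text \<open>Multiplication by \<open>c = \<alpha> + \<i>\<beta>\<close> with \<open>\<alpha> \<noteq> 0\<close> is a composition of shears and scalings of the
  coordinate axes, so that one-dimensional substitutions suffice.  If \<open>\<alpha> = 0\<close>, then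
  \<open>c = (1 + \<i>) d\<close>, where both factors have non-zero real part.\<close>

lemma nn_integral_complex_scale:
  fixes f :: "complex \<Rightarrow> ennreal" and c :: complex
  assumes [measurable]: "f \<in> borel_measurable borel" and "c \<noteq> 0"
  shows "(\<integral>\<^sup>+z. f z \<partial>lborel) = ennreal ((norm c)\<^sup>2) * (\<integral>\<^sup>+z. f (c * z) \<partial>lborel)"
proof -
  have Re0: "(\<integral>\<^sup>+z. f z \<partial>lborel) = ennreal ((norm c)\<^sup>2) * (\<integral>\<^sup>+z. f (c * z) \<partial>lborel)"
    if [measurable]: "f \<in> borel_measurable borel" and c: "Re c \<noteq> 0" for c and f :: "complex \<Rightarrow> ennreal"
  proof -
    define \<alpha> \<beta> where "\<alpha> = Re c" and "\<beta> = Im c"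
    have \<alpha>: "\<alpha> \<noteq> 0" using c by (simp add: \<alpha>_def)
    define \<gamma> where "\<gamma> = (\<alpha>\<^sup>2 + \<beta>\<^sup>2) / \<alpha>"
    have pos: "\<alpha>\<^sup>2 + \<beta>\<^sup>2 > 0" using \<alpha> by (simp add: sum_power2_gt_zero_iff)
    have \<gamma>: "\<gamma> \<noteq> 0" using \<alpha> pos by (simp add: \<gamma>_def)
    have nc: "(norm c)\<^sup>2 = \<bar>\<alpha>\<bar> * \<bar>\<gamma>\<bar>"
      using \<alpha> pos by (simp add: cmod_power2 \<alpha>_def[symmetric] \<beta>_def[symmetric] \<gamma>_def abs_mult[symmetric])
    have Cm[measurable]: "(\<lambda>z. Complex (a z) (b z)) \<in> borel_measurable M"
      if [measurable]: "a \<in> borel_measurable M" "b \<in> borel_measurable M" for a b and M :: "'m measure"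
      unfolding Complex_eq by measurable
    have "(\<integral>\<^sup>+z. f (c * z) \<partial>lborel) = (\<integral>\<^sup>+x. \<integral>\<^sup>+y. f (c * Complex x y) \<partial>lborel \<partial>lborel)"
      by (rule nn_integral_complex_Complex) measurable
    also have "\<dots> = (\<integral>\<^sup>+y. \<integral>\<^sup>+x. f (Complex (\<alpha> * x - \<beta> * y) (\<beta> * x + \<alpha> * y)) \<partial>lborel \<partial>lborel)"
      by (subst lborel_pair.Fubini') (auto simp: complex_mult Complex_eq[symmetric] \<alpha>_def \<beta>_def mult.commute complex_eq_iff intro!: nn_integral_cong arg_cong[where f = f])
    finally have 1: "(\<integral>\<^sup>+z. f (c * z) \<partial>lborel) =
      (\<integral>\<^sup>+y. \<integral>\<^sup>+x. f (Complex (\<alpha> * x - \<beta> * y) (\<beta> * x + \<alpha> * y)) \<partial>lborel \<partial>lborel)" .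
    have 2: "(\<integral>\<^sup>+x. f (Complex x (\<beta> / \<alpha> * x + \<gamma> * y)) \<partial>lborel) =
      ennreal \<bar>\<alpha>\<bar> * (\<integral>\<^sup>+x. f (Complex (\<alpha> * x - \<beta> * y) (\<beta> * x + \<alpha> * y)) \<partial>lborel)" for y
    proof -
      have e: "\<beta> / \<alpha> * (- (\<beta> * y) + \<alpha> * x) + \<gamma> * y = \<beta> * x + \<alpha> * y" for x
        using \<alpha> unfolding \<gamma>_def by (simp add: field_simps power2_eq_square)
      have "(\<integral>\<^sup>+x. f (Complex x (\<beta> / \<alpha> * x + \<gamma> * y)) \<partial>lborel) =
        ennreal \<bar>\<alpha>\<bar> * (\<integral>\<^sup>+x. f (Complex (- (\<beta> * y) + \<alpha> * x) (\<beta> / \<alpha> * (- (\<beta> * y) + \<alpha> * x) + \<gamma> * y)) \<partial>lborel)"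
        using \<alpha> by (intro nn_integral_real_affine) measurable
      also have "\<dots> = ennreal \<bar>\<alpha>\<bar> * (\<integral>\<^sup>+x. f (Complex (\<alpha> * x - \<beta> * y) (\<beta> * x + \<alpha> * y)) \<partial>lborel)"
        unfolding e by (simp add: algebra_simps)
      finally show ?thesis .
    qed
    have 3: "(\<integral>\<^sup>+y. f (Complex x y) \<partial>lborel) = ennreal \<bar>\<gamma>\<bar> * (\<integral>\<^sup>+y. f (Complex x (\<beta> / \<alpha> * x + \<gamma> * y)) \<partial>lborel)" for x
      using \<gamma> by (intro nn_integral_real_affine) measurable
    have "(\<integral>\<^sup>+z. f z \<partial>lborel) = (\<integral>\<^sup>+x. \<integral>\<^sup>+y. f (Complex x y) \<partial>lborel \<partial>lborel)"
      by (rule nn_integral_complex_Complex) measurable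
    also have "\<dots> = ennreal \<bar>\<gamma>\<bar> * (\<integral>\<^sup>+x. \<integral>\<^sup>+y. f (Complex x (\<beta> / \<alpha> * x + \<gamma> * y)) \<partial>lborel \<partial>lborel)"
      unfolding 3 by (rule nn_integral_cmult) measurable
    also have "(\<integral>\<^sup>+x. \<integral>\<^sup>+y. f (Complex x (\<beta> / \<alpha> * x + \<gamma> * y)) \<partial>lborel \<partial>lborel) =
        (\<integral>\<^sup>+y. \<integral>\<^sup>+x. f (Complex x (\<beta> / \<alpha> * x + \<gamma> * y)) \<partial>lborel \<partial>lborel)"
      by (rule lborel_pair.Fubini') measurable
    also have "\<dots> = ennreal \<bar>\<alpha>\<bar> * (\<integral>\<^sup>+z. f (c * z) \<partial>lborel)"
      unfolding 1 2 by (rule nn_integral_cmult) measurable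
    finally show ?thesis
      by (simp add: nc ennreal_mult mult_ac)
  qed
  show ?thesis
  proof (cases "Re c = 0")
    case False
    then show ?thesis using Re0[of f c] by simp
  next
    case True
    define d where "d = c / (1 + \<i>)"
    have ne: "(1 + \<i> :: complex) \<noteq> 0" by (simp add: complex_eq_iff)
    have c: "c = (1 + \<i>) * d" using ne by (simp add: d_def)
    have "Re d \<noteq> 0"
    proof
      assume "Re d = 0"
      then have "Re c = - Im d" by (simp add: c)
      with True \<open>Re d = 0\<close> have "d = 0" by (simp add: complex_eq_iff)
      with c \<open>c \<noteq> 0\<close> show False by simp
    qed
    then have "(\<integral>\<^sup>+z. f z \<partial>lborel) =
        ennreal ((norm (1 + \<i>))\<^sup>2) * (ennreal ((norm d)\<^sup>2) * (\<integral>\<^sup>+z. f ((1 + \<i>) * (d * z)) \<partial>lborel))"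
      by (subst Re0[of f "1 + \<i>"]) (simp_all add: Re0[of "\<lambda>z. f ((1 + \<i>) * z)" d])
    then show ?thesis
      by (simp add: c norm_mult power_mult_distrib ennreal_mult mult_ac)
  qed
qed

lemma lborel_distr_translation: "distr lborel borel (\<lambda>z. t + z) = (lborel :: 'a::euclidean_space measure)"
  using lborel_affine[of 1 t] by (simp add: density_1)

lemma nn_integral_translation:
  fixes f :: "'a::euclidean_space \<Rightarrow> ennreal"
  assumes [measurable]: "f \<in> borel_measurable borel"
  shows "(\<integral>\<^sup>+z. f z \<partial>lborel) = (\<integral>\<^sup>+z. f (t + z) \<partial>lborel)"
proof -
  have "(\<integral>\<^sup>+z. f z \<partial>lborel) = (\<integral>\<^sup>+z. f z \<partial>distr lborel borel (\<lambda>z. t + z))"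
    by (simp add: lborel_distr_translation)
  then show ?thesis by (simp add: nn_integral_distr)
qed

definition mk2 :: "complex \<Rightarrow> complex \<Rightarrow> complex \<Rightarrow> complex \<Rightarrow> mat2" where
  "mk2 a b c d = (\<chi> i j. if i = 1 then (if j = 1 then a else b) else (if j = 1 then c else d))"

lemma mk2_nth [simp]: "mk2 a b c d $ 1 $ 1 = a" "mk2 a b c d $ 1 $ 2 = b"
  "mk2 a b c d $ 2 $ 1 = c" "mk2 a b c d $ 2 $ 2 = d"
  by (auto simp: mk2_def)

lemma mk2_nth_eta [simp]: "mk2 (X $ 1 $ 1) (X $ 1 $ 2) (X $ 2 $ 1) (X $ 2 $ 2) = X"
  by (simp add: vec_eq_iff forall_2)

lemma mk2_eq_iff: "mk2 a b c d = mk2 a' b' c' d' \<longleftrightarrow> a = a' \<and> b = b' \<and> c = c' \<and> d = d'"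
  by (auto simp: vec_eq_iff forall_2)

lemma det_mk2 [simp]: "det (mk2 a b c d) = a * d - b * c"
  by (simp add: det_2)

lemma GL2_iff: "X \<in> GL2 \<longleftrightarrow> det X \<noteq> 0"
  by (simp add: GL2_def invertible_det_nz)

lemma bounded_linear_mk2:
  "bounded_linear (\<lambda>x. mk2 (fst (fst x)) (fst (snd x)) (snd (fst x)) (snd (snd x)))"
  by (intro linear_conv_bounded_linear[THEN iffD1] linearI) (simp_all add: vec_eq_iff forall_2)

lemma has_derivative_mk2 [derivative_intros]:
  assumes "(a has_derivative a') (at x within S)" "(b has_derivative b') (at x within S)"
    "(c has_derivative c') (at x within S)" "(d has_derivative d') (at x within S)"
  shows "((\<lambda>x. mk2 (a x) (b x) (c x) (d x)) has_derivative (\<lambda>h. mk2 (a' h) (b' h) (c' h) (d' h))) (at x within S)"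
  using bounded_linear.has_derivative[OF bounded_linear_mk2
      has_derivative_Pair[OF has_derivative_Pair[OF assms(1,3)] has_derivative_Pair[OF assms(2,4)]]]
  by simp

lemma continuous_on_mk2 [continuous_intros]:
  assumes "continuous_on S a" "continuous_on S b" "continuous_on S c" "continuous_on S d"
  shows "continuous_on S (\<lambda>x. mk2 (a x) (b x) (c x) (d x))"
  using bounded_linear.continuous_on[OF bounded_linear_mk2
      continuous_on_Pair[OF continuous_on_Pair[OF assms(1,3)] continuous_on_Pair[OF assms(2,4)]]]
  by simp

lemma borel_measurable_mk2 [measurable (raw)]:
  assumes [measurable]: "a \<in> borel_measurable M" "b \<in> borel_measurable M" "c \<in> borel_measurable M" "d \<in> borel_measurable M"
  shows "(\<lambda>x. mk2 (a x) (b x) (c x) (d x)) \<in> borel_measurable M"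
proof -
  have "(\<lambda>x. mk2 (fst (fst x)) (fst (snd x)) (snd (fst x)) (snd (snd x))) \<in> borel_measurable borel"
    by (intro borel_measurable_continuous_onI bounded_linear.continuous_on[OF bounded_linear_mk2] continuous_on_id)
  from measurable_compose[OF _ this, of "\<lambda>x. ((a x, c x), (b x, d x))" M] show ?thesis
    by simp
qed

lemma nn_integral_prod:
  fixes f :: "'a::euclidean_space \<times> 'b::euclidean_space \<Rightarrow> ennreal"
  assumes "f \<in> borel_measurable borel"
  shows "(\<integral>\<^sup>+x. f x \<partial>lborel) = (\<integral>\<^sup>+x. \<integral>\<^sup>+y. f (x, y) \<partial>lborel \<partial>lborel)"
  using lborel.nn_integral_fst[of f "lborel :: 'a measure"] assms by (simp add: lborel_prod)

text \<open>The measurability rules for pairs expect the product \<open>\<sigma>\<close>-algebra; here the product carries its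
  Borel \<open>\<sigma>\<close>-algebra.\<close>

lemma borel_measurable_fst_snd [measurable]:
  "fst \<in> borel_measurable (borel :: ('a::second_countable_topology \<times> 'b::second_countable_topology) measure)"
  "snd \<in> borel_measurable (borel :: ('a \<times> 'b) measure)"
  by (auto simp: borel_prod[symmetric])

lemma nn_integral_mat2:
  fixes f :: "mat2 \<Rightarrow> ennreal"
  assumes [measurable]: "f \<in> borel_measurable borel"
  shows "(\<integral>\<^sup>+X. f X \<partial>lborel) = (\<integral>\<^sup>+z. \<integral>\<^sup>+d. \<integral>\<^sup>+b. f (mk2 (snd z) b (fst z) d) \<partial>lborel \<partial>lborel \<partial>lborel)"
proof -
  let ?f = "\<lambda>x :: (complex \<times> complex) \<times> (complex \<times> complex). mk2 (snd (fst x)) (snd (snd x)) (fst (fst x)) (fst (snd x))"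
  let ?g = "\<lambda>X :: mat2. ((X $ 2 $ 1, X $ 1 $ 1), (X $ 2 $ 2, X $ 1 $ 2))"
  have B: "Basis = {axis i (axis j (z :: complex)) | (i :: 2) (j :: 2) z. z \<in> {1, \<i>}}"
    unfolding Basis_vec_def Basis_complex_def by auto
  have "distr lborel borel ?f = lborel"
  proof (rule lborel_eq_distr_isometry[where g = ?g])
    show "?f x \<bullet> y = x \<bullet> ?g y" for x y
      by (cases x) (simp add: inner_vec_def sum_2 inner_prod_def algebra_simps)
    show "?g b \<in> Basis" if b: "b \<in> Basis" for b
    proof -
      obtain i j z where "b = axis i (axis j z)" "z \<in> {1, \<i>}" using b unfolding B by blast
      then show ?thesis
        using exhaust_2[of i] exhaust_2[of j] by (auto simp: axis_def Basis_prod_def Basis_complex_def zero_prod_def)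
    qed
    show "?f b \<in> Basis" if "b \<in> Basis" for b
    proof -
      have ax: "mk2 0 0 0 z = axis 2 (axis 2 z)" "mk2 0 0 z 0 = axis 2 (axis 1 z)"
        "mk2 0 z 0 0 = axis 1 (axis 2 z)" "mk2 z 0 0 0 = axis 1 (axis 1 z)" for z
        by (auto simp: vec_eq_iff forall_2 axis_def)
      have axB: "axis i (axis j z) \<in> (Basis :: mat2 set)" if "z \<in> {1, \<i>}" for i j z
        using that unfolding B by blast
      show ?thesis
        using that by (auto simp: Basis_prod_def Basis_complex_def ax axB)
    qed
  qed (auto simp: vec_eq_iff forall_2)
  then have "(\<integral>\<^sup>+X. f X \<partial>lborel) = (\<integral>\<^sup>+X. f X \<partial>distr lborel borel ?f)"
    by simp
  also have "\<dots> = (\<integral>\<^sup>+x. f (?f x) \<partial>lborel)"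
    by (rule nn_integral_distr) measurable
  also have "\<dots> = (\<integral>\<^sup>+z. \<integral>\<^sup>+y. f (?f (z, y)) \<partial>lborel \<partial>lborel)"
    by (rule nn_integral_prod) measurable
  also have "\<dots> = (\<integral>\<^sup>+z. \<integral>\<^sup>+d. \<integral>\<^sup>+b. f (mk2 (snd z) b (fst z) d) \<partial>lborel \<partial>lborel \<partial>lborel)"
    by (intro nn_integral_cong, subst nn_integral_prod) auto
  finally show ?thesis .
qed

section \<open>Triangular coordinates\<close>

type_synonym coords = "(complex \<times> complex) \<times> complex"

text \<open>A product of unipotent upper, lower triangular, and unipotent upper triangular matrices.  The
  coordinates are ordered \<open>((w, u), v)\<close> because the change of variables proceeds in this order.\<close>

definition Phi :: "complex \<Rightarrow> complex \<Rightarrow> coords \<Rightarrow> mat2" where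
  "Phi t s p = (case p of ((w, u), v) \<Rightarrow> mk2 (u - t * w) (s * u - t * (v + s * w)) w (v + s * w))"

lemma det_Phi [simp]: "det (Phi t s ((w, u), v)) = u * v"
  by (simp add: Phi_def algebra_simps)

lemma borel_measurable_Phi [measurable (raw)]:
  assumes [measurable]: "a \<in> borel_measurable M" "b \<in> borel_measurable M" "p \<in> borel_measurable M"
  shows "(\<lambda>x. Phi (a x) (b x) (p x)) \<in> borel_measurable M"
proof -
  have "(\<lambda>(t, s, p). Phi t s p) \<in> borel_measurable borel"
    unfolding Phi_def case_prod_unfold
    by (intro borel_measurable_continuous_onI continuous_intros)
  from measurable_compose[OF _ this, of "\<lambda>x. (a x, b x, p x)" M] show ?thesis
    by simp
qed

text \<open>Each step changes one variable while the others are fixed: \<open>x\<^sub>1\<^sub>1\<close> and \<open>x\<^sub>1\<^sub>2\<close> are translated,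
  then \<open>x\<^sub>1\<^sub>2 + t x\<^sub>2\<^sub>2 = s u\<close> is scaled by \<open>u\<close>, which contributes \<open>|u|\<^sup>2\<close>, and finally
  \<open>x\<^sub>2\<^sub>2 = v + s w\<close> is translated.\<close>

lemma nn_integral_Phi:
  fixes f :: "mat2 \<Rightarrow> ennreal"
  assumes [measurable]: "f \<in> borel_measurable borel"
  shows "(\<integral>\<^sup>+X. f X \<partial>lborel) = (\<integral>\<^sup>+sp. ennreal ((norm (snd (fst (snd sp))))\<^sup>2) * f (Phi t (fst sp) (snd sp)) \<partial>lborel)"
proof -
  have tr: "(\<integral>\<^sup>+z. g z \<partial>lborel) = (\<integral>\<^sup>+z. g (z + k) \<partial>lborel)" if "g \<in> borel_measurable borel" for g and k :: complex
    using nn_integral_translation[OF that, of k] by (simp add: add.commute)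
  let ?n = "\<lambda>u::complex. ennreal ((norm u)\<^sup>2)"
  have "(\<integral>\<^sup>+X. f X \<partial>lborel) = (\<integral>\<^sup>+z. \<integral>\<^sup>+d. \<integral>\<^sup>+b. f (mk2 (snd z) b (fst z) d) \<partial>lborel \<partial>lborel \<partial>lborel)"
    by (rule nn_integral_mat2) measurable
  also have "\<dots> = (\<integral>\<^sup>+w. \<integral>\<^sup>+a. \<integral>\<^sup>+d. \<integral>\<^sup>+b. f (mk2 a b w d) \<partial>lborel \<partial>lborel \<partial>lborel \<partial>lborel)"
    by (subst nn_integral_prod) simp_all
  also have "\<dots> = (\<integral>\<^sup>+w. \<integral>\<^sup>+u. \<integral>\<^sup>+d. \<integral>\<^sup>+b. f (mk2 (u - t * w) b w d) \<partial>lborel \<partial>lborel \<partial>lborel \<partial>lborel)"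
    by (rule nn_integral_cong, subst tr[where k = "- (t * w)" for w]) simp_all
  also have "\<dots> = (\<integral>\<^sup>+w. \<integral>\<^sup>+u. \<integral>\<^sup>+d. \<integral>\<^sup>+b. f (mk2 (u - t * w) (b - t * d) w d) \<partial>lborel \<partial>lborel \<partial>lborel \<partial>lborel)"
    by (rule nn_integral_cong, rule nn_integral_cong, rule nn_integral_cong, subst tr[where k = "- (t * w)" for w]) simp_all
  also have "\<dots> = (\<integral>\<^sup>+w. \<integral>\<^sup>+u. \<integral>\<^sup>+d. \<integral>\<^sup>+s. ?n u * f (mk2 (u - t * w) (s * u - t * d) w d) \<partial>lborel \<partial>lborel \<partial>lborel \<partial>lborel)"
  \<comment> \<open>The scaling by \<open>u\<close> fails only for \<open>u = 0\<close>, which is a null set.\<close>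
  proof (rule nn_integral_cong, rule nn_integral_cong_AE, rule AE_I[where N = "{0}"])
    fix w :: complex
    have "(\<integral>\<^sup>+d. \<integral>\<^sup>+b. f (mk2 (u - t * w) (b - t * d) w d) \<partial>lborel \<partial>lborel) =
      (\<integral>\<^sup>+d. \<integral>\<^sup>+s. ?n u * f (mk2 (u - t * w) (s * u - t * d) w d) \<partial>lborel \<partial>lborel)" if "u \<noteq> 0" for u
      by (rule nn_integral_cong, subst nn_integral_complex_scale[OF _ that]) (simp_all add: nn_integral_cmult mult.commute)
    then show "{u \<in> space lborel. (\<integral>\<^sup>+d. \<integral>\<^sup>+b. f (mk2 (u - t * w) (b - t * d) w d) \<partial>lborel \<partial>lborel) \<noteq>
      (\<integral>\<^sup>+d. \<integral>\<^sup>+s. ?n u * f (mk2 (u - t * w) (s * u - t * d) w d) \<partial>lborel \<partial>lborel)} \<subseteq> {0}"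
      by blast
  qed auto
  also have "\<dots> = (\<integral>\<^sup>+w. \<integral>\<^sup>+u. \<integral>\<^sup>+s. \<integral>\<^sup>+d. ?n u * f (mk2 (u - t * w) (s * u - t * d) w d) \<partial>lborel \<partial>lborel \<partial>lborel \<partial>lborel)"
    by (rule nn_integral_cong, rule nn_integral_cong, rule lborel_pair.Fubini') simp
  also have "\<dots> = (\<integral>\<^sup>+w. \<integral>\<^sup>+u. \<integral>\<^sup>+s. \<integral>\<^sup>+v. ?n u * f (mk2 (u - t * w) (s * u - t * (v + s * w)) w (v + s * w)) \<partial>lborel \<partial>lborel \<partial>lborel \<partial>lborel)"
    by (rule nn_integral_cong, rule nn_integral_cong, rule nn_integral_cong, subst tr[where k = "s * w" for s w]) simp_all
  also have "\<dots> = (\<integral>\<^sup>+z. \<integral>\<^sup>+s. \<integral>\<^sup>+v. ?n (snd z) * f (Phi t s (z, v)) \<partial>lborel \<partial>lborel \<partial>lborel)"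
    by (subst nn_integral_prod) (simp_all add: Phi_def)
  also have "\<dots> = (\<integral>\<^sup>+s. \<integral>\<^sup>+z. \<integral>\<^sup>+v. ?n (snd z) * f (Phi t s (z, v)) \<partial>lborel \<partial>lborel \<partial>lborel)"
    by (rule lborel_pair.Fubini') simp
  also have "\<dots> = (\<integral>\<^sup>+s. \<integral>\<^sup>+p. ?n (snd (fst p)) * f (Phi t s p) \<partial>lborel \<partial>lborel)"
    by (subst nn_integral_prod[of "\<lambda>p. ?n (snd (fst p)) * f (Phi t s p)" for s]) simp_all
  also have "\<dots> = (\<integral>\<^sup>+sp. ?n (snd (fst (snd sp))) * f (Phi t (fst sp) (snd sp)) \<partial>lborel)"
    by (subst nn_integral_prod) simp_all
  finally show ?thesis .
qed

lemma lborel_eq_distr_Phi: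
  "lborel = distr (density lborel (\<lambda>sp. ennreal ((norm (snd (fst (snd sp))))\<^sup>2))) borel (\<lambda>sp. Phi t (fst sp) (snd sp))"
proof (rule measure_eqI)
  fix A :: "mat2 set" assume "A \<in> sets lborel"
  then have [measurable]: "A \<in> sets borel" by simp
  have M: "(\<lambda>sp. Phi t (fst sp) (snd sp)) \<in> borel_measurable borel" by measurable
  have "emeasure lborel A = (\<integral>\<^sup>+X. indicator A X \<partial>lborel)" by simp
  also have "\<dots> = (\<integral>\<^sup>+sp. ennreal ((norm (snd (fst (snd sp))))\<^sup>2) * indicator A (Phi t (fst sp) (snd sp)) \<partial>lborel)"
    by (rule nn_integral_Phi) measurable
  also have "\<dots> = emeasure (distr (density lborel (\<lambda>sp. ennreal ((norm (snd (fst (snd sp))))\<^sup>2))) borel (\<lambda>sp. Phi t (fst sp) (snd sp))) A"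
    using measurable_sets[OF M \<open>A \<in> sets borel\<close>]
    by (subst emeasure_distr, simp, simp, subst emeasure_density)
       (auto intro!: nn_integral_cong simp: indicator_def)
  finally show "emeasure lborel A = emeasure (distr (density lborel (\<lambda>sp. ennreal ((norm (snd (fst (snd sp))))\<^sup>2))) borel (\<lambda>sp. Phi t (fst sp) (snd sp))) A" .
qed simp

lemma integral_Phi:
  fixes G :: "mat2 \<Rightarrow> complex" and t :: complex
  assumes G: "integrable lborel G"
  defines "H \<equiv> \<lambda>s p. of_real ((norm (snd (fst p)))\<^sup>2) * G (Phi t s p)"
  shows "integrable lborel (\<lambda>s. \<integral>p. H s p \<partial>lborel)"
    and "(\<integral>X. G X \<partial>lborel) = (\<integral>s. \<integral>p. H s p \<partial>lborel \<partial>lborel)"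
proof -
  have [measurable]: "G \<in> borel_measurable borel"
    using borel_measurable_integrable[OF G] by simp
  let ?n = "\<lambda>sp :: complex \<times> coords. (norm (snd (fst (snd sp))))\<^sup>2"
  let ?D = "density lborel (\<lambda>sp. ennreal (?n sp))"
  let ?P = "\<lambda>sp :: complex \<times> coords. Phi t (fst sp) (snd sp)"
  have "integrable (distr ?D borel ?P) G"
    using G by (simp add: lborel_eq_distr_Phi[of t, symmetric])
  then have "integrable ?D (\<lambda>sp. G (?P sp))"
    by (subst (asm) integrable_distr_eq) simp_all
  then have i: "integrable lborel (\<lambda>sp. ?n sp *\<^sub>R G (?P sp))"
    by (subst (asm) integrable_density) simp_all
  then have i': "integrable (lborel \<Otimes>\<^sub>M lborel) (\<lambda>(s, p). H s p)"
    by (simp add: lborel_prod H_def case_prod_unfold scaleR_conv_of_real)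
  show "integrable lborel (\<lambda>s. \<integral>p. H s p \<partial>lborel)"
    using lborel_pair.integrable_fst'[OF i'] by simp
  have "(\<integral>X. G X \<partial>lborel) = (\<integral>X. G X \<partial>distr ?D borel ?P)"
    by (simp add: lborel_eq_distr_Phi[of t, symmetric])
  also have "\<dots> = (\<integral>sp. G (?P sp) \<partial>?D)"
    by (rule integral_distr) simp_all
  also have "\<dots> = (\<integral>sp. ?n sp *\<^sub>R G (?P sp) \<partial>lborel)"
    by (rule integral_density) simp_all
  also have "\<dots> = (\<integral>sp. (case sp of (s, p) \<Rightarrow> H s p) \<partial>(lborel \<Otimes>\<^sub>M lborel))"
    by (simp add: lborel_prod H_def case_prod_unfold scaleR_conv_of_real)
  also have "\<dots> = (\<integral>s. \<integral>p. H s p \<partial>lborel \<partial>lborel)"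
    using lborel_pair.integral_fst'[OF i'] by simp
  finally show "(\<integral>X. G X \<partial>lborel) = (\<integral>s. \<integral>p. H s p \<partial>lborel \<partial>lborel)" .
qed

section \<open>Concentrating sections of the principal series\<close>

text \<open>A class of functions that is closed under directional derivatives, hence smooth in the sense of
  iterated directional derivatives.  The weight is \<open>1 + |z|\<^sup>2\<close> to a complex power.\<close>

inductive_set explicit_smooth :: "(complex \<Rightarrow> complex) set" where
  const: "(\<lambda>z. a) \<in> explicit_smooth"
| ident: "(\<lambda>z. z) \<in> explicit_smooth"
| conj: "(\<lambda>z. cnj z) \<in> explicit_smooth"
| plus: "f \<in> explicit_smooth \<Longrightarrow> g \<in> explicit_smooth \<Longrightarrow> (\<lambda>z. f z + g z) \<in> explicit_smooth"
| times: "f \<in> explicit_smooth \<Longrightarrow> g \<in> explicit_smooth \<Longrightarrow> (\<lambda>z. f z * g z) \<in> explicit_smooth"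
| weight: "(\<lambda>z. exp (c * of_real (ln (1 + (norm z)\<^sup>2)))) \<in> explicit_smooth"

lemma explicit_smooth_power: "f \<in> explicit_smooth \<Longrightarrow> (\<lambda>z. f z ^ n) \<in> explicit_smooth"
  by (induction n) (auto intro: explicit_smooth.intros)

lemma has_derivative_weight:
  fixes z c :: complex
  shows "((\<lambda>z. exp (c * of_real (ln (1 + (norm z)\<^sup>2)))) has_derivative
    (\<lambda>h. c * (z * cnj h + cnj z * h) * exp ((c - 1) * of_real (ln (1 + (norm z)\<^sup>2))))) (at z)"
proof -
  have pos: "1 + (norm z)\<^sup>2 > 0" by (simp add: add_pos_nonneg)
  have 1: "((\<lambda>z. ln (1 + (norm z)\<^sup>2)) has_derivative (\<lambda>h. 2 * (z \<bullet> h) / (1 + (norm z)\<^sup>2))) (at z)"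
    unfolding power2_norm_eq_inner
    using pos by (auto intro!: derivative_eq_intros simp: power2_norm_eq_inner inner_commute divide_inverse fun_eq_iff algebra_simps)
  have 2: "exp ((c - 1) * of_real (ln (1 + (norm z)\<^sup>2))) = exp (c * of_real (ln (1 + (norm z)\<^sup>2))) / of_real (1 + (norm z)\<^sup>2)"
    using pos by (simp add: algebra_simps exp_diff exp_of_real del: of_real_add)
  have 3: "z * cnj h + cnj z * h = of_real (2 * (z \<bullet> h))" for h
    by (simp add: complex_eq_iff inner_complex_def)
  have "((\<lambda>z. exp (c * of_real (ln (1 + (norm z)\<^sup>2)))) has_derivative
    (\<lambda>h. exp (c * of_real (ln (1 + (norm z)\<^sup>2))) * (c * of_real (2 * (z \<bullet> h) / (1 + (norm z)\<^sup>2))))) (at z)"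
    by (rule has_derivative_compose[OF _ DERIV_exp[unfolded has_field_derivative_def]])
       (intro derivative_intros 1)
  then show ?thesis
    by (rule has_derivative_eq_rhs) (simp add: 2 3 fun_eq_iff)
qed

lemma explicit_smooth_derivative:
  assumes "f \<in> explicit_smooth"
  shows "\<exists>D. (\<forall>z. (f has_derivative D z) (at z)) \<and> (\<forall>h. (\<lambda>z. D z h) \<in> explicit_smooth)"
  using assms
proof induction
  case (const a)
  then show ?case by (intro exI[of _ "\<lambda>z h. 0"]) (auto intro: explicit_smooth.intros)
next
  case ident
  then show ?case by (intro exI[of _ "\<lambda>z h. h"]) (auto intro: explicit_smooth.intros)
next
  case conj
  then show ?case
    by (intro exI[of _ "\<lambda>z h. cnj h"]) (auto intro: explicit_smooth.intros bounded_linear_imp_has_derivative bounded_linear_cnj)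
next
  case (plus f g)
  then obtain D E where "\<forall>z. (f has_derivative D z) (at z)" "\<forall>h. (\<lambda>z. D z h) \<in> explicit_smooth"
    "\<forall>z. (g has_derivative E z) (at z)" "\<forall>h. (\<lambda>z. E z h) \<in> explicit_smooth" by blast
  then show ?case
    by (intro exI[of _ "\<lambda>z h. D z h + E z h"]) (auto intro: explicit_smooth.intros has_derivative_add)
next
  case (times f g)
  then obtain D E where "\<forall>z. (f has_derivative D z) (at z)" "\<forall>h. (\<lambda>z. D z h) \<in> explicit_smooth"
    "\<forall>z. (g has_derivative E z) (at z)" "\<forall>h. (\<lambda>z. E z h) \<in> explicit_smooth" by blast
  with times show ?case
    by (intro exI[of _ "\<lambda>z h. f z * E z h + D z h * g z"]) (auto intro!: explicit_smooth.intros has_derivative_mult)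
next
  case (weight c)
  show ?case
    by (rule exI[of _ "\<lambda>z h. c * (z * cnj h + cnj z * h) * exp ((c - 1) * of_real (ln (1 + (norm z)\<^sup>2)))"])
       (intro conjI allI has_derivative_weight explicit_smooth.intros)
qed

lemma Ck_on_explicit_smooth: "f \<in> explicit_smooth \<Longrightarrow> Ck_on k f UNIV"
proof (induction k arbitrary: f)
  case 0
  from explicit_smooth_derivative[OF 0] obtain D where "\<forall>z. (f has_derivative D z) (at z)" by blast
  then have "continuous_on UNIV f"
    by (intro continuous_at_imp_continuous_on) (auto intro: has_derivative_continuous)
  then show ?case by simp
next
  case (Suc k)
  from explicit_smooth_derivative[OF Suc.prems] obtain D
    where D: "\<And>z. (f has_derivative D z) (at z)" and E: "\<And>h. (\<lambda>z. D z h) \<in> explicit_smooth" by blast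
  have "frechet_derivative f (at z) = D z" for z
    using D by (simp add: frechet_derivative_at[symmetric])
  then show ?case
    using Suc.IH[OF E] D by (auto simp: differentiable_on_def differentiable_def)
qed

lemma smooth_on_explicit: "f \<in> explicit_smooth \<Longrightarrow> smooth_on f UNIV"
  by (simp add: smooth_on_def Ck_on_explicit_smooth)

text \<open>Up to the nowhere vanishing section \<open>(1 + |s|\<^sup>2)\<^sup>c\<close>, this is the \<open>N\<close>-th power of
  \<open>|1 + s cnj y|\<^sup>2 / (1 + |s|\<^sup>2)\<close>, which on the projective line is a multiple of the squared cosine of
  the Fubini-Study distance between \<open>s\<close> and \<open>y\<close> and so has its only maximum at \<open>s = y\<close>.\<close>

definition peak :: "complex \<Rightarrow> nat \<Rightarrow> complex \<Rightarrow> complex \<Rightarrow> complex" where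
  "peak c N y s = ((1 + s * cnj y) * cnj (1 + s * cnj y)) ^ N * exp ((c - of_nat N) * of_real (ln (1 + (norm s)\<^sup>2)))"

text \<open>At infinity, \<open>bipow t\<close> contributes \<open>|t|\<close> to the power \<open>2 c\<close>, which the weight absorbs, and a
  monomial \<open>q\<close> in \<open>t\<close> or \<open>cnj t\<close>.  The exponent \<open>c\<close> is the one of the two for which this monomial has
  non-negative degree.\<close>

lemma peak_in_ps_space:
  assumes "\<mu>1 - \<mu>1' \<in> \<int>" "\<mu>2 - \<mu>2' \<in> \<int>"
  obtains c where "\<And>N y. peak c N y \<in> ps_space \<mu>1 \<mu>1' \<mu>2 \<mu>2'"
proof -
  define a a' where "a = -1 + \<mu>1 - \<mu>2" and "a' = -1 + \<mu>1' - \<mu>2'"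
  have "a' - a = - (\<mu>1 - \<mu>1') + (\<mu>2 - \<mu>2')" by (simp add: a_def a'_def)
  then have "a' - a \<in> \<int>" using assms by (metis Ints_add Ints_minus)
  then obtain n where n: "a' - a = of_int n" by (auto elim: Ints_cases)
  define c where "c = (if n \<ge> 0 then a else a')"
  \<comment> \<open>\<open>bipow t a a'\<close> is \<open>|t|\<close> to the power \<open>2 a\<close> times \<open>cnj t\<close> to the power \<open>n = a' - a\<close>; for negative \<open>n\<close> the latter is rewritten by \<open>t (cnj t) = |t|\<^sup>2\<close>.\<close>
  define q :: "complex \<Rightarrow> complex" where "q t = (if n \<ge> 0 then cnj t ^ nat n else t ^ nat (- n))" for t
  have q: "of_real (norm t) powr (2 * a) * cnj t powi n = of_real (norm t) powr (2 * c) * q t" if "t \<noteq> 0" for t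
  proof (cases "n \<ge> 0")
    case True
    then show ?thesis by (simp add: c_def q_def power_int_def)
  next
    case False
    have nt: "norm t > 0" using that by simp
    have "of_real (norm t) powr (2 * c) = of_real (norm t) powr (2 * a + of_int (2 * n))"
      using False n by (simp add: c_def algebra_simps)
    also have "\<dots> = of_real (norm t) powr (2 * a) * of_real (norm t) powr of_int (2 * n)"
      by (rule powr_add)
    also have "(of_real (norm t) :: complex) powr of_int (2 * n) = of_real (norm t) powi (2 * n)"
      by (rule complex_powr_of_int) (use that in simp)
    also have "\<dots> = ((of_real (norm t))\<^sup>2) powi n"
      by (simp add: power_int_mult)
    also have "(of_real (norm t) :: complex)\<^sup>2 = t * cnj t"
      by (metis complex_norm_square of_real_power)
    also have "(t * cnj t) powi n = t powi n * cnj t powi n"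
      by (rule power_int_mult_distrib)
    finally have "of_real (norm t) powr (2 * c) * q t = of_real (norm t) powr (2 * a) * cnj t powi n * (t powi n * q t)"
      by simp
    also have "t powi n * q t = 1"
      using False that by (simp add: q_def power_int_def field_simps)
    finally show ?thesis by simp
  qed
  have "peak c N y \<in> ps_space \<mu>1 \<mu>1' \<mu>2 \<mu>2'" for N y
  proof -
    let ?\<psi> = "\<lambda>t. ((t + (- cnj y)) * (cnj t + (- y))) ^ N * exp ((c - of_nat N) * of_real (ln (1 + (norm t)\<^sup>2))) * q t"
    have qs: "q \<in> explicit_smooth"
      unfolding q_def[abs_def] by (cases "n \<ge> 0") (auto intro!: explicit_smooth_power explicit_smooth.intros)
    have "peak c N y = (\<lambda>s. ((1 + s * cnj y) * (1 + cnj s * y)) ^ N * exp ((c - of_nat N) * of_real (ln (1 + (norm s)\<^sup>2))))"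
      by (simp add: peak_def fun_eq_iff)
    also have "\<dots> \<in> explicit_smooth"
      by (intro explicit_smooth_power explicit_smooth.intros)
    finally have "smooth_on (peak c N y) UNIV" by (rule smooth_on_explicit)
    moreover have "smooth_on ?\<psi> UNIV"
      by (intro smooth_on_explicit explicit_smooth_power explicit_smooth.intros qs)
    moreover have "?\<psi> t = peak c N y (- inverse t) * bipow t a a'" if "t \<noteq> 0" for t
    proof -
      let ?r = "norm t"
      have r: "?r > 0" using that by simp
      have L: "ln (1 + (norm (- inverse t))\<^sup>2) = ln (1 + ?r\<^sup>2) - 2 * ln ?r"
      proof -
        have "1 + (norm (- inverse t))\<^sup>2 = (1 + ?r\<^sup>2) / ?r\<^sup>2"
          using r by (simp add: norm_inverse norm_divide power_divide field_simps)
        then have "ln (1 + (norm (- inverse t))\<^sup>2) = ln ((1 + ?r\<^sup>2) / ?r\<^sup>2)" by simp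
        also have "\<dots> = ln (1 + ?r\<^sup>2) - ln (?r\<^sup>2)"
          by (rule ln_divide_pos) (use r in \<open>auto simp: add_pos_nonneg\<close>)
        also have "ln (?r\<^sup>2) = 2 * ln ?r" using r by (simp add: ln_realpow)
        finally show ?thesis .
      qed
      have P: "of_real ?r powr (2 * c) = exp (c * of_real (2 * ln ?r))"
        using r by (simp add: powr_def Ln_of_real algebra_simps)
      have "exp ((of_nat N - c) * of_real (2 * ln ?r)) * exp (c * of_real (2 * ln ?r)) = exp (of_nat (2 * N) * of_real (ln ?r) :: complex)"
        by (simp add: exp_add[symmetric] algebra_simps)
      also have "\<dots> = of_real ?r ^ (2 * N)"
        using r by (subst exp_of_nat_mult) (simp add: exp_of_real)
      finally have E: "exp ((of_nat N - c) * of_real (2 * ln ?r)) * exp (c * of_real (2 * ln ?r)) = of_real ?r ^ (2 * N)" .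
      have E2: "exp ((c - of_nat N) * of_real (ln (1 + (norm (- inverse t))\<^sup>2))) * of_real ?r powr (2 * c)
         = exp ((c - of_nat N) * of_real (ln (1 + ?r\<^sup>2))) * of_real ?r ^ (2 * N)"
        unfolding L P E[symmetric] by (simp add: exp_add[symmetric] algebra_simps)
      have B: "bipow t a a' = of_real ?r powr (2 * c) * q t"
        unfolding bipow_def n using q[OF that] by simp
      have M: "((1 + (- inverse t) * cnj y) * cnj (1 + (- inverse t) * cnj y)) ^ N * of_real ?r ^ (2 * N) = ((t + (- cnj y)) * (cnj t + (- y))) ^ N"
      proof -
        have "(of_real ?r :: complex) ^ (2 * N) = (t * cnj t) ^ N"
          by (metis power_mult complex_norm_square of_real_power)
        moreover have "(1 + (- inverse t) * cnj y) * cnj (1 + (- inverse t) * cnj y) * (t * cnj t) = (t + (- cnj y)) * (cnj t + (- y))"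
          using that by (simp add: field_simps)
        ultimately show ?thesis
          by (simp only: power_mult_distrib[symmetric])
      qed
      have "peak c N y (- inverse t) * bipow t a a' = ((1 + (- inverse t) * cnj y) * cnj (1 + (- inverse t) * cnj y)) ^ N *
         (exp ((c - of_nat N) * of_real (ln (1 + (norm (- inverse t))\<^sup>2))) * of_real ?r powr (2 * c)) * q t"
        unfolding peak_def B by (simp only: mult_ac)
      also have "\<dots> = (((1 + (- inverse t) * cnj y) * cnj (1 + (- inverse t) * cnj y)) ^ N * of_real ?r ^ (2 * N)) * exp ((c - of_nat N) * of_real (ln (1 + ?r\<^sup>2))) * q t"
        unfolding E2 by (simp only: mult_ac)
      finally show ?thesis unfolding M by simp
    qed
    ultimately show ?thesis
      unfolding ps_space_def a_def a'_def by blast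
  qed
  then show thesis by (rule that)
qed

definition chord :: "complex \<Rightarrow> complex \<Rightarrow> real" where
  "chord y s = (norm (1 + s * cnj y))\<^sup>2 / (1 + (norm s)\<^sup>2)"

lemma peak_eq: "peak c N y s = of_real (chord y s ^ N) * peak c 0 y s"
proof -
  have pos: "1 + (norm s)\<^sup>2 > 0" by (simp add: add_pos_nonneg)
  have "exp ((c - of_nat N) * of_real (ln (1 + (norm s)\<^sup>2))) =
      exp (c * of_real (ln (1 + (norm s)\<^sup>2))) / of_real (1 + (norm s)\<^sup>2) ^ N"
    using pos by (simp add: algebra_simps exp_diff exp_of_nat_mult exp_of_real del: of_real_add)
  then show ?thesis
    unfolding peak_def chord_def complex_norm_square[symmetric] by (simp add: power_divide)
qed

lemma chord_defect: "1 + (norm y)\<^sup>2 - chord y s = (norm (s - y))\<^sup>2 / (1 + (norm s)\<^sup>2)"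
proof -
  have pos: "1 + (norm s)\<^sup>2 > 0" by (simp add: add_pos_nonneg)
  have "(1 + (norm y)\<^sup>2) * (1 + (norm s)\<^sup>2) - (norm (1 + s * cnj y))\<^sup>2 = (norm (s - y))\<^sup>2"
    unfolding cmod_power2 by (simp add: power2_eq_square algebra_simps)
  then show ?thesis using pos by (simp add: chord_def field_simps)
qed

text \<open>The maximum is strict uniformly, including near infinity: the defect
  \<open>|s - y|\<^sup>2 / (1 + |s|\<^sup>2)\<close> is bounded below when \<open>|s - y| \<ge> r\<close>.\<close>

lemma chord_far:
  assumes "r > 0"
  obtains q where "q < 1 + (norm y)\<^sup>2" "q > 0" "\<And>s. norm (s - y) \<ge> r \<Longrightarrow> chord y s \<le> q"
proof -
  \<comment> \<open>\<open>A\<close> comes from \<open>|s| \<le> |s - y| + |y|\<close> and gives \<open>1 + |s|\<^sup>2 \<le> A |s - y|\<^sup>2\<close> for \<open>|s - y| \<ge> r\<close>.\<close>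
  define A where "A = 1 / r\<^sup>2 + (1 + norm y / r)\<^sup>2"
  have A: "A > 0" using assms by (auto simp: A_def intro!: add_pos_nonneg)
  define q where "q = max (1/2) (1 + (norm y)\<^sup>2 - 1 / A)"
  have "chord y s \<le> q" if s: "norm (s - y) \<ge> r" for s
  proof -
    define \<rho> where "\<rho> = norm (s - y)"
    have \<rho>: "\<rho> \<ge> r" "\<rho> > 0" using s assms by (auto simp: \<rho>_def)
    have "norm s \<le> \<rho> + norm y" using norm_triangle_ineq[of "s - y" y] by (simp add: \<rho>_def)
    also have "norm y \<le> \<rho> * (norm y / r)" using \<rho> assms by (simp add: field_simps mult_right_mono)
    finally have "norm s \<le> \<rho> * (1 + norm y / r)" by (simp add: algebra_simps)
    then have "(norm s)\<^sup>2 \<le> (\<rho> * (1 + norm y / r))\<^sup>2" by (intro power_mono) auto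
    moreover have "1 \<le> \<rho>\<^sup>2 / r\<^sup>2" using \<rho> assms by (simp add: power_mono)
    moreover have "(\<rho> * (1 + norm y / r))\<^sup>2 = \<rho>\<^sup>2 * (1 + norm y / r)\<^sup>2"
      by (rule power_mult_distrib)
    moreover have "\<rho>\<^sup>2 * A = \<rho>\<^sup>2 / r\<^sup>2 + \<rho>\<^sup>2 * (1 + norm y / r)\<^sup>2"
      by (simp only: A_def distrib_left times_divide_eq_right mult_1_right)
    ultimately have "1 + (norm s)\<^sup>2 \<le> \<rho>\<^sup>2 * A"
      by linarith
    then have "1 / A \<le> \<rho>\<^sup>2 / (1 + (norm s)\<^sup>2)"
      using A by (simp add: field_simps add_pos_nonneg)
    then show ?thesis
      using chord_defect[of y s] by (simp add: q_def \<rho>_def)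
  qed
  moreover have "q < 1 + (norm y)\<^sup>2" "q > 0"
    using A by (auto simp: q_def max_def add_strict_increasing2 intro: add_pos_nonneg)
  ultimately show thesis using that by blast
qed

lemma continuous_on_peak [continuous_intros]: "continuous_on S (peak c N y)"
  unfolding peak_def by (intro continuous_intros) (auto simp: add_nonneg_eq_0_iff)

lemma continuous_on_chord: "continuous_on S (chord y)"
  unfolding chord_def by (intro continuous_intros) (auto simp: add_nonneg_eq_0_iff)

lemma peak0_nonzero: "peak c 0 y s \<noteq> 0"
  by (simp add: peak_def)

text \<open>Laplace's method.  If \<open>g y \<noteq> 0\<close>, normalise to \<open>G y = 1\<close>; as \<open>N\<close> grows, the contribution of a
  small ball around \<open>y\<close>, of order at least \<open>q'\<close> to the power \<open>N\<close>, dominates the rest, which is at most of order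
  \<open>q\<close> to the power \<open>N\<close> with \<open>q < q'\<close>.\<close>

lemma peak_separates:
  fixes g :: "complex \<Rightarrow> complex"
  assumes g: "continuous_on UNIV g"
    and int: "integrable lborel (\<lambda>s. g s * peak c 0 y s)"
    and zero: "\<And>N. (\<integral>s. g s * peak c N y s \<partial>lborel) = 0"
  shows "g y = 0"
proof (rule ccontr)
  assume "g y \<noteq> 0"
  define G where "G s = Re (g s * peak c 0 y s / (g y * peak c 0 y y))" for s
  have Gy: "G y = 1" using \<open>g y \<noteq> 0\<close> peak0_nonzero[of c y y] by (simp add: G_def)
  have Gint: "integrable lborel G"
    unfolding G_def by (intro integrable_Re integrable_divide int)
  have Gcont: "continuous_on UNIV G"
    unfolding G_def using \<open>g y \<noteq> 0\<close> peak0_nonzero[of c y y] by (intro continuous_intros g) auto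
  have ch0: "chord y s \<ge> 0" for s by (simp add: chord_def)
  have ch1: "chord y s \<le> 1 + (norm y)\<^sup>2" for s
    using chord_defect[of y s] by (smt (verit) divide_nonneg_nonneg zero_le_power2)
  have Nint: "integrable lborel (\<lambda>s. chord y s ^ N * G s)" for N
  proof (rule Bochner_Integration.integrable_bound[where f = "\<lambda>s. (1 + (norm y)\<^sup>2) ^ N * G s"])
    show "integrable lborel (\<lambda>s. (1 + (norm y)\<^sup>2) ^ N * G s)" by (intro integrable_mult_right Gint)
    show "(\<lambda>s. chord y s ^ N * G s) \<in> borel_measurable lborel"
      using borel_measurable_continuous_onI[OF continuous_on_chord[of UNIV y]] borel_measurable_integrable[OF Gint]
      by simp
    show "AE s in lborel. norm (chord y s ^ N * G s) \<le> norm ((1 + (norm y)\<^sup>2) ^ N * G s)"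
      using ch0 ch1 by (auto simp: abs_mult power_abs intro!: mult_right_mono power_mono)
  qed
  have zeroN: "(\<integral>s. chord y s ^ N * G s \<partial>lborel) = 0" for N
  proof -
    have e: "chord y s ^ N * G s = Re (g s * peak c N y s / (g y * peak c 0 y y))" for s
    proof -
      have "g s * peak c N y s / (g y * peak c 0 y y) = of_real (chord y s ^ N) * (g s * peak c 0 y s / (g y * peak c 0 y y))"
        by (subst peak_eq) simp
      then show ?thesis by (simp only: G_def times_complex.sel Re_complex_of_real Im_complex_of_real mult_zero_left diff_zero)
    qed
    have "integrable lborel (\<lambda>s. of_real (chord y s ^ N) * (g s * peak c 0 y s))"
    proof (rule Bochner_Integration.integrable_bound[where f = "\<lambda>s. of_real ((1 + (norm y)\<^sup>2) ^ N) * (g s * peak c 0 y s)"])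
      show "integrable lborel (\<lambda>s. complex_of_real ((1 + (norm y)\<^sup>2) ^ N) * (g s * peak c 0 y s))"
        by (intro integrable_mult_right int)
      show "(\<lambda>s. complex_of_real (chord y s ^ N) * (g s * peak c 0 y s)) \<in> borel_measurable lborel"
        using borel_measurable_continuous_onI[OF continuous_on_chord[of UNIV y]] borel_measurable_integrable[OF int]
        by simp
      show "AE s in lborel. norm (complex_of_real (chord y s ^ N) * (g s * peak c 0 y s)) \<le> norm (complex_of_real ((1 + (norm y)\<^sup>2) ^ N) * (g s * peak c 0 y s))"
        using ch0 ch1 by (auto simp del: of_real_power of_real_add simp: norm_mult power_abs intro!: mult_right_mono power_mono)
    qed
    then have "integrable lborel (\<lambda>s. g s * peak c N y s)"
      by (subst peak_eq) (simp add: mult_ac)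
    then show ?thesis
      unfolding e by (subst integral_Re) (auto simp: zero)
  qed
  have "isCont G y" using Gcont by (simp add: continuous_on_eq_continuous_at)
  from continuous_at_eps_delta[THEN iffD1, OF this, rule_format, of "1/2"] obtain r
    where r: "r > 0" "\<And>s. norm (s - y) < r \<Longrightarrow> \<bar>G s - 1\<bar> < 1/2"
    by (auto simp: dist_norm Gy)
  obtain q where q: "q < 1 + (norm y)\<^sup>2" "q > 0" "\<And>s. norm (s - y) \<ge> r \<Longrightarrow> chord y s \<le> q"
    using chord_far[OF r(1)] by metis
  define q' where "q' = (q + (1 + (norm y)\<^sup>2)) / 2"
  have q': "q < q'" "q' < 1 + (norm y)\<^sup>2" using q by (auto simp: q'_def)
  have chy: "chord y y = 1 + (norm y)\<^sup>2" using chord_defect[of y y] by simp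
  have "isCont (chord y) y" using continuous_on_chord[of UNIV y] by (simp add: continuous_on_eq_continuous_at)
  from continuous_at_eps_delta[THEN iffD1, OF this, rule_format, of "1 + (norm y)\<^sup>2 - q'"] q' obtain r1
    where r1: "r1 > 0" "\<And>s. norm (s - y) < r1 \<Longrightarrow> \<bar>chord y s - (1 + (norm y)\<^sup>2)\<bar> < 1 + (norm y)\<^sup>2 - q'"
    by (auto simp: dist_norm chy)
  define r2 where "r2 = min r r1"
  have r2: "r2 > 0" using r r1 by (simp add: r2_def)
  define V where "V = measure lborel (ball y r2)"
  have V: "V > 0" unfolding V_def using r2 by (simp add: content_ball_pos)
  define I where "I = (\<integral>s. \<bar>G s\<bar> \<partial>lborel)"
  have lower: "q' ^ N * (V / 2) \<le> q ^ N * I" for N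
  proof -
    have iV: "integrable lborel (\<lambda>s. q' ^ N / 2 * indicator (ball y r2) s :: real)"
      using emeasure_bounded_finite[OF bounded_ball, of y r2]
      by (intro integrable_mult_right) (simp add: integrable_indicator_iff)
    have iG: "integrable lborel (\<lambda>s. q ^ N * \<bar>G s\<bar>)"
      by (intro integrable_mult_right integrable_abs Gint)
    have "(\<integral>s. q' ^ N / 2 * indicator (ball y r2) s - q ^ N * \<bar>G s\<bar> \<partial>lborel) \<le> (\<integral>s. chord y s ^ N * G s \<partial>lborel)"
    proof (rule integral_mono)
      show "integrable lborel (\<lambda>s. q' ^ N / 2 * indicator (ball y r2) s - q ^ N * \<bar>G s\<bar>)"
        by (intro Bochner_Integration.integrable_diff iV iG)
      show "integrable lborel (\<lambda>s. chord y s ^ N * G s)" by (rule Nint)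
      fix s
      show "q' ^ N / 2 * indicator (ball y r2) s - q ^ N * \<bar>G s\<bar> \<le> chord y s ^ N * G s"
      proof (cases "norm (s - y) < r")
        case True
        with r(2)[of s] have G: "G s > 1/2" by (auto simp: abs_if split: if_splits)
        show ?thesis
        proof (cases "s \<in> ball y r2")
          case True
          then have "norm (s - y) < r1" by (auto simp: r2_def dist_norm norm_minus_commute)
          with r1(2)[of s] have "chord y s \<ge> q'" by (auto simp: abs_if split: if_splits)
          then have "q' ^ N \<le> chord y s ^ N" using q q' by (intro power_mono) auto
          then have "q' ^ N * (1/2) \<le> chord y s ^ N * G s"
            using G q q' ch0 by (intro mult_mono) auto
          moreover have "q ^ N * \<bar>G s\<bar> \<ge> 0" using q by simp
          ultimately show ?thesis using True by simp
        next
          case False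
          moreover have "q ^ N * \<bar>G s\<bar> \<ge> 0" "chord y s ^ N * G s \<ge> 0" using q ch0 G by auto
          ultimately show ?thesis by simp
        qed
      next
        case False
        then have "chord y s ^ N * \<bar>G s\<bar> \<le> q ^ N * \<bar>G s\<bar>"
          using q(3)[of s] ch0 by (intro mult_right_mono power_mono) auto
        moreover have "- (chord y s ^ N * \<bar>G s\<bar>) \<le> chord y s ^ N * G s"
          using ch0[of s] by (simp add: abs_if mult_nonneg_nonpos)
        moreover have "s \<notin> ball y r2" using False by (auto simp: r2_def dist_norm norm_minus_commute)
        ultimately show ?thesis by simp
      qed
    qed
    also have "(\<integral>s. q' ^ N / 2 * indicator (ball y r2) s - q ^ N * \<bar>G s\<bar> \<partial>lborel) = q' ^ N / 2 * V - q ^ N * I"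
      by (subst Bochner_Integration.integral_diff[OF iV iG]) (simp add: V_def I_def)
    finally show ?thesis by (simp add: zeroN)
  qed
  have "(\<lambda>N. (q / q') ^ N * I) \<longlonglongrightarrow> 0 * I"
    using q q' by (intro tendsto_mult_right LIMSEQ_realpow_zero) auto
  then have "eventually (\<lambda>N. (q / q') ^ N * I < V / 2) sequentially"
    using V by (intro order_tendstoD) auto
  then obtain N where "(q / q') ^ N * I < V / 2" by (auto simp: eventually_sequentially)
  then have "q ^ N * I < q' ^ N * (V / 2)"
    using q q' by (simp add: power_divide field_simps)
  with lower[of N] show False by simp
qed

lemma kernel_unique:
  assumes "\<mu>1 - \<mu>1' \<in> \<int>" "\<mu>2 - \<mu>2' \<in> \<int>"
    and K: "continuous_on UNIV (\<lambda>(t, s). K t s)" "is_kernel (ps_space \<mu>1 \<mu>1' \<mu>2 \<mu>2') A K"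
    and L: "continuous_on UNIV (\<lambda>(t, s). L t s)" "is_kernel (ps_space \<mu>1 \<mu>1' \<mu>2 \<mu>2') A L"
  shows "K = L"
proof (intro ext)
  fix t y
  obtain c where c: "\<And>N y. peak c N y \<in> ps_space \<mu>1 \<mu>1' \<mu>2 \<mu>2'"
    using peak_in_ps_space[OF assms(1,2)] by metis
  have cont: "continuous_on UNIV (J t)" if "continuous_on UNIV (\<lambda>(t, s). J t s)" for J :: "complex \<Rightarrow> complex \<Rightarrow> complex"
    using continuous_on_compose2[OF that, of UNIV "\<lambda>s. (t, s)"] by (simp add: continuous_on_Pair)
  have i: "integrable lborel (\<lambda>s. J t s * peak c N y s)" "(\<integral>s. J t s * peak c N y s \<partial>lborel) = A (peak c N y) t"
    if "is_kernel (ps_space \<mu>1 \<mu>1' \<mu>2 \<mu>2') A J" for J N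
    using that c[of N y] by (auto simp: is_kernel_def)
  have "K t y - L t y = 0"
  proof (rule peak_separates[where g = "\<lambda>s. K t s - L t s" and c = c])
    show "continuous_on UNIV (\<lambda>s. K t s - L t s)"
      by (intro continuous_on_diff cont K L)
    show "integrable lborel (\<lambda>s. (K t s - L t s) * peak c 0 y s)"
      unfolding left_diff_distrib by (intro Bochner_Integration.integrable_diff i K L)
    show "(\<integral>s. (K t s - L t s) * peak c N y s \<partial>lborel) = 0" for N
      unfolding left_diff_distrib
      by (subst Bochner_Integration.integral_diff) (auto simp: i[OF K(2)] i[OF L(2)])
  qed
  then show "K t y = L t y" by simp
qed

section \<open>The powers with two exponents\<close>

lemma bipow_0 [simp]: "bipow 0 \<nu> \<nu>' = 0"
  by (simp add: bipow_def)

lemma bipow_eq_exp: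
  assumes "z \<noteq> 0"
  shows "bipow z \<nu> \<nu>' = exp (2 * \<nu> * of_real (ln (norm z))) * cnj z powi \<lfloor>Re (\<nu>' - \<nu>)\<rfloor>"
  using assms by (simp add: bipow_def powr_def Ln_of_real)

lemma bipow_eq_exp':
  assumes "z \<noteq> 0" "\<nu>' - \<nu> = of_int n"
  shows "bipow z \<nu> \<nu>' = exp (2 * \<nu> * of_real (ln (norm z))) * cnj z powi n"
  using assms by (simp add: bipow_eq_exp)

lemma bipow_add:
  assumes "\<nu> - \<nu>' \<in> \<int>" "\<kappa> - \<kappa>' \<in> \<int>"
  shows "bipow z (\<nu> + \<kappa>) (\<nu>' + \<kappa>') = bipow z \<nu> \<nu>' * bipow z \<kappa> \<kappa>'"
proof (cases "z = 0")
  case False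
  obtain m n where mn: "\<nu>' - \<nu> = of_int m" "\<kappa>' - \<kappa> = of_int n"
    using assms by (metis Ints_cases Ints_minus minus_diff_eq)
  have "\<nu>' + \<kappa>' - (\<nu> + \<kappa>) = of_int (m + n)"
    using mn by (simp add: algebra_simps)
  from bipow_eq_exp'[OF False this] show ?thesis
    using False by (simp add: bipow_eq_exp'[OF False mn(1)] bipow_eq_exp'[OF False mn(2)] power_int_add exp_add distrib_left distrib_right)
qed simp

lemma bipow_mult: "bipow (z * w) \<nu> \<nu>' = bipow z \<nu> \<nu>' * bipow w \<nu> \<nu>'"
proof (cases "z = 0 \<or> w = 0")
  case False
  then show ?thesis
    by (simp add: bipow_eq_exp norm_mult ln_mult exp_add algebra_simps power_int_mult_distrib)
qed auto

lemma exp_2_ln_norm: "z \<noteq> 0 \<Longrightarrow> exp (2 * of_real (ln (norm z))) = z * cnj z"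
proof -
  assume "z \<noteq> 0"
  have "exp (2 * of_real (ln (norm z)) :: complex) = exp (of_real (ln (norm z))) ^ 2"
    by (rule exp_double)
  also have "\<dots> = of_real ((norm z)\<^sup>2)" using \<open>z \<noteq> 0\<close> by (simp add: exp_of_real)
  finally show ?thesis by (simp only: complex_norm_square)
qed

lemma bipow_1_0 [simp]: "bipow z 1 0 = z"
  using bipow_eq_exp'[of z 0 1 "-1"] by (cases "z = 0") (simp_all add: exp_2_ln_norm power_int_minus)

lemma bipow_neg [simp]: "bipow z (-1) 0 = inverse z"
proof -
  have "bipow z (-1 + 1) (0 + 0) = bipow z (-1) 0 * bipow z 1 0"
    by (rule bipow_add) auto
  then have "bipow z (-1) 0 * z = 1" if "z \<noteq> 0"
    using that by (simp add: bipow_eq_exp'[of z 0 0 0])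
  then show "bipow z (-1) 0 = inverse z"
    by (cases "z = 0") (auto simp: field_simps)
qed

lemma bipow_cnj:
  assumes "\<nu> - \<nu>' \<in> \<int>"
  shows "bipow (cnj z) \<nu> \<nu>' = bipow z \<nu>' \<nu>"
proof (cases "z = 0")
  case False
  obtain m where m: "\<nu> - \<nu>' = of_int m" using assms by (auto elim!: Ints_cases)
  have m': "\<nu>' - \<nu> = of_int (- m)" using m by (metis minus_diff_eq of_int_minus)
  have e: "exp (2 * \<nu> * of_real (ln (norm z))) = exp (2 * \<nu>' * of_real (ln (norm z))) * (z * cnj z) powi m"
  proof -
    have "exp (2 * \<nu> * of_real (ln (norm z))) = exp (2 * \<nu>' * of_real (ln (norm z))) * exp (of_int m * of_real (2 * ln (norm z)))"
      unfolding exp_add[symmetric] m[symmetric] by (simp add: algebra_simps)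
    also have "exp (of_int m * of_real (2 * ln (norm z)) :: complex) = (exp (of_real (2 * ln (norm z)))) powi m"
      by (simp add: exp_power_int mult.commute)
    also have "exp (of_real (2 * ln (norm z))) = (of_real ((norm z)\<^sup>2) :: complex)"
      using False by (simp add: exp_2_ln_norm complex_norm_square del: of_real_power)
    finally show ?thesis by (simp only: complex_norm_square)
  qed
  show ?thesis
    using False unfolding bipow_eq_exp[OF False] by (subst bipow_eq_exp) (simp_all add: m m' e power_int_mult_distrib power_int_minus)
qed simp

lemma norm_bipow: "z \<noteq> 0 \<Longrightarrow> norm (bipow z \<nu> \<nu>') = norm z powr (2 * Re \<nu> + of_int \<lfloor>Re (\<nu>' - \<nu>)\<rfloor>)"
  by (simp add: bipow_eq_exp norm_mult norm_power_int powr_add powr_real_of_int' )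
     (simp add: powr_def)

text \<open>The function is a joint eigenfunction of \<open>z \<partial>/\<partial>z\<close> and \<open>cnj z \<partial>/\<partial>(cnj z)\<close> with eigenvalues
  \<open>\<nu>\<close> and \<open>\<nu>'\<close>.  This is what makes integration by parts reproduce the exponents.\<close>

lemma has_derivative_bipow:
  assumes "z \<noteq> 0" "\<nu> - \<nu>' \<in> \<int>"
  shows "((\<lambda>z. bipow z \<nu> \<nu>') has_derivative (\<lambda>h. bipow z \<nu> \<nu>' * (\<nu> * (h / z) + \<nu>' * cnj (h / z)))) (at z)"
proof -
  obtain m where m: "\<nu> - \<nu>' = of_int m" using assms by (auto elim!: Ints_cases)
  have m': "\<nu>' - \<nu> = of_int (- m)" using m by (metis minus_diff_eq of_int_minus)
  have nu': "\<nu>' = \<nu> + of_int (- m)" using m' by (simp add: algebra_simps)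
  have nz: "norm z > 0" using assms by simp
  have ln: "((\<lambda>z. ln (norm z)) has_derivative (\<lambda>h. (z \<bullet> h) / (norm z)\<^sup>2)) (at z)"
    by (rule has_derivative_eq_rhs[OF has_derivative_ln[OF nz has_derivative_norm[OF assms(1)]]])
       (use nz in \<open>simp add: fun_eq_iff sgn_div_norm power2_eq_square field_simps inner_commute\<close>)
  have 2: "complex_of_real ((z \<bullet> h) / (norm z)\<^sup>2) = (h / z + cnj (h / z)) / 2" for h
  proof -
    have "h / z + cnj (h / z) = (h * cnj z + cnj h * z) / (z * cnj z)"
      using assms by (simp add: field_simps)
    also have "h * cnj z + cnj h * z = of_real (2 * (z \<bullet> h))"
      by (simp add: complex_eq_iff inner_complex_def)
    finally show ?thesis
      unfolding complex_norm_square[symmetric] by simp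
  qed
  have e: "((\<lambda>z. exp (2 * \<nu> * of_real (ln (norm z)))) has_derivative
     (\<lambda>h. exp (2 * \<nu> * of_real (ln (norm z))) * (2 * \<nu> * of_real ((z \<bullet> h) / (norm z)\<^sup>2)))) (at z)"
    by (rule has_derivative_compose[OF _ DERIV_exp[unfolded has_field_derivative_def]])
       (intro derivative_intros ln)
  have p: "((\<lambda>z. cnj z powi (- m)) has_derivative (\<lambda>h. cnj h * (of_int (- m) * cnj z powi (- m - 1)))) (at z)"
    by (rule has_derivative_compose[OF bounded_linear_imp_has_derivative[OF bounded_linear_cnj] has_derivative_power_int'])
       (use assms in simp)
  have q: "cnj z powi (- m - 1) = cnj z powi (- m) / cnj z"
    using assms by (simp add: power_int_diff)
  have "((\<lambda>z. exp (2 * \<nu> * of_real (ln (norm z))) * cnj z powi (- m)) has_derivative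
    (\<lambda>h. bipow z \<nu> \<nu>' * (\<nu> * (h / z) + \<nu>' * cnj (h / z)))) (at z)"
  proof (rule has_derivative_eq_rhs[OF has_derivative_mult[OF e p]], rule ext)
    fix h
    have alg: "E * (a * (M * (W / b))) + E * (2 * \<nu> * ((x + a / b) / 2)) * W = E * W * (\<nu> * x + (\<nu> + M) * (a / b))"
      for E a M W b x :: complex
    proof -
      have "a * (M * (W / b)) = M * W * (a / b)" "2 * \<nu> * ((x + a / b) / 2) = \<nu> * (x + a / b)"
        by simp_all
      then show ?thesis by (simp only: distrib_left distrib_right mult_ac add_ac)
    qed
    show "exp (2 * \<nu> * of_real (ln (norm z))) * (cnj h * (of_int (- m) * cnj z powi (- m - 1))) +
        exp (2 * \<nu> * of_real (ln (norm z))) * (2 * \<nu> * of_real ((z \<bullet> h) / (norm z)\<^sup>2)) * cnj z powi (- m) =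
        bipow z \<nu> \<nu>' * (\<nu> * (h / z) + \<nu>' * cnj (h / z))"
      unfolding 2 q bipow_eq_exp'[OF assms(1) m'] complex_cnj_divide alg unfolding nu' ..
  qed
  then show ?thesis
    by (rule has_derivative_transform_within_open[where s = "- {0}"])
       (use assms in \<open>auto simp: bipow_eq_exp m'\<close>)
qed

lemma continuous_on_bipow:
  assumes "\<nu> - \<nu>' \<in> \<int>" "continuous_on S f" "\<And>x. x \<in> S \<Longrightarrow> f x \<noteq> 0"
  shows "continuous_on S (\<lambda>x. bipow (f x) \<nu> \<nu>')"
proof -
  have "continuous_on (- {0}) (\<lambda>z. bipow z \<nu> \<nu>')"
    using has_derivative_continuous[OF has_derivative_bipow[OF _ assms(1)]]
    by (intro continuous_at_imp_continuous_on) auto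
  then show ?thesis
    by (rule continuous_on_compose2) (use assms in auto)
qed

lemma borel_measurable_bipow:
  assumes "\<nu> - \<nu>' \<in> \<int>" "f \<in> borel_measurable M"
  shows "(\<lambda>x. bipow (f x) \<nu> \<nu>') \<in> borel_measurable M"
proof -
  have "(\<lambda>z. if z \<in> - {0} then bipow z \<nu> \<nu>' else 0) \<in> borel_measurable borel"
    by (rule borel_measurable_continuous_on_if) (auto intro!: continuous_on_bipow assms continuous_intros)
  also have "(\<lambda>z. if z \<in> - {0} then bipow z \<nu> \<nu>' else 0) = (\<lambda>z. bipow z \<nu> \<nu>')"
    by auto
  finally show ?thesis
    using measurable_compose[OF assms(2)] by blast
qed

section \<open>Wirtinger derivatives of both kinds\<close>

text \<open>With \<open>c\<close> true the functions \<open>cj\<close>, \<open>wirt\<close>, \<open>wd\<close> and \<open>bp\<close> describe the holomorphic half of the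
  calculus, with \<open>c\<close> false the antiholomorphic half.\<close>

definition cj :: "bool \<Rightarrow> complex \<Rightarrow> complex" where
  "cj c z = (if c then z else cnj z)"

lemma cj_simps [simp]:
  "cj c (z + w) = cj c z + cj c w" "cj c (z - w) = cj c z - cj c w" "cj c (- z) = - cj c z"
  "cj c (z * w) = cj c z * cj c w" "cj c (z / w) = cj c z / cj c w" "cj c (z ^ n) = cj c z ^ n"
  "cj c 0 = 0" "cj c 1 = 1" "cj c (of_real r) = of_real r" "cj c (cnj z) = cnj (cj c z)"
  "cj c z = 0 \<longleftrightarrow> z = 0" "norm (cj c z) = norm z" "cj True z = z" "cj False z = cnj z"
  "cj c (inverse z) = inverse (cj c z)"
  by (auto simp: cj_def)

lemma bounded_linear_cj: "bounded_linear (cj c)"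
  unfolding cj_def by (cases c) (auto simp: bounded_linear_cnj bounded_linear_ident)

lemmas has_derivative_cj [derivative_intros] = bounded_linear.has_derivative[OF bounded_linear_cj]
lemmas continuous_on_cj [continuous_intros] = bounded_linear.continuous_on[OF bounded_linear_cj]

text \<open>The coefficient of \<open>cj c h\<close> in a real-linear map \<open>L\<close> of \<open>h\<close>; the coefficient of the conjugate is
  \<open>wirt (\<not> c) L\<close>.\<close>

definition wirt :: "bool \<Rightarrow> (complex \<Rightarrow> complex) \<Rightarrow> complex" where
  "wirt c L = (L 1 - cj c \<i> * L \<i>) / 2"

lemma wirt_eq [simp]: "wirt c (\<lambda>h. A * cj c h + B * cnj (cj c h)) = A"
  by (cases c) (simp_all add: wirt_def field_simps)

lemma linear_complex_wirt:
  assumes "linear L"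
  shows "L h = wirt c L * cj c h + wirt (\<not> c) L * cnj (cj c h)"
proof -
  have "L h = L (Re h *\<^sub>R 1 + Im h *\<^sub>R \<i>)"
    by (simp add: scaleR_conv_of_real complex_eq[symmetric] mult.commute)
  also have "\<dots> = Re h *\<^sub>R L 1 + Im h *\<^sub>R L \<i>"
    by (simp only: linear_add[OF assms] linear_scale[OF assms])
  also have "\<dots> = of_real (Re h) * L 1 + of_real (Im h) * L \<i>"
    by (simp add: scaleR_conv_of_real)
  finally have L: "L h = of_real (Re h) * L 1 + of_real (Im h) * L \<i>" .
  have h: "of_real (Re h) = (h + cnj h) / 2" "of_real (Im h) = (h - cnj h) / (2 * \<i>)"
    by (simp_all add: complex_eq_iff)
  show ?thesis
    unfolding L h by (cases c) (simp_all add: wirt_def field_simps)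
qed

text \<open>The first exponent belongs to the variable \<open>cj c z\<close> that is differentiated, so that for both values
  of \<open>c\<close> the shift and derivative formulas read alike.\<close>

definition bp :: "bool \<Rightarrow> complex \<Rightarrow> complex \<Rightarrow> complex \<Rightarrow> complex" where
  "bp c z \<nu> \<nu>' = bipow (cj c z) \<nu> \<nu>'"

lemma bp_shift:
  assumes "\<nu> - \<nu>' \<in> \<int>"
  shows "bp c z (\<nu> - 1) \<nu>' = bp c z \<nu> \<nu>' / cj c z" "bp c z (\<nu> + 1) \<nu>' = bp c z \<nu> \<nu>' * cj c z"
  using bipow_add[OF assms, of "-1" 0 "cj c z"] bipow_add[OF assms, of 1 0 "cj c z"]
  by (simp_all add: bp_def divide_inverse)

lemma has_derivative_bp:
  assumes "z \<noteq> 0" "\<nu> - \<nu>' \<in> \<int>"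
  shows "((\<lambda>z. bp c z \<nu> \<nu>') has_derivative
    (\<lambda>h. bp c z \<nu> \<nu>' * (\<nu> * (cj c h / cj c z) + \<nu>' * cnj (cj c h / cj c z)))) (at z)"
  unfolding bp_def
  using has_derivative_compose[OF bounded_linear_imp_has_derivative[OF bounded_linear_cj] has_derivative_bipow, of c z \<nu> \<nu>' UNIV] assms
  by simp

lemma continuous_on_bp:
  assumes "\<nu> - \<nu>' \<in> \<int>" "continuous_on S f" "\<And>x. x \<in> S \<Longrightarrow> f x \<noteq> 0"
  shows "continuous_on S (\<lambda>x. bp c (f x) \<nu> \<nu>')"
  unfolding bp_def using assms by (intro continuous_on_bipow continuous_on_cj) auto

section \<open>Compactly supported integrands with a parameter\<close>

lemma integrable_compact_support:
  fixes f :: "'a::euclidean_space \<Rightarrow> complex"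
  assumes "continuous_on UNIV f" "\<And>x. f x \<noteq> 0 \<Longrightarrow> norm x \<le> M"
  shows "integrable lborel f"
proof -
  have "integrable lborel (\<lambda>x. indicator (cball 0 M) x *\<^sub>R f x)"
    by (intro borel_integrable_compact continuous_on_subset[OF assms(1)]) auto
  also have "(\<lambda>x. indicator (cball 0 M) x *\<^sub>R f x) = f"
    using assms(2) by (auto simp: fun_eq_iff indicator_def)
  finally show ?thesis .
qed

lemma integral_compact_support:
  fixes f :: "'a::euclidean_space \<Rightarrow> complex"
  assumes "continuous_on UNIV f" "\<And>x. f x \<noteq> 0 \<Longrightarrow> norm x \<le> M" "cball 0 M \<subseteq> cbox a b"
  shows "(\<integral>x. f x \<partial>lborel) = integral (cbox a b) f"
proof -
  have "(\<integral>x. f x \<partial>lborel) = integral UNIV f"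
    using integral_lborel[OF integrable_compact_support[OF assms(1,2)]] by simp
  also have "\<dots> = integral UNIV (\<lambda>x. if x \<in> cbox a b then f x else 0)"
  proof (rule arg_cong[where f = "integral UNIV"], rule ext)
    fix x show "f x = (if x \<in> cbox a b then f x else 0)"
      using assms(2)[of x] assms(3) by (auto simp: subset_iff)
  qed
  also have "\<dots> = integral (cbox a b) f"
    by (rule integral_restrict_UNIV)
  finally show ?thesis .
qed

text \<open>Near \<open>x0\<close> all integrands live in one ball, so the Leibniz rule on a box applies.  The derivative
  of the integrand vanishes outside the same ball because the integrand does so for all \<open>x\<close> near \<open>x0\<close>.\<close>

lemma has_derivative_lborel_integral:
  fixes f :: "'x::euclidean_space \<Rightarrow> 'p::euclidean_space \<Rightarrow> complex"
  assumes d: "\<And>x p. ((\<lambda>x. f x p) has_derivative f' x p) (at x)"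
    and cf: "\<And>x. continuous_on UNIV (f x)"
    and cf': "\<And>h. continuous_on UNIV (\<lambda>(x, p). f' x p h)"
    and r: "r > 0" and supp: "\<And>x p. dist x x0 < r \<Longrightarrow> f x p \<noteq> 0 \<Longrightarrow> norm p \<le> M"
  shows "((\<lambda>x. \<integral>p. f x p \<partial>lborel) has_derivative (\<lambda>h. \<integral>p. f' x0 p h \<partial>lborel)) (at x0)"
proof -
  obtain a where a: "cball (0::'p) M \<subseteq> cbox (- a) a"
    using bounded_subset_cbox_symmetric[OF bounded_cball] by metis
  define fx where "fx x p = Blinfun (f' x p)" for x p
  have fx [simp]: "blinfun_apply (fx x p) = f' x p" for x p
    unfolding fx_def by (rule bounded_linear_Blinfun_apply[OF has_derivative_bounded_linear[OF d]])
  have cfx: "continuous_on UNIV (\<lambda>(x, p). fx x p)"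
    unfolding case_prod_unfold
    by (rule continuous_on_blinfun_componentwise) (use cf' in \<open>simp add: case_prod_unfold\<close>)
  have "((\<lambda>x. integral (cbox (- a) a) (f x)) has_derivative integral (cbox (- a) a) (fx x0)) (at x0 within ball x0 r)"
  proof (rule leibniz_rule)
    show "f x integrable_on cbox (- a) a" for x
      by (intro integrable_continuous continuous_on_subset[OF cf]) auto
    show "((\<lambda>x. f x t) has_derivative blinfun_apply (fx x t)) (at x within ball x0 r)" for x t
      using d by (auto intro: has_derivative_at_withinI)
    show "continuous_on (ball x0 r \<times> cbox (- a) a) (\<lambda>(x, t). fx x t)"
      by (rule continuous_on_subset[OF cfx]) auto
  qed (use r in auto)
  then have "((\<lambda>x. integral (cbox (- a) a) (f x)) has_derivative integral (cbox (- a) a) (fx x0)) (at x0)"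
    using r by (subst (asm) at_within_open) auto
  then have "((\<lambda>x. \<integral>p. f x p \<partial>lborel) has_derivative integral (cbox (- a) a) (fx x0)) (at x0)"
  proof (rule has_derivative_transform_within_open[where s = "ball x0 r"])
    fix x assume "x \<in> ball x0 r"
    then show "integral (cbox (- a) a) (f x) = (\<integral>p. f x p \<partial>lborel)"
      by (intro integral_compact_support[symmetric, OF cf _ a] supp) (auto simp: dist_commute)
  qed (use r in auto)
  moreover have "(\<integral>p. f' x0 p h \<partial>lborel) = blinfun_apply (integral (cbox (- a) a) (fx x0)) h" for h
  proof -
    have c0: "continuous_on UNIV (fx x0)"
      using continuous_on_compose2[OF cfx, of UNIV "\<lambda>p. (x0, p)"] by (simp add: continuous_on_Pair)
    have c1: "continuous_on UNIV (\<lambda>p. f' x0 p h)"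
      using continuous_on_compose2[OF cf', of UNIV "\<lambda>p. (x0, p)"] by (simp add: continuous_on_Pair)
    have "fx x0 integrable_on cbox (- a) a"
      by (intro integrable_continuous continuous_on_subset[OF c0]) auto
    then have "blinfun_apply (integral (cbox (- a) a) (fx x0)) h = integral (cbox (- a) a) (\<lambda>p. f' x0 p h)"
      by (subst blinfun_apply_integral) simp_all
    also have "\<dots> = (\<integral>p. f' x0 p h \<partial>lborel)"
    proof (rule integral_compact_support[symmetric, OF c1 _ a])
      fix p assume ne: "f' x0 p h \<noteq> 0"
      show "norm p \<le> M"
      proof (rule ccontr)
        assume "\<not> norm p \<le> M"
        then have z: "f x p = 0" if "x \<in> ball x0 r" for x
          using supp[of x p] that by (auto simp: dist_commute)
        have "((\<lambda>x. f x p) has_derivative (\<lambda>h. 0)) (at x0)"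
          by (rule has_derivative_transform_within_open[where s = "ball x0 r" and f = "\<lambda>_. 0"])
             (use z r in auto)
        from has_derivative_unique[OF this d] ne show False by metis
      qed
    qed
    finally show ?thesis by simp
  qed
  ultimately show ?thesis by simp
qed

text \<open>Integration by parts without Fubini: the integral of the translate \<open>f (x *\<^sub>R h + p)\<close> over \<open>p\<close> does not depend
  on \<open>x\<close>, and its derivative at \<open>x = 0\<close> is the integral of \<open>D p h\<close>.\<close>

lemma integral_derivative_eq_0:
  fixes f :: "'p::euclidean_space \<Rightarrow> complex"
  assumes d: "\<And>p. (f has_derivative D p) (at p)"
    and c: "\<And>h. continuous_on UNIV (\<lambda>p. D p h)"
    and supp: "\<And>p. f p \<noteq> 0 \<Longrightarrow> norm p \<le> M"
  shows "(\<integral>p. D p h \<partial>lborel) = 0"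
proof -
  have cf: "continuous_on UNIV f"
    by (intro continuous_at_imp_continuous_on) (auto intro: has_derivative_continuous d)
  have lin: "D p (x *\<^sub>R h) = x *\<^sub>R D p h" for p x h
    using has_derivative_linear[OF d] by (rule linear_scale)
  have 1: "((\<lambda>x::real. \<integral>p. f (x *\<^sub>R h + p) \<partial>lborel) has_derivative (\<lambda>k. \<integral>p. D (0 *\<^sub>R h + p) (k *\<^sub>R h) \<partial>lborel)) (at 0)"
  proof (rule has_derivative_lborel_integral[where r = 1 and M = "M + norm h" and f' = "\<lambda>x p k. D (x *\<^sub>R h + p) (k *\<^sub>R h)"])
    show "((\<lambda>x. f (x *\<^sub>R h + p)) has_derivative (\<lambda>k. D (x *\<^sub>R h + p) (k *\<^sub>R h))) (at x)" for x p
      by (rule has_derivative_compose[OF _ d]) (auto intro!: derivative_eq_intros)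
    show "continuous_on UNIV (\<lambda>p. f (x *\<^sub>R h + p))" for x
      by (rule continuous_on_compose2[OF cf]) (auto intro!: continuous_intros)
    show "continuous_on UNIV (\<lambda>(x, p). D (x *\<^sub>R h + p) (k *\<^sub>R h))" for k
      unfolding case_prod_unfold
      by (rule continuous_on_compose2[OF c]) (auto intro!: continuous_intros)
    fix x :: real and p assume x: "dist x 0 < 1" and "f (x *\<^sub>R h + p) \<noteq> 0"
    then have "norm (x *\<^sub>R h + p) \<le> M" by (intro supp)
    moreover have "norm p \<le> norm (x *\<^sub>R h + p) + norm (x *\<^sub>R h)"
      using norm_triangle_ineq4[of "x *\<^sub>R h + p" "x *\<^sub>R h"] by simp
    moreover have "norm (x *\<^sub>R h) \<le> 1 * norm h"
      unfolding norm_scaleR using x by (intro mult_right_mono) (auto simp: dist_norm)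
    ultimately show "norm p \<le> M + norm h" by simp
  qed simp
  have "(\<integral>p. f (x *\<^sub>R h + p) \<partial>lborel) = (\<integral>p. f p \<partial>lborel)" for x
  proof -
    have "(\<integral>p. f p \<partial>lborel) = (\<integral>p. f p \<partial>distr lborel borel (\<lambda>p. x *\<^sub>R h + p))"
      by (simp add: lborel_distr_translation)
    also have "\<dots> = (\<integral>p. f (x *\<^sub>R h + p) \<partial>lborel)"
      by (rule integral_distr) (auto intro: borel_measurable_continuous_onI cf)
    finally show ?thesis by simp
  qed
  then have "((\<lambda>x::real. \<integral>p. f (x *\<^sub>R h + p) \<partial>lborel) has_derivative (\<lambda>k. 0)) (at 0)"
    by simp
  from has_derivative_unique[OF 1 this, THEN fun_cong, of 1] show ?thesis
    by simp
qed

section \<open>Functions with compact support in the group\<close>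

definition cs_GL2 :: "(mat2 \<Rightarrow> complex) \<Rightarrow> bool" where
  "cs_GL2 g \<longleftrightarrow> continuous_on UNIV g \<and> (\<exists>C. compact C \<and> C \<subseteq> GL2 \<and> (\<forall>X. X \<notin> C \<longrightarrow> g X = 0))"

lemma continuous_on_entry [continuous_intros]:
  "continuous_on S f \<Longrightarrow> continuous_on S (\<lambda>x. (f x :: mat2) $ i $ j)"
  by (intro continuous_on_component)

lemma continuous_on_det2 [continuous_intros]:
  "continuous_on S f \<Longrightarrow> continuous_on S (\<lambda>x. det (f x :: mat2))"
  unfolding det_2 by (intro continuous_intros)

lemma open_GL2: "open GL2"
proof -
  have "open {X :: mat2. det X \<noteq> 0}"
    by (intro open_Collect_neq continuous_intros)
  moreover have "{X. det X \<noteq> 0} = GL2" using GL2_iff by auto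
  ultimately show ?thesis by simp
qed

lemma cs_GL2I:
  assumes C: "compact C" "C \<subseteq> GL2" "\<And>X. X \<notin> C \<Longrightarrow> g X = 0" and g: "continuous_on GL2 g"
  shows "cs_GL2 g"
proof -
  have "isCont g X" for X
  proof (cases "X \<in> C")
    case True
    then show ?thesis using g C open_GL2 by (auto simp: continuous_on_eq_continuous_at)
  next
    case False
    have o: "open (- C)" using C by (simp add: compact_imp_closed open_Compl)
    have "continuous_on (- C) g"
      by (subst continuous_on_cong[OF refl C(3)]) auto
    then show ?thesis using o False by (auto simp: continuous_on_eq_continuous_at)
  qed
  then show ?thesis
    unfolding cs_GL2_def using C by (auto intro!: continuous_at_imp_continuous_on)
qed

lemma cs_GL2_continuous: "cs_GL2 g \<Longrightarrow> continuous_on UNIV g"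
  by (simp add: cs_GL2_def)

lemma cs_GL2_zero: "cs_GL2 g \<Longrightarrow> det X = 0 \<Longrightarrow> g X = 0"
  using GL2_iff by (auto simp: cs_GL2_def)

text \<open>The differential of a function of a matrix in terms of its Wirtinger derivatives \<open>P i j\<close> in
  the entries and the Wirtinger derivatives \<open>Q i j\<close> of the opposite kind.\<close>

definition mat_form :: "bool \<Rightarrow> (2 \<Rightarrow> 2 \<Rightarrow> mat2 \<Rightarrow> complex) \<Rightarrow> (2 \<Rightarrow> 2 \<Rightarrow> mat2 \<Rightarrow> complex) \<Rightarrow> mat2 \<Rightarrow> mat2 \<Rightarrow> complex" where
  "mat_form c P Q X Y = (\<Sum>i\<in>UNIV. \<Sum>j\<in>UNIV. P i j X * cj c (Y $ i $ j) + Q i j X * cnj (cj c (Y $ i $ j)))"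

text \<open>Off its compact support the function vanishes locally, so it is continuously differentiable on all
  matrices and its partial derivatives again have compact support in the group.\<close>

lemma test_functions_derivative:
  assumes F: "F \<in> test_functions"
  obtains P Q where "cs_GL2 F" "\<And>i j. cs_GL2 (P i j)" "\<And>i j. cs_GL2 (Q i j)"
    "\<And>X. (F has_derivative mat_form c P Q X) (at X)"
proof -
  obtain C where C: "compact C" "C \<subseteq> GL2" "\<And>X. X \<notin> C \<Longrightarrow> F X = 0" and sm: "smooth_on F GL2"
    using F unfolding test_functions_def by blast
  define D where "D X = frechet_derivative F (at X)" for X
  have "Ck_on (Suc 0) F GL2" using sm unfolding smooth_on_def by blast
  then have diff: "F differentiable_on GL2" and cD: "\<And>v. continuous_on GL2 (\<lambda>X. D X v)"
    by (auto simp: D_def)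
  have D0: "(F has_derivative (\<lambda>_. 0)) (at X)" if "X \<notin> C" for X
  proof (rule has_derivative_transform_within_open[where s = "- C" and f = "\<lambda>_. 0"])
    show "open (- C)" using C(1) by (simp add: compact_imp_closed open_Compl)
    show "0 = F Y" if "Y \<in> - C" for Y using C(3)[of Y] that by simp
  qed (use that in auto)
  have DF: "(F has_derivative D X) (at X)" for X
  proof (cases "X \<in> GL2")
    case True
    then have "F differentiable at X"
      using diff unfolding differentiable_on_def at_within_open[OF True open_GL2, symmetric] by blast
    then show ?thesis by (simp add: D_def frechet_derivative_works)
  next
    case False
    then have "X \<notin> C" using C by auto
    from D0[OF this] have "F differentiable at X" unfolding differentiable_def by blast
    then show ?thesis by (simp add: D_def frechet_derivative_works)
  qed
  have D_zero: "D X v = 0" if "X \<notin> C" for X v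
    using has_derivative_unique[OF D0[OF that] DF] by metis
  define E :: "2 \<Rightarrow> 2 \<Rightarrow> complex \<Rightarrow> mat2" where "E i j z = axis i (axis j z)" for i j z
  have linE: "linear (E i j)" for i j
    by (rule linearI) (auto simp: E_def vec_eq_iff axis_def)
  define P where "P i j X = wirt c (\<lambda>z. D X (E i j z))" for i j X
  define Q where "Q i j X = wirt (\<not> c) (\<lambda>z. D X (E i j z))" for i j X
  have cs: "cs_GL2 (\<lambda>X. wirt b (\<lambda>z. D X (E i j z)))" for b i j
    by (rule cs_GL2I[OF C(1,2)]) (auto simp: wirt_def D_zero intro!: continuous_intros cD)
  have "D X Y = mat_form c P Q X Y" for X Y
  proof -
    have lin: "linear (D X)" using DF by (rule has_derivative_linear)
    have Y: "Y = (\<Sum>i\<in>UNIV. \<Sum>j\<in>UNIV. E i j (Y $ i $ j))"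
      by (auto simp: vec_eq_iff forall_2 sum_2 E_def axis_def)
    have "D X Y = (\<Sum>i\<in>UNIV. \<Sum>j\<in>UNIV. D X (E i j (Y $ i $ j)))"
      by (subst Y) (simp add: linear_sum[OF lin])
    also have "\<dots> = mat_form c P Q X Y"
      unfolding mat_form_def P_def Q_def
    proof (intro sum.cong refl)
      fix i j :: 2
      have "linear (\<lambda>z. D X (E i j z))"
        using linear_compose[OF linE lin] by (simp add: o_def)
      from linear_complex_wirt[OF this, of "Y $ i $ j" c]
      show "D X (E i j (Y $ i $ j)) = wirt c (\<lambda>z. D X (E i j z)) * cj c (Y $ i $ j) +
        wirt (\<not> c) (\<lambda>z. D X (E i j z)) * cnj (cj c (Y $ i $ j))" .
    qed
    finally show ?thesis .
  qed
  then have "D X = mat_form c P Q X" for X by (rule ext)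
  then have "(F has_derivative mat_form c P Q X) (at X)" for X
    using DF[of X] by simp
  moreover have "cs_GL2 F"
    using C DF by (auto simp: cs_GL2_def intro!: continuous_at_imp_continuous_on intro: has_derivative_continuous)
  moreover have "cs_GL2 (P i j)" "cs_GL2 (Q i j)" for i j
    unfolding P_def[abs_def] Q_def[abs_def] by (rule cs)+
  ultimately show thesis using that by blast
qed

text \<open>The coordinates of invertible matrices.\<close>

definition off_axes :: "coords set" where
  "off_axes = {p. snd (fst p) \<noteq> 0 \<and> snd p \<noteq> 0}"

lemma det_Phi_pair: "det (Phi t s p) = snd (fst p) * snd p"
proof -
  obtain w u v where "p = ((w, u), v)" by (metis surj_pair)
  then show ?thesis by simp
qed

lemma continuous_on_Phi [continuous_intros]:
  assumes "continuous_on S t" "continuous_on S s" "continuous_on S p"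
  shows "continuous_on S (\<lambda>x. Phi (t x) (s x) (p x))"
  unfolding Phi_def case_prod_unfold by (intro continuous_intros assms)

text \<open>The factor \<open>n\<close> may be singular on the axes \<open>u v = 0\<close>: there \<open>Phi\<close> is singular, so \<open>g\<close> vanishes
  in a neighbourhood and the product extends continuously by zero.\<close>

lemma continuous_on_pullback:
  fixes t s :: "'y::t2_space \<Rightarrow> complex"
  assumes g: "cs_GL2 g" and tsp: "continuous_on UNIV t" "continuous_on UNIV s" "continuous_on UNIV p"
    and n: "continuous_on {y. p y \<in> off_axes} n"
  shows "continuous_on UNIV (\<lambda>y. g (Phi (t y) (s y) (p y)) * n y)"
proof (rule continuous_at_imp_continuous_on, rule ballI)
  fix y
  obtain C where C: "compact C" "C \<subseteq> GL2" "\<And>X. X \<notin> C \<Longrightarrow> g X = 0"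
    using g by (auto simp: cs_GL2_def)
  have P: "continuous_on UNIV (\<lambda>y. Phi (t y) (s y) (p y))"
    by (intro continuous_intros tsp)
  show "isCont (\<lambda>y. g (Phi (t y) (s y) (p y)) * n y) y"
  proof (cases "p y \<in> off_axes")
    case True
    have o: "open {y. p y \<in> off_axes}"
      unfolding off_axes_def mem_Collect_eq by (intro open_Collect_conj open_Collect_neq continuous_intros tsp)
    have "continuous_on {y. p y \<in> off_axes} (\<lambda>y. g (Phi (t y) (s y) (p y)) * n y)"
      by (intro continuous_on_mult n continuous_on_compose2[OF cs_GL2_continuous[OF g]]
          continuous_on_subset[OF P]) auto
    then show ?thesis using o True by (auto simp: continuous_on_eq_continuous_at)
  next
    case False
    let ?S = "(\<lambda>y. Phi (t y) (s y) (p y)) -` (- C)"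
    have o: "open ?S"
      using C by (intro open_vimage P) (simp add: compact_imp_closed open_Compl)
    have "Phi (t y) (s y) (p y) \<notin> GL2"
      using False by (auto simp: GL2_iff det_Phi_pair off_axes_def)
    then have y: "y \<in> ?S" using C by auto
    have "continuous_on ?S (\<lambda>y. g (Phi (t y) (s y) (p y)) * n y)"
      by (subst continuous_on_cong[OF refl, where g = "\<lambda>_. 0"]) (auto simp: C)
    then show ?thesis using o y by (auto simp: continuous_on_eq_continuous_at)
  qed
qed

text \<open>The entries of \<open>Phi t s ((w, u), v)\<close> determine \<open>w\<close>, \<open>u = x\<^sub>1\<^sub>1 + t x\<^sub>2\<^sub>1\<close> and \<open>v = x\<^sub>2\<^sub>2 - s x\<^sub>2\<^sub>1\<close>,
  which are therefore bounded when \<open>t\<close>, \<open>s\<close> and the matrix are.\<close>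

lemma pullback_support:
  assumes "cs_GL2 g"
  obtains M where "\<And>t s p. norm t \<le> R \<Longrightarrow> norm s \<le> R \<Longrightarrow> g (Phi t s p) \<noteq> 0 \<Longrightarrow> norm p \<le> M"
proof -
  obtain C where C: "compact C" "\<And>X. X \<notin> C \<Longrightarrow> g X = 0"
    using assms by (auto simp: cs_GL2_def)
  obtain B where B: "\<And>X. X \<in> C \<Longrightarrow> norm X \<le> B"
    using compact_imp_bounded[OF C(1)] by (auto simp: bounded_iff)
  have "norm p \<le> 3 * B + 2 * (R * B)" if ts: "norm t \<le> R" "norm s \<le> R" and ne: "g (Phi t s p) \<noteq> 0" for t s p
  proof -
    obtain w u v where p: "p = ((w, u), v)" by (metis surj_pair)
    define X where "X = Phi t s p"
    have "norm X \<le> B" using ne C(2) B by (auto simp: X_def)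
    then have X: "norm (X $ i $ j) \<le> B" for i j
      using Finite_Cartesian_Product.norm_nth_le[of X i] Finite_Cartesian_Product.norm_nth_le[of "X $ i" j] by linarith
    have w: "w = X $ 2 $ 1" and u: "u = X $ 1 $ 1 + t * X $ 2 $ 1" and v: "v = X $ 2 $ 2 - s * X $ 2 $ 1"
      by (simp_all add: X_def p Phi_def)
    have m: "norm (r * X $ 2 $ 1) \<le> R * B" if "norm r \<le> R" for r
      unfolding norm_mult using that X[of 2 1] by (intro mult_mono) (auto intro: order_trans[OF norm_ge_zero])
    have "norm w \<le> B" using X w by simp
    moreover have "norm u \<le> B + R * B" unfolding u
      using norm_triangle_ineq[of "X $ 1 $ 1" "t * X $ 2 $ 1"] X[of 1 1] m[OF ts(1)] by linarith
    moreover have "norm v \<le> B + R * B" unfolding v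
      using norm_triangle_ineq4[of "X $ 2 $ 2" "s * X $ 2 $ 1"] X[of 2 2] m[OF ts(2)] by linarith
    moreover have "norm p \<le> norm w + norm u + norm v"
      unfolding p using norm_Pair_le[of "(w, u)" v] norm_Pair_le[of w u] by linarith
    ultimately show ?thesis by linarith
  qed
  then show thesis by (rule that)
qed

lemma integrable_pullback:
  assumes "cs_GL2 g" "continuous_on off_axes n"
  shows "integrable lborel (\<lambda>p. g (Phi t s p) * n p)"
proof -
  obtain M where M: "\<And>p. g (Phi t s p) \<noteq> 0 \<Longrightarrow> norm p \<le> M"
    using pullback_support[OF assms(1), of "max (norm t) (norm s)"] by (metis max.cobounded1 max.cobounded2)
  show ?thesis
    by (rule integrable_compact_support[where M = M])
       (use assms M in \<open>auto intro!: continuous_on_pullback[OF assms(1)] continuous_on_const continuous_on_id\<close>)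
qed

section \<open>Differentiating kernel integrals\<close>

definition kernel_int :: "(mat2 \<Rightarrow> complex) \<Rightarrow> (coords \<Rightarrow> complex) \<Rightarrow> complex \<Rightarrow> complex \<Rightarrow> complex" where
  "kernel_int g n t s = (\<integral>p. g (Phi t s p) * n p \<partial>lborel)"

lemma continuous_on_kernel_int:
  assumes g: "cs_GL2 g" and n: "continuous_on off_axes n"
  shows "continuous_on UNIV (\<lambda>(t, s). kernel_int g n t s)"
proof (rule continuous_at_imp_continuous_on, rule ballI)
  fix ts0 :: "complex \<times> complex"
  define R where "R = norm ts0 + 1"
  have tsR: "norm (fst ts) \<le> R" "norm (snd ts) \<le> R" if "ts \<in> ball ts0 1" for ts
  proof -
    have "norm ts \<le> R"
      using that norm_triangle_ineq2[of ts ts0] by (simp add: dist_norm norm_minus_commute R_def)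
    then show "norm (fst ts) \<le> R" "norm (snd ts) \<le> R"
      using norm_fst_le[of "fst ts" "snd ts"] norm_snd_le[of "snd ts" "fst ts"] by auto
  qed
  obtain M where M: "\<And>t s p. norm t \<le> R \<Longrightarrow> norm s \<le> R \<Longrightarrow> g (Phi t s p) \<noteq> 0 \<Longrightarrow> norm p \<le> M"
    using pullback_support[OF g, of R] by metis
  obtain a where a: "cball (0::coords) M \<subseteq> cbox (- a) a"
    using bounded_subset_cbox_symmetric[OF bounded_cball] by metis
  have c: "continuous_on UNIV (\<lambda>(ts, p). g (Phi (fst ts) (snd ts) p) * n p)"
    unfolding case_prod_unfold
    by (rule continuous_on_pullback[OF g])
       (auto intro!: continuous_intros continuous_on_compose2[OF n])
  have "continuous_on (ball ts0 1) (\<lambda>ts. integral (cbox (- a) a) (\<lambda>p. g (Phi (fst ts) (snd ts) p) * n p))"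
    by (rule integral_continuous_on_param) (rule continuous_on_subset[OF c], simp)
  also have "?this \<longleftrightarrow> continuous_on (ball ts0 1) (\<lambda>(t, s). kernel_int g n t s)"
  proof (rule continuous_on_cong[OF refl])
    fix ts assume ts: "ts \<in> ball ts0 1"
    have "(\<integral>p. g (Phi (fst ts) (snd ts) p) * n p \<partial>lborel) = integral (cbox (- a) a) (\<lambda>p. g (Phi (fst ts) (snd ts) p) * n p)"
      by (rule integral_compact_support[OF continuous_on_pullback[OF g] _ a])
         (use tsR[OF ts] M in \<open>auto intro!: continuous_intros n\<close>)
    then show "integral (cbox (- a) a) (\<lambda>p. g (Phi (fst ts) (snd ts) p) * n p) = (case ts of (t, s) \<Rightarrow> kernel_int g n t s)"
      by (simp add: kernel_int_def case_prod_unfold)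
  qed
  finally show "isCont (\<lambda>(t, s). kernel_int g n t s) ts0"
    by (simp add: continuous_on_eq_continuous_at)
qed

definition wd :: "bool \<Rightarrow> (complex \<Rightarrow> complex) \<Rightarrow> complex \<Rightarrow> complex" where
  "wd c f z = wirt c (frechet_derivative f (at z))"

lemma wd_eq: "wd True = wirtinger" "wd False = wirtinger_bar"
  by (simp_all add: wd_def wirt_def wirtinger_def wirtinger_bar_def fun_eq_iff)

lemma wd_has_derivative: "(f has_derivative L) (at z) \<Longrightarrow> wd c f z = wirt c L"
  by (simp add: wd_def frechet_derivative_at[symmetric])

lemma wirt_integral:
  assumes "\<And>h. integrable M (\<lambda>p. D p h)"
  shows "wirt c (\<lambda>h. \<integral>p. D p h \<partial>M) = (\<integral>p. wirt c (D p) \<partial>M)"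
  unfolding wirt_def using assms by simp

locale C1_compact =
  fixes c :: bool and F :: "mat2 \<Rightarrow> complex" and P Q :: "2 \<Rightarrow> 2 \<Rightarrow> mat2 \<Rightarrow> complex"
  assumes F: "cs_GL2 F" and P: "\<And>i j. cs_GL2 (P i j)" and Q: "\<And>i j. cs_GL2 (Q i j)"
    and deriv: "\<And>X. (F has_derivative mat_form c P Q X) (at X)"
begin

lemma continuous_form:
  fixes t s :: "'y::t2_space \<Rightarrow> complex"
  assumes tsp: "continuous_on UNIV t" "continuous_on UNIV s" "continuous_on UNIV p"
    and Y: "\<And>i j. continuous_on UNIV (\<lambda>y. Y y $ i $ j)"
    and n: "continuous_on {y. p y \<in> off_axes} n"
  shows "continuous_on UNIV (\<lambda>y. mat_form c P Q (Phi (t y) (s y) (p y)) (Y y) * n y)"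
  unfolding mat_form_def sum_distrib_right distrib_right mult.assoc
  by (intro continuous_on_sum continuous_on_add continuous_on_pullback P Q tsp continuous_on_mult n
      continuous_on_cj continuous_on_cnj continuous_on_subset[OF Y]) auto

lemma integrable_form:
  assumes Y: "\<And>i j. continuous_on UNIV (\<lambda>p. Y p $ i $ j)" and n: "continuous_on off_axes n"
  shows "integrable lborel (\<lambda>p. mat_form c P Q (Phi t s p) (Y p) * n p)"
  unfolding mat_form_def sum_distrib_right distrib_right mult.assoc
  by (intro Bochner_Integration.integrable_sum Bochner_Integration.integrable_add integrable_pullback P Q continuous_on_mult n
      continuous_on_cj continuous_on_cnj continuous_on_subset[OF Y]) auto

lemma wd_kernel_int:
  assumes n: "continuous_on off_axes n"
  shows wd_kernel_int_t: "wd c (\<lambda>t. kernel_int F n t s) t = (\<integral>p. (- P 1 1 (Phi t s p) * cj c (fst (fst p))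
        - P 1 2 (Phi t s p) * cj c (snd p + s * fst (fst p))) * n p \<partial>lborel)" (is ?t)
    and wd_kernel_int_s: "wd c (\<lambda>s. kernel_int F n t s) s = (\<integral>p. (P 1 2 (Phi t s p) * cj c (snd (fst p) - t * fst (fst p))
        + P 2 2 (Phi t s p) * cj c (fst (fst p))) * n p \<partial>lborel)" (is ?s)
proof -
  let ?Y = "\<lambda>(p :: coords) h. mk2 (- (h * fst (fst p))) (- (h * (snd p + s * fst (fst p)))) 0 0"
  let ?Z = "\<lambda>(p :: coords) h. mk2 0 (h * (snd (fst p) - t * fst (fst p))) 0 (h * fst (fst p))"
  obtain M where M: "\<And>t' s' p. norm t' \<le> max (norm t) (norm s) + 1 \<Longrightarrow> norm s' \<le> max (norm t) (norm s) + 1 \<Longrightarrow> F (Phi t' s' p) \<noteq> 0 \<Longrightarrow> norm p \<le> M"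
    using pullback_support[OF F] by metis
  have near: "norm x \<le> max (norm t) (norm s) + 1" if "dist x t < 1 \<or> dist x s < 1" for x
    using that norm_triangle_ineq2[of x t] norm_triangle_ineq2[of x s] by (auto simp: dist_norm)
  have comp: "continuous_on UNIV (\<lambda>y. mk2 (a y) (b y) (d y) (e y) $ i $ j)"
    if "continuous_on UNIV a" "continuous_on UNIV b" "continuous_on UNIV d" "continuous_on UNIV e"
    for a b d e i j and y :: "'y::topological_space"
    by (intro continuous_intros that)
  have "((\<lambda>t. \<integral>p. F (Phi t s p) * n p \<partial>lborel) has_derivative (\<lambda>h. \<integral>p. mat_form c P Q (Phi t s p) (?Y p h) * n p \<partial>lborel)) (at t)"
  proof (rule has_derivative_lborel_integral[where r = 1 and M = M and f' = "\<lambda>t p h. mat_form c P Q (Phi t s p) (?Y p h) * n p"])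
    show "((\<lambda>t. F (Phi t s p) * n p) has_derivative (\<lambda>h. mat_form c P Q (Phi t s p) (?Y p h) * n p)) (at t)" for t p
      by (rule has_derivative_mult_left, rule has_derivative_compose[OF _ deriv])
         (auto simp: Phi_def case_prod_unfold intro!: derivative_eq_intros)
    show "continuous_on UNIV (\<lambda>p. F (Phi t s p) * n p)" for t
      by (rule continuous_on_pullback[OF F]) (use n in \<open>auto intro!: continuous_intros\<close>)
    show "continuous_on UNIV (\<lambda>(t, p). mat_form c P Q (Phi t s p) (?Y p h) * n p)" for h
      unfolding case_prod_unfold
      by (rule continuous_form) (auto intro!: continuous_intros continuous_on_compose2[OF n])
    show "norm p \<le> M" if "dist x t < 1" "F (Phi x s p) * n p \<noteq> 0" for x p
      using M[of x s p] near[of x] that by auto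
  qed simp
  then have "wd c (\<lambda>t. kernel_int F n t s) t = wirt c (\<lambda>h. \<integral>p. mat_form c P Q (Phi t s p) (?Y p h) * n p \<partial>lborel)"
    unfolding kernel_int_def by (rule wd_has_derivative)
  also have "\<dots> = (\<integral>p. wirt c (\<lambda>h. mat_form c P Q (Phi t s p) (?Y p h) * n p) \<partial>lborel)"
    by (intro wirt_integral integrable_form n comp continuous_intros)
  also have "(\<lambda>p. wirt c (\<lambda>h. mat_form c P Q (Phi t s p) (?Y p h) * n p)) =
     (\<lambda>p. (- P 1 1 (Phi t s p) * cj c (fst (fst p)) - P 1 2 (Phi t s p) * cj c (snd p + s * fst (fst p))) * n p)"
    by (cases c) (simp_all add: fun_eq_iff wirt_def mat_form_def sum_2 field_simps)
  finally show ?t .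
  have "((\<lambda>s. \<integral>p. F (Phi t s p) * n p \<partial>lborel) has_derivative (\<lambda>h. \<integral>p. mat_form c P Q (Phi t s p) (?Z p h) * n p \<partial>lborel)) (at s)"
  proof (rule has_derivative_lborel_integral[where r = 1 and M = M and f' = "\<lambda>s p h. mat_form c P Q (Phi t s p) (?Z p h) * n p"])
    show "((\<lambda>s. F (Phi t s p) * n p) has_derivative (\<lambda>h. mat_form c P Q (Phi t s p) (?Z p h) * n p)) (at s)" for s p
      by (rule has_derivative_mult_left, rule has_derivative_compose[OF _ deriv])
         (auto simp: Phi_def case_prod_unfold fun_eq_iff algebra_simps intro!: derivative_eq_intros)
    show "continuous_on UNIV (\<lambda>p. F (Phi t s p) * n p)" for s
      by (rule continuous_on_pullback[OF F]) (use n in \<open>auto intro!: continuous_intros\<close>)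
    show "continuous_on UNIV (\<lambda>(s, p). mat_form c P Q (Phi t s p) (?Z p h) * n p)" for h
      unfolding case_prod_unfold
      by (rule continuous_form) (auto intro!: continuous_intros continuous_on_compose2[OF n])
    show "norm p \<le> M" if "dist x s < 1" "F (Phi t x p) * n p \<noteq> 0" for x p
      using M[of t x p] near[of x] that by auto
  qed simp
  then have "wd c (\<lambda>s. kernel_int F n t s) s = wirt c (\<lambda>h. \<integral>p. mat_form c P Q (Phi t s p) (?Z p h) * n p \<partial>lborel)"
    unfolding kernel_int_def by (rule wd_has_derivative)
  also have "\<dots> = (\<integral>p. wirt c (\<lambda>h. mat_form c P Q (Phi t s p) (?Z p h) * n p) \<partial>lborel)"
    by (intro wirt_integral integrable_form n comp continuous_intros)
  also have "(\<lambda>p. wirt c (\<lambda>h. mat_form c P Q (Phi t s p) (?Z p h) * n p)) =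
     (\<lambda>p. (P 1 2 (Phi t s p) * cj c (snd (fst p) - t * fst (fst p)) + P 2 2 (Phi t s p) * cj c (fst (fst p))) * n p)"
    by (cases c) (simp_all add: fun_eq_iff wirt_def mat_form_def sum_2 field_simps)
  finally show ?s .
qed

end

section \<open>The kernel of the Fourier transform\<close>

lemma bipow_minus_1: "bipow z (\<nu> - 1) (\<nu>' - 1) = bipow z \<nu> \<nu>' / of_real ((norm z)\<^sup>2)"
proof (cases "z = 0")
  case False
  have e: "2 * (\<nu> - 1) * of_real (ln (norm z)) = 2 * \<nu> * of_real (ln (norm z)) - 2 * of_real (ln (norm z))"
    by (simp add: algebra_simps)
  show ?thesis
    unfolding bipow_eq_exp[OF False] e exp_diff exp_2_ln_norm[OF False] complex_norm_square by simp
qed simp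

text \<open>The weight against which \<open>F(Phi)\<close> is integrated: with the exponents of \<open>kernel_exists\<close> it combines
  the automorphy factor, the power of the determinant, the Haar density and the Jacobian \<open>|u|\<^sup>2\<close>.\<close>

definition haar_dens :: "complex \<Rightarrow> complex \<Rightarrow> complex \<Rightarrow> complex \<Rightarrow> coords \<Rightarrow> complex" where
  "haar_dens \<alpha> \<alpha>' \<beta> \<beta>' p = bipow (snd (fst p)) \<alpha> \<alpha>' * bipow (snd p) \<beta> \<beta>'"

lemma continuous_on_haar_dens:
  assumes "\<alpha> - \<alpha>' \<in> \<int>" "\<beta> - \<beta>' \<in> \<int>"
  shows "continuous_on off_axes (haar_dens \<alpha> \<alpha>' \<beta> \<beta>')"
  unfolding haar_dens_def by (intro continuous_intros continuous_on_bipow assms) (auto simp: off_axes_def)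

text \<open>The row vector \<open>(u, p)\<close> is a homogeneous coordinate of \<open>p / u\<close>.  Where \<open>|p| \<le> |u|\<close> the section is
  controlled by \<open>\<phi>\<close> on the unit disc, elsewhere by its expression \<open>\<psi>\<close> at infinity.  Hence
  \<open>ps_op\<close> applied to \<open>\<phi>\<close> stays bounded on compact sets of invertible matrices, even as \<open>u\<close> tends to \<open>0\<close>.\<close>

lemma ps_space_bound:
  assumes \<phi>: "\<phi> \<in> ps_space \<mu>1 \<mu>1' \<mu>2 \<mu>2'"
  obtains B r where "B \<ge> 0" "\<And>p u. u \<noteq> 0 \<Longrightarrow>
     norm (\<phi> (p / u) * bipow u (-1 + \<mu>1 - \<mu>2) (-1 + \<mu>1' - \<mu>2')) \<le> B * max (norm p) (norm u) powr r"
proof -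
  define a a' where "a = -1 + \<mu>1 - \<mu>2" and "a' = -1 + \<mu>1' - \<mu>2'"
  define r where "r = 2 * Re a + of_int \<lfloor>Re (a' - a)\<rfloor>"
  obtain \<psi> where \<psi>: "smooth_on \<phi> UNIV" "smooth_on \<psi> UNIV" "\<And>t. t \<noteq> 0 \<Longrightarrow> \<psi> t = \<phi> (- inverse t) * bipow t a a'"
    using \<phi> by (auto simp: ps_space_def a_def a'_def)
  have bd: "\<exists>B. \<forall>x\<in>cball 0 1. norm (f x) \<le> B" if "smooth_on f UNIV" for f :: "complex \<Rightarrow> complex"
  proof -
    have "Ck_on 0 f UNIV" using that unfolding smooth_on_def by blast
    then have "continuous_on UNIV f" by simp
    then have "continuous_on (cball 0 1) f" by (rule continuous_on_subset) simp
    then have "compact (f ` cball 0 1)" by (rule compact_continuous_image) simp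
    from compact_imp_bounded[OF this] show ?thesis by (auto simp: bounded_iff)
  qed
  obtain B1 B2 where "\<forall>x\<in>cball 0 1. norm (\<phi> x) \<le> B1" "\<forall>x\<in>cball 0 1. norm (\<psi> x) \<le> B2"
    using bd[OF \<psi>(1)] bd[OF \<psi>(2)] by blast
  then have B1: "norm x \<le> 1 \<Longrightarrow> norm (\<phi> x) \<le> B1" and B2: "norm x \<le> 1 \<Longrightarrow> norm (\<psi> x) \<le> B2" for x
    by simp_all
  have nonneg: "B1 \<ge> 0" "B2 \<ge> 0" using B1[of 0] B2[of 0] by (auto intro: order_trans[OF norm_ge_zero])
  have "norm (\<phi> (p / u) * bipow u a a') \<le> max B1 B2 * max (norm p) (norm u) powr r" if u: "u \<noteq> 0" for p u
  proof (cases "norm p \<le> norm u")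
    case True
    then have "norm (\<phi> (p / u)) \<le> B1" using u by (intro B1) (simp add: norm_divide)
    then have "norm (\<phi> (p / u) * bipow u a a') \<le> max B1 B2 * norm u powr r"
      unfolding norm_mult norm_bipow[OF u] r_def[symmetric] using nonneg by (intro mult_mono) auto
    then show ?thesis using True by (simp add: max_def)
  next
    case False
    then have p: "p \<noteq> 0" by auto
    define \<tau> where "\<tau> = - u / p"
    have \<tau>: "\<tau> \<noteq> 0" "norm \<tau> \<le> 1" "- inverse \<tau> = p / u" "u = \<tau> * (- p)"
      using p u False by (auto simp: \<tau>_def norm_divide)
    have "\<phi> (p / u) * bipow u a a' = \<psi> \<tau> * bipow (- p) a a'"
      unfolding \<psi>(3)[OF \<tau>(1)] \<tau>(3) by (subst \<tau>(4), subst bipow_mult) (simp add: mult_ac)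
    also have "norm \<dots> \<le> max B1 B2 * norm p powr r"
      using B2[OF \<tau>(2)] nonneg norm_bipow[of "- p" a a'] p unfolding norm_mult
      by (intro mult_mono) (auto simp: r_def)
    finally show ?thesis using False by (simp add: max_def)
  qed
  then show thesis
    using that[of "max B1 B2" r] nonneg by (auto simp: a_def a'_def)
qed

lemma borel_measurable_entry [measurable]: "(\<lambda>X :: mat2. X $ i $ j) \<in> borel_measurable borel"
  by (intro borel_measurable_continuous_onI continuous_intros)

text \<open>Apply the change of variables to the defining integral.  Its integrand \<open>G\<close> is bounded with
  compact support by the previous estimate, so Fubini is available although neither \<open>\<phi>\<close> nor the
  kernel has compact support in \<open>s\<close>.\<close>

lemma kernel_exists:
  assumes F: "cs_GL2 F" and \<mu>: "\<mu>1 - \<mu>1' \<in> \<int>" "\<mu>2 - \<mu>2' \<in> \<int>"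
  shows "is_kernel (ps_space \<mu>1 \<mu>1' \<mu>2 \<mu>2') (ps_integrated \<mu>1 \<mu>1' \<mu>2 \<mu>2' F)
    (kernel_int F (haar_dens (\<mu>1 - 3/2) (\<mu>1' - 3/2) (\<mu>2 - 3/2) (\<mu>2' - 3/2)))"
  unfolding is_kernel_def
proof (intro ballI allI)
  fix \<phi> t assume \<phi>: "\<phi> \<in> ps_space \<mu>1 \<mu>1' \<mu>2 \<mu>2'"
  define a a' where "a = -1 + \<mu>1 - \<mu>2" and "a' = -1 + \<mu>1' - \<mu>2'"
  define n where "n = haar_dens (\<mu>1 - 3/2) (\<mu>1' - 3/2) (\<mu>2 - 3/2) (\<mu>2' - 3/2)"
  obtain C where C: "compact C" "C \<subseteq> GL2" "\<And>X. X \<notin> C \<Longrightarrow> F X = 0"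
    using F unfolding cs_GL2_def by blast
  have aZ: "a - a' \<in> \<int>" "1/2 + \<mu>2 - (1/2 + \<mu>2') \<in> \<int>"
  proof -
    have "a - a' = (\<mu>1 - \<mu>1') - (\<mu>2 - \<mu>2')" by (simp add: a_def a'_def)
    then show "a - a' \<in> \<int>" using \<mu> by (metis Ints_diff)
  qed (use \<mu> in simp)
  have "Ck_on 0 \<phi> UNIV" using \<phi> unfolding ps_space_def smooth_on_def by blast
  then have [measurable]: "\<phi> \<in> borel_measurable borel" by (simp add: borel_measurable_continuous_onI)
  have [measurable]: "F \<in> borel_measurable borel" by (intro borel_measurable_continuous_onI cs_GL2_continuous F)
  have [measurable]: "GL2 \<in> sets borel" by (intro borel_open open_GL2)
  define G where "G X = indicator GL2 X *\<^sub>R (F X * ps_op \<mu>1 \<mu>1' \<mu>2 \<mu>2' X \<phi> t / of_real (norm (det X) ^ 4))" for X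
  have Gm: "G \<in> borel_measurable borel"
    unfolding G_def[abs_def] ps_op_def det_2 a_def[symmetric] a'_def[symmetric]
    by (intro borel_measurable_scaleR borel_measurable_indicator borel_measurable_times borel_measurable_divide
        borel_measurable_bipow aZ) measurable
  let ?u = "\<lambda>X :: mat2. X $ 1 $ 1 + t * X $ 2 $ 1" and ?p = "\<lambda>X :: mat2. X $ 1 $ 2 + t * X $ 2 $ 2"
  obtain B r where B: "B \<ge> 0" "\<And>p u. u \<noteq> 0 \<Longrightarrow> norm (\<phi> (p / u) * bipow u a a') \<le> B * max (norm p) (norm u) powr r"
    using ps_space_bound[OF \<phi>] unfolding a_def a'_def by metis
  define h where "h X = norm (F X) * (B * max (norm (?p X)) (norm (?u X)) powr r) *
      norm (bipow (det X) (1/2 + \<mu>2) (1/2 + \<mu>2')) / norm (det X) ^ 4" for X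
  have pu: "max (norm (?p X)) (norm (?u X)) \<noteq> 0" if "X \<in> GL2" for X
  proof
    assume "max (norm (?p X)) (norm (?u X)) = 0"
    then have "norm (?p X) \<le> 0" "norm (?u X) \<le> 0" by (metis max.cobounded1 max.cobounded2)+
    then have "X $ 1 $ 2 = - (t * X $ 2 $ 2)" "X $ 1 $ 1 = - (t * X $ 2 $ 1)" by (simp_all add: eq_neg_iff_add_eq_0)
    then have "det X = 0" by (simp add: det_2)
    then show False using that by (simp add: GL2_iff)
  qed
  have "continuous_on C h"
    unfolding h_def
    by (intro continuous_intros continuous_on_bipow aZ continuous_on_subset[OF cs_GL2_continuous[OF F]])
       (use C(2) pu in \<open>auto simp: GL2_iff\<close>)
  then have "bounded (h ` C)"
    using C(1) by (intro compact_imp_bounded compact_continuous_image)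
  then obtain M where M: "\<And>X. X \<in> C \<Longrightarrow> norm (h X) \<le> M" by (auto simp: bounded_iff)
  have hM: "h X \<le> M" if "X \<in> C" for X using M[OF that] by simp
  have M0: "M \<ge> 0" if "X \<in> C" for X using M[OF that] by (meson norm_ge_zero order_trans)
  have Gb: "norm (G X) \<le> norm (indicator C X * M)" for X
  proof (cases "X \<in> C")
    case True
    have "norm (G X) \<le> h X"
    proof (cases "?u X = 0")
      case True
      have "h X \<ge> 0" using B(1) by (simp add: h_def)
      then show ?thesis using True by (simp add: G_def ps_op_def)
    next
      case False
      have "norm (G X) \<le> norm (F X) * norm (\<phi> (?p X / ?u X) * bipow (?u X) a a') *
          norm (bipow (det X) (1/2 + \<mu>2) (1/2 + \<mu>2')) / norm (det X) ^ 4"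
        by (simp add: G_def ps_op_def a_def a'_def norm_mult norm_divide norm_power indicator_def mult.assoc)
      also have "\<dots> \<le> h X"
        unfolding h_def by (intro divide_right_mono mult_right_mono mult_left_mono B(2) False) auto
      finally show ?thesis .
    qed
    then show ?thesis using hM[OF True] M0[OF True] True by simp
  next
    case False
    then show ?thesis by (simp add: G_def C(3))
  qed
  have Gi: "integrable lborel G"
  proof (rule Bochner_Integration.integrable_bound)
    show "integrable lborel (\<lambda>X. indicator C X * M)"
      using emeasure_bounded_finite[OF compact_imp_bounded[OF C(1)]] C(1)
      by (intro integrable_mult_left) (simp add: integrable_indicator_iff borel_compact)
  qed (use Gm Gb in auto)
  have H: "of_real ((norm (snd (fst p)))\<^sup>2) * G (Phi t s p) = F (Phi t s p) * n p * \<phi> s" for s p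
  proof -
    obtain w u v where p: "p = ((w, u), v)" by (metis surj_pair)
    show ?thesis
    proof (cases "u = 0 \<or> v = 0")
      case True
      then have "det (Phi t s p) = 0" by (auto simp: p)
      then show ?thesis by (simp add: G_def cs_GL2_zero[OF F])
    next
      case False
      define X where "X = Phi t s p"
      have X: "?u X = u" "?p X = s * u" "det X = u * v" and XG: "X \<in> GL2"
        using False by (simp_all add: X_def p GL2_iff) (simp_all add: Phi_def)
      have nu: "(of_real ((norm u)\<^sup>2) :: complex) \<noteq> 0" "(of_real ((norm v)\<^sup>2) :: complex) \<noteq> 0"
        using False by simp_all
      have "bipow u a a' * bipow u (1/2 + \<mu>2) (1/2 + \<mu>2') = bipow u (\<mu>1 - 1/2) (\<mu>1' - 1/2)"
        by (subst bipow_add[OF aZ, symmetric]) (simp add: a_def a'_def algebra_simps)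
      moreover have "bipow u (\<mu>1 - 3/2) (\<mu>1' - 3/2) = bipow u (\<mu>1 - 1/2) (\<mu>1' - 1/2) / of_real ((norm u)\<^sup>2)"
        by (subst bipow_minus_1[symmetric]) (simp add: algebra_simps)
      ultimately have u: "bipow u a a' * bipow u (1/2 + \<mu>2) (1/2 + \<mu>2') = bipow u (\<mu>1 - 3/2) (\<mu>1' - 3/2) * of_real ((norm u)\<^sup>2)"
        using nu by simp
      have "bipow v (\<mu>2 - 3/2) (\<mu>2' - 3/2) = bipow v (1/2 + \<mu>2 - 1 - 1) (1/2 + \<mu>2' - 1 - 1)"
        by (simp add: algebra_simps)
      also have "\<dots> = bipow v (1/2 + \<mu>2) (1/2 + \<mu>2') / of_real ((norm v)\<^sup>2) / of_real ((norm v)\<^sup>2)"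
        unfolding bipow_minus_1 ..
      finally have v: "bipow v (1/2 + \<mu>2) (1/2 + \<mu>2') = bipow v (\<mu>2 - 3/2) (\<mu>2' - 3/2) * (of_real ((norm v)\<^sup>2) * of_real ((norm v)\<^sup>2))"
        using nu by simp
      have d: "of_real (norm (u * v) ^ 4) = (of_real ((norm u)\<^sup>2) * of_real ((norm u)\<^sup>2)) * (of_real ((norm v)\<^sup>2) * of_real ((norm v)\<^sup>2) :: complex)"
        by (simp add: norm_mult power_mult_distrib power2_eq_square power4_eq_xxxx mult_ac)
      \<comment> \<open>The powers of \<open>|u|\<close> and \<open>|v|\<close> cancel: \<open>|u v|\<^sup>4\<close> from the Haar density against \<open>|u|\<^sup>2\<close> from the Jacobian and the shifts of the exponents.\<close>
      have alg: "U * (f * (\<phi> s * bu * (du * dv)) / (U * U * (V * V))) = f * (nu * nv) * \<phi> s"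
        if "bu * du = nu * U" "dv = nv * (V * V)" "U \<noteq> 0" "V \<noteq> 0" for U V f bu du dv nu nv :: complex
      proof -
        have "f * (\<phi> s * bu * (du * dv)) = f * \<phi> s * (bu * du) * dv" by (simp only: mult_ac)
        also have "\<dots> = f * \<phi> s * (nu * U) * (nv * (V * V))" by (simp only: that)
        finally show ?thesis using that(3,4) by (simp add: field_simps)
      qed
      have "G X = F X * (\<phi> s * bipow u a a' * (bipow u (1/2 + \<mu>2) (1/2 + \<mu>2') * bipow v (1/2 + \<mu>2) (1/2 + \<mu>2'))) /
          (of_real ((norm u)\<^sup>2) * of_real ((norm u)\<^sup>2) * (of_real ((norm v)\<^sup>2) * of_real ((norm v)\<^sup>2)))"
        using XG False unfolding G_def ps_op_def X a_def[symmetric] a'_def[symmetric] d bipow_mult by simp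
      then show ?thesis
        unfolding X_def[symmetric] using alg[OF u v nu] by (simp add: p n_def haar_dens_def del: of_real_power)
    qed
  qed
  have e: "(\<integral>p. of_real ((norm (snd (fst p)))\<^sup>2) * G (Phi t s p) \<partial>lborel) = kernel_int F n t s * \<phi> s" for s
    unfolding H kernel_int_def by (rule integral_mult_left_zero)
  show "integrable lborel (\<lambda>s. kernel_int F n t s * \<phi> s) \<and> ps_integrated \<mu>1 \<mu>1' \<mu>2 \<mu>2' F \<phi> t = (\<integral>s. kernel_int F n t s * \<phi> s \<partial>lborel)"

    using integral_Phi[OF Gi, of t] unfolding e
    by (simp add: ps_integrated_def set_lebesgue_integral_def G_def[abs_def])
qed

lemma K_F_eq:
  assumes F: "cs_GL2 F" and \<mu>: "\<mu>1 - \<mu>1' \<in> \<int>" "\<mu>2 - \<mu>2' \<in> \<int>"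
  shows "K_F F t s \<mu>1 \<mu>1' \<mu>2 \<mu>2' = kernel_int F (haar_dens (\<mu>1 - 3/2) (\<mu>1' - 3/2) (\<mu>2 - 3/2) (\<mu>2' - 3/2)) t s"
proof -
  let ?K = "kernel_int F (haar_dens (\<mu>1 - 3/2) (\<mu>1' - 3/2) (\<mu>2 - 3/2) (\<mu>2' - 3/2))"
  have "(THE K. continuous_on UNIV (\<lambda>(t, s). K t s) \<and>
      is_kernel (ps_space \<mu>1 \<mu>1' \<mu>2 \<mu>2') (ps_integrated \<mu>1 \<mu>1' \<mu>2 \<mu>2' F) K) = ?K"
  proof (rule the_equality)
    show *: "continuous_on UNIV (\<lambda>(t, s). ?K t s) \<and>
        is_kernel (ps_space \<mu>1 \<mu>1' \<mu>2 \<mu>2') (ps_integrated \<mu>1 \<mu>1' \<mu>2 \<mu>2' F) ?K"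
      by (intro conjI continuous_on_kernel_int F continuous_on_haar_dens kernel_exists \<mu>) (use \<mu> in simp_all)
    show "K = ?K" if "continuous_on UNIV (\<lambda>(t, s). K t s) \<and>
        is_kernel (ps_space \<mu>1 \<mu>1' \<mu>2 \<mu>2') (ps_integrated \<mu>1 \<mu>1' \<mu>2 \<mu>2' F) K" for K
      using kernel_unique[OF \<mu>] that * by blast
  qed
  then show ?thesis by (simp add: K_F_def)
qed

section \<open>Integration by parts in triangular coordinates\<close>

text \<open>The weights of the integrals: a power of \<open>w\<close> times powers of \<open>u\<close> and \<open>v\<close>.  The factor in \<open>w\<close> is
  needed because the coefficients in the chain rule contain \<open>w\<close> and \<open>w\<^sup>2\<close>.\<close>

definition bimonomial :: "bool \<Rightarrow> nat \<Rightarrow> complex \<Rightarrow> complex \<Rightarrow> complex \<Rightarrow> complex \<Rightarrow> coords \<Rightarrow> complex" where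
  "bimonomial c j \<alpha> \<alpha>' \<beta> \<beta>' p = cj c (fst (fst p)) ^ j * bp c (snd (fst p)) \<alpha> \<alpha>' * bp c (snd p) \<beta> \<beta>'"

definition bimonomial_deriv :: "bool \<Rightarrow> nat \<Rightarrow> complex \<Rightarrow> complex \<Rightarrow> complex \<Rightarrow> complex \<Rightarrow> coords \<Rightarrow> coords \<Rightarrow> complex" where
  "bimonomial_deriv c j \<alpha> \<alpha>' \<beta> \<beta>' p k =
     of_nat j * bimonomial c (j - 1) \<alpha> \<alpha>' \<beta> \<beta>' p * cj c (fst (fst k))
   + bimonomial c j \<alpha> \<alpha>' \<beta> \<beta>' p * (\<alpha> * (cj c (snd (fst k)) / cj c (snd (fst p))) + \<alpha>' * cnj (cj c (snd (fst k)) / cj c (snd (fst p))))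
   + bimonomial c j \<alpha> \<alpha>' \<beta> \<beta>' p * (\<beta> * (cj c (snd k) / cj c (snd p)) + \<beta>' * cnj (cj c (snd k) / cj c (snd p)))"

lemma continuous_on_bimonomial:
  assumes "\<alpha> - \<alpha>' \<in> \<int>" "\<beta> - \<beta>' \<in> \<int>"
  shows "continuous_on off_axes (bimonomial c j \<alpha> \<alpha>' \<beta> \<beta>')"
  unfolding bimonomial_def by (intro continuous_intros continuous_on_bp assms) (auto simp: off_axes_def)

lemma continuous_on_bimonomial_deriv:
  assumes "\<alpha> - \<alpha>' \<in> \<int>" "\<beta> - \<beta>' \<in> \<int>"
  shows "continuous_on off_axes (\<lambda>p. bimonomial_deriv c j \<alpha> \<alpha>' \<beta> \<beta>' p k)"
  unfolding bimonomial_deriv_def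
  by (intro continuous_intros continuous_on_bimonomial assms) (auto simp: off_axes_def)

lemma has_derivative_bimonomial:
  assumes "\<alpha> - \<alpha>' \<in> \<int>" "\<beta> - \<beta>' \<in> \<int>" "p \<in> off_axes"
  shows "(bimonomial c j \<alpha> \<alpha>' \<beta> \<beta>' has_derivative bimonomial_deriv c j \<alpha> \<alpha>' \<beta> \<beta>' p) (at p)"
proof -
  have U: "((\<lambda>p. bp c (snd (fst p)) \<alpha> \<alpha>') has_derivative (\<lambda>k. bp c (snd (fst p)) \<alpha> \<alpha>' *
      (\<alpha> * (cj c (snd (fst k)) / cj c (snd (fst p))) + \<alpha>' * cnj (cj c (snd (fst k)) / cj c (snd (fst p)))))) (at p)"
    by (rule has_derivative_compose[OF _ has_derivative_bp])
       (use assms in \<open>auto simp: off_axes_def intro!: derivative_eq_intros\<close>)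
  have V: "((\<lambda>p. bp c (snd p) \<beta> \<beta>') has_derivative (\<lambda>k. bp c (snd p) \<beta> \<beta>' *
      (\<beta> * (cj c (snd k) / cj c (snd p)) + \<beta>' * cnj (cj c (snd k) / cj c (snd p))))) (at p)"
    by (rule has_derivative_compose[OF _ has_derivative_bp])
       (use assms in \<open>auto simp: off_axes_def intro!: derivative_eq_intros\<close>)
  have W: "((\<lambda>p :: coords. cj c (fst (fst p)) ^ j) has_derivative (\<lambda>k. of_nat j * cj c (fst (fst k)) * cj c (fst (fst p)) ^ (j - 1))) (at p)"
    by (intro has_derivative_power has_derivative_cj has_derivative_fst has_derivative_ident)
  show ?thesis
    unfolding bimonomial_def[abs_def]
  proof (rule has_derivative_eq_rhs[OF has_derivative_mult[OF has_derivative_mult[OF W U] V]], rule ext)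
    fix k
    have alg: "w * u * (v * dv) + (w * (u * du) + n * dw * w' * u) * v = n * (w' * u * v) * dw + w * u * v * du + w * u * v * dv"
      for w u v dv du n dw w' :: complex
      by (simp only: distrib_left distrib_right mult_ac add_ac)
    show "cj c (fst (fst p)) ^ j * bp c (snd (fst p)) \<alpha> \<alpha>' * (bp c (snd p) \<beta> \<beta>' *
        (\<beta> * (cj c (snd k) / cj c (snd p)) + \<beta>' * cnj (cj c (snd k) / cj c (snd p)))) +
      (cj c (fst (fst p)) ^ j * (bp c (snd (fst p)) \<alpha> \<alpha>' *
        (\<alpha> * (cj c (snd (fst k)) / cj c (snd (fst p))) + \<alpha>' * cnj (cj c (snd (fst k)) / cj c (snd (fst p))))) +
       of_nat j * cj c (fst (fst k)) * cj c (fst (fst p)) ^ (j - 1) * bp c (snd (fst p)) \<alpha> \<alpha>') * bp c (snd p) \<beta> \<beta>' =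
      bimonomial_deriv c j \<alpha> \<alpha>' \<beta> \<beta>' p k"
      unfolding bimonomial_deriv_def bimonomial_def alg ..
  qed
qed

context C1_compact
begin

text \<open>For fixed \<open>t\<close> and \<open>s\<close> the map \<open>Phi\<close> is linear in the coordinates, hence its own derivative.\<close>

lemma has_derivative_Phi: "(Phi t s has_derivative Phi t s) (at p)"
  unfolding Phi_def case_prod_unfold
  by (auto intro!: derivative_eq_intros simp: algebra_simps)

definition total_deriv where
  "total_deriv t s j \<alpha> \<alpha>' \<beta> \<beta>' p k =
     mat_form c P Q (Phi t s p) (Phi t s k) * bimonomial c j \<alpha> \<alpha>' \<beta> \<beta>' p + F (Phi t s p) * bimonomial_deriv c j \<alpha> \<alpha>' \<beta> \<beta>' p k"

lemma has_derivative_total: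
  assumes "\<alpha> - \<alpha>' \<in> \<int>" "\<beta> - \<beta>' \<in> \<int>"
  shows "((\<lambda>p. F (Phi t s p) * bimonomial c j \<alpha> \<alpha>' \<beta> \<beta>' p) has_derivative total_deriv t s j \<alpha> \<alpha>' \<beta> \<beta>' p) (at p)"
proof (cases "p \<in> off_axes")
  case True
  have "((\<lambda>p. F (Phi t s p)) has_derivative (\<lambda>k. mat_form c P Q (Phi t s p) (Phi t s k))) (at p)"
    by (rule has_derivative_compose[OF has_derivative_Phi deriv])
  from has_derivative_mult[OF this has_derivative_bimonomial[OF assms True]] show ?thesis
    by (rule has_derivative_eq_rhs) (simp add: total_deriv_def fun_eq_iff add.commute)
next
  case False
  then have z: "det (Phi t s p) = 0" by (auto simp: det_Phi_pair off_axes_def)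
  have D: "total_deriv t s j \<alpha> \<alpha>' \<beta> \<beta>' p = (\<lambda>_. 0)"
    by (simp add: total_deriv_def fun_eq_iff mat_form_def cs_GL2_zero[OF F z] cs_GL2_zero[OF P z] cs_GL2_zero[OF Q z])
  obtain C where C: "compact C" "C \<subseteq> GL2" "\<And>X. X \<notin> C \<Longrightarrow> F X = 0"
    using F unfolding cs_GL2_def by blast
  show ?thesis unfolding D
  proof (rule has_derivative_transform_within_open[where s = "Phi t s -` (- C)" and f = "\<lambda>_. 0"])
    show "open (Phi t s -` (- C))"
      using C(1) by (intro open_vimage) (auto simp: compact_imp_closed open_Compl intro!: continuous_intros)
    show "p \<in> Phi t s -` (- C)" using C(2) z by (auto simp: GL2_iff)
    show "0 = F (Phi t s q) * bimonomial c j \<alpha> \<alpha>' \<beta> \<beta>' q" if "q \<in> Phi t s -` (- C)" for q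
      using C(3)[of "Phi t s q"] that by simp
  qed simp
qed

lemma continuous_Phi_entry: "continuous_on UNIV (\<lambda>p. Phi t s k $ i $ j)"
  by simp

lemma
  assumes \<alpha>\<beta>: "\<alpha> - \<alpha>' \<in> \<int>" "\<beta> - \<beta>' \<in> \<int>"
  shows integrable_total: "integrable lborel (\<lambda>p. total_deriv t s j \<alpha> \<alpha>' \<beta> \<beta>' p k)"
    and integral_total: "(\<integral>p. total_deriv t s j \<alpha> \<alpha>' \<beta> \<beta>' p k \<partial>lborel) = 0"
proof -
  show "integrable lborel (\<lambda>p. total_deriv t s j \<alpha> \<alpha>' \<beta> \<beta>' p k)"
    unfolding total_deriv_def
    by (intro Bochner_Integration.integrable_add integrable_form integrable_pullback F
        continuous_on_bimonomial continuous_on_bimonomial_deriv continuous_Phi_entry \<alpha>\<beta>)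
  obtain M where M: "\<And>p. F (Phi t s p) \<noteq> 0 \<Longrightarrow> norm p \<le> M"
    using pullback_support[OF F, of "max (norm t) (norm s)"] by (metis max.cobounded1 max.cobounded2)
  show "(\<integral>p. total_deriv t s j \<alpha> \<alpha>' \<beta> \<beta>' p k \<partial>lborel) = 0"
  proof (rule integral_derivative_eq_0[OF has_derivative_total[OF \<alpha>\<beta>]])
    show "continuous_on UNIV (\<lambda>p. total_deriv t s j \<alpha> \<alpha>' \<beta> \<beta>' p h)" for h
      unfolding total_deriv_def
      by (intro continuous_on_add continuous_form continuous_on_pullback F continuous_on_const continuous_on_id continuous_Phi_entry)
         (simp_all add: continuous_on_bimonomial continuous_on_bimonomial_deriv \<alpha>\<beta>)
    show "norm p \<le> M" if "F (Phi t s p) * bimonomial c j \<alpha> \<alpha>' \<beta> \<beta>' p \<noteq> 0" for p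
      using M[of p] that by auto
  qed
qed

text \<open>Separates the part of the vanishing integral that is linear in \<open>cj c h\<close> from its conjugate, so as
  to obtain an identity for a single Wirtinger derivative.\<close>

lemma integral_total_direction:
  assumes \<alpha>\<beta>: "\<alpha> - \<alpha>' \<in> \<int>" "\<beta> - \<beta>' \<in> \<int>"
    and e: "\<And>p h. total_deriv t s j \<alpha> \<alpha>' \<beta> \<beta>' p (e h) = A p * cj c h + B p * cnj (cj c h)"
  shows "integrable lborel A" "(\<integral>p. A p \<partial>lborel) = 0"
proof -
  have A: "A p = wirt c (\<lambda>h. total_deriv t s j \<alpha> \<alpha>' \<beta> \<beta>' p (e h))" for p
    by (simp add: e)
  show "integrable lborel A"
    unfolding A[abs_def] wirt_def using integrable_total[OF \<alpha>\<beta>] by simp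
  have "(\<integral>p. A p \<partial>lborel) = wirt c (\<lambda>h. \<integral>p. total_deriv t s j \<alpha> \<alpha>' \<beta> \<beta>' p (e h) \<partial>lborel)"
    unfolding A by (rule wirt_integral[symmetric]) (rule integrable_total[OF \<alpha>\<beta>])
  also have "\<dots> = 0" by (simp add: integral_total[OF \<alpha>\<beta>] wirt_def)
  finally show "(\<integral>p. A p \<partial>lborel) = 0" .
qed

text \<open>\<open>u_divergence\<close>, \<open>v_divergence\<close> and \<open>w_divergence\<close> are the Wirtinger derivatives of \<open>F(Phi)\<close> times
  a bimonomial in the directions \<open>u\<close>, \<open>v\<close> and \<open>w\<close>; their integrals vanish.\<close>

definition u_divergence where "u_divergence t s j \<alpha> \<alpha>' \<beta> \<beta>' p =
  (P 1 1 (Phi t s p) + cj c s * P 1 2 (Phi t s p)) * bimonomial c j \<alpha> \<alpha>' \<beta> \<beta>' p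
   + F (Phi t s p) * (\<alpha> / cj c (snd (fst p)) * bimonomial c j \<alpha> \<alpha>' \<beta> \<beta>' p)"

definition v_divergence where "v_divergence t s j \<alpha> \<alpha>' \<beta> \<beta>' p =
  (P 2 2 (Phi t s p) - cj c t * P 1 2 (Phi t s p)) * bimonomial c j \<alpha> \<alpha>' \<beta> \<beta>' p
   + F (Phi t s p) * (\<beta> / cj c (snd p) * bimonomial c j \<alpha> \<alpha>' \<beta> \<beta>' p)"

definition w_divergence where "w_divergence t s j \<alpha> \<alpha>' \<beta> \<beta>' p =
  (P 2 1 (Phi t s p) + cj c s * P 2 2 (Phi t s p) - cj c t * P 1 1 (Phi t s p) - cj c t * cj c s * P 1 2 (Phi t s p)) * bimonomial c j \<alpha> \<alpha>' \<beta> \<beta>' p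
   + F (Phi t s p) * (of_nat j * bimonomial c (j - 1) \<alpha> \<alpha>' \<beta> \<beta>' p)"

lemma
  assumes \<alpha>\<beta>: "\<alpha> - \<alpha>' \<in> \<int>" "\<beta> - \<beta>' \<in> \<int>"
  shows u_divergence: "integrable lborel (u_divergence t s j \<alpha> \<alpha>' \<beta> \<beta>')" "(\<integral>p. u_divergence t s j \<alpha> \<alpha>' \<beta> \<beta>' p \<partial>lborel) = 0"
    and v_divergence: "integrable lborel (v_divergence t s j \<alpha> \<alpha>' \<beta> \<beta>')" "(\<integral>p. v_divergence t s j \<alpha> \<alpha>' \<beta> \<beta>' p \<partial>lborel) = 0"
    and w_divergence: "integrable lborel (w_divergence t s j \<alpha> \<alpha>' \<beta> \<beta>')" "(\<integral>p. w_divergence t s j \<alpha> \<alpha>' \<beta> \<beta>' p \<partial>lborel) = 0"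
proof -
  have u: "total_deriv t s j \<alpha> \<alpha>' \<beta> \<beta>' p ((0, h), 0) = u_divergence t s j \<alpha> \<alpha>' \<beta> \<beta>' p * cj c h
      + ((Q 1 1 (Phi t s p) + cnj (cj c s) * Q 1 2 (Phi t s p)) * bimonomial c j \<alpha> \<alpha>' \<beta> \<beta>' p
        + F (Phi t s p) * (\<alpha>' / cnj (cj c (snd (fst p))) * bimonomial c j \<alpha> \<alpha>' \<beta> \<beta>' p)) * cnj (cj c h)" for p h
    unfolding total_deriv_def mat_form_def bimonomial_deriv_def u_divergence_def
    by (simp add: sum_2 Phi_def[of t s "((0, h), 0)"] divide_inverse algebra_simps)
  have v: "total_deriv t s j \<alpha> \<alpha>' \<beta> \<beta>' p ((0, 0), h) = v_divergence t s j \<alpha> \<alpha>' \<beta> \<beta>' p * cj c h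
      + ((Q 2 2 (Phi t s p) - cnj (cj c t) * Q 1 2 (Phi t s p)) * bimonomial c j \<alpha> \<alpha>' \<beta> \<beta>' p
        + F (Phi t s p) * (\<beta>' / cnj (cj c (snd p)) * bimonomial c j \<alpha> \<alpha>' \<beta> \<beta>' p)) * cnj (cj c h)" for p h
    unfolding total_deriv_def mat_form_def bimonomial_deriv_def v_divergence_def
    by (simp add: sum_2 Phi_def[of t s "((0, 0), h)"] divide_inverse algebra_simps)
  have w: "total_deriv t s j \<alpha> \<alpha>' \<beta> \<beta>' p ((h, 0), 0) = w_divergence t s j \<alpha> \<alpha>' \<beta> \<beta>' p * cj c h
      + ((Q 2 1 (Phi t s p) + cnj (cj c s) * Q 2 2 (Phi t s p) - cnj (cj c t) * Q 1 1 (Phi t s p)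
          - cnj (cj c t) * cnj (cj c s) * Q 1 2 (Phi t s p)) * bimonomial c j \<alpha> \<alpha>' \<beta> \<beta>' p) * cnj (cj c h)" for p h
    unfolding total_deriv_def mat_form_def bimonomial_deriv_def w_divergence_def
    by (simp add: sum_2 Phi_def[of t s "((h, 0), 0)"] algebra_simps)
  show "integrable lborel (u_divergence t s j \<alpha> \<alpha>' \<beta> \<beta>')" "(\<integral>p. u_divergence t s j \<alpha> \<alpha>' \<beta> \<beta>' p \<partial>lborel) = 0"
    using integral_total_direction[OF \<alpha>\<beta> u] by blast+
  show "integrable lborel (v_divergence t s j \<alpha> \<alpha>' \<beta> \<beta>')" "(\<integral>p. v_divergence t s j \<alpha> \<alpha>' \<beta> \<beta>' p \<partial>lborel) = 0"
    using integral_total_direction[OF \<alpha>\<beta> v] by blast+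
  show "integrable lborel (w_divergence t s j \<alpha> \<alpha>' \<beta> \<beta>')" "(\<integral>p. w_divergence t s j \<alpha> \<alpha>' \<beta> \<beta>' p \<partial>lborel) = 0"
    using integral_total_direction[OF \<alpha>\<beta> w] by blast+
qed

section \<open>The two operator identities\<close>

text \<open>The explicit first-order operators by which \<open>e\<^sub>1\<^sub>4\<close> and \<open>e\<^sub>3\<^sub>2\<close> (or their conjugates) act on \<open>F\<close>.\<close>

definition gen14 :: "complex \<Rightarrow> mat2 \<Rightarrow> complex" where
  "gen14 \<sigma> X = P 1 2 X + F X * ((1 - \<sigma>) * cj c (X $ 2 $ 1 / det X))"

definition gen32 :: "complex \<Rightarrow> mat2 \<Rightarrow> complex" where
  "gen32 \<sigma> X = - (P 1 1 X * cj c (X $ 1 $ 1 * X $ 2 $ 1) + P 1 2 X * cj c (X $ 1 $ 1 * X $ 2 $ 2)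
       + P 2 1 X * cj c (X $ 2 $ 1 * X $ 2 $ 1) + P 2 2 X * cj c (X $ 2 $ 1 * X $ 2 $ 2))
     + F X * ((\<sigma> - 1) * cj c (X $ 2 $ 1))"

lemma bimonomial_shift:
  assumes "\<alpha> - \<alpha>' \<in> \<int>" "\<beta> - \<beta>' \<in> \<int>"
  shows "bimonomial c j (\<alpha> - 1) \<alpha>' \<beta> \<beta>' p = bimonomial c j \<alpha> \<alpha>' \<beta> \<beta>' p / cj c (snd (fst p))"
    "bimonomial c j (\<alpha> + 1) \<alpha>' \<beta> \<beta>' p = bimonomial c j \<alpha> \<alpha>' \<beta> \<beta>' p * cj c (snd (fst p))"
    "bimonomial c j \<alpha> \<alpha>' (\<beta> - 1) \<beta>' p = bimonomial c j \<alpha> \<alpha>' \<beta> \<beta>' p / cj c (snd p)"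
    "bimonomial c j \<alpha> \<alpha>' (\<beta> + 1) \<beta>' p = bimonomial c j \<alpha> \<alpha>' \<beta> \<beta>' p * cj c (snd p)"
  by (simp_all add: bimonomial_def bp_shift assms)

lemma bimonomial_1: "bimonomial c (Suc 0) \<alpha> \<alpha>' \<beta> \<beta>' p = cj c (fst (fst p)) * bimonomial c 0 \<alpha> \<alpha>' \<beta> \<beta>' p"
  and bimonomial_2: "bimonomial c 2 \<alpha> \<alpha>' \<beta> \<beta>' p = (cj c (fst (fst p)))\<^sup>2 * bimonomial c 0 \<alpha> \<alpha>' \<beta> \<beta>' p"
  by (simp_all add: bimonomial_def)

lemma Phi_nth:
  "Phi t s ((w, u), v) $ 1 $ 1 = u - t * w" "Phi t s ((w, u), v) $ 1 $ 2 = s * u - t * (v + s * w)"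
  "Phi t s ((w, u), v) $ 2 $ 1 = w" "Phi t s ((w, u), v) $ 2 $ 2 = v + s * w"
  by (simp_all add: Phi_def)

lemma shift_Ints: "\<alpha> - \<alpha>' \<in> \<int> \<Longrightarrow> \<alpha> - 1 - \<alpha>' \<in> \<int>" "\<alpha> - \<alpha>' \<in> \<int> \<Longrightarrow> \<alpha> + 1 - \<alpha>' \<in> \<int>" for \<alpha> \<alpha>' :: complex
proof -
  have "\<alpha> - 1 - \<alpha>' = (\<alpha> - \<alpha>') - 1" "\<alpha> + 1 - \<alpha>' = (\<alpha> - \<alpha>') + 1" by simp_all
  then show "\<alpha> - \<alpha>' \<in> \<int> \<Longrightarrow> \<alpha> - 1 - \<alpha>' \<in> \<int>" "\<alpha> - \<alpha>' \<in> \<int> \<Longrightarrow> \<alpha> + 1 - \<alpha>' \<in> \<int>"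
    by (metis Ints_1 Ints_diff, metis Ints_1 Ints_add)
qed

lemma vanish_on_axes:
  assumes "p \<notin> off_axes"
  shows "F (Phi t s p) = 0" "P i j (Phi t s p) = 0"
proof -
  have "det (Phi t s p) = 0" using assms by (auto simp: det_Phi_pair off_axes_def)
  then show "F (Phi t s p) = 0" "P i j (Phi t s p) = 0"
    by (rule cs_GL2_zero[OF F], rule cs_GL2_zero[OF P])
qed

text \<open>With \<open>x = F\<^sub>1\<^sub>2\<close>, \<open>y = (w/u) \<partial>\<^sub>v F\<close>, \<open>z = (w/v) \<partial>\<^sub>u F\<close> and \<open>g = w F / (u v)\<close>, all multiplied by the
  weight, the two derivatives of the kernel are \<open>x + y\<close> and \<open>- x - z\<close>, and up to divergences \<open>y\<close> and
  \<open>z\<close> are \<open>- \<beta> g\<close> and \<open>- \<alpha> g\<close>.  The coefficients \<open>A\<close> and \<open>B\<close> are the solution of \<open>A - B = 1\<close> and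
  \<open>B \<alpha> - A \<beta> = 1 - \<sigma>\<close>.\<close>

lemma kernel_int_gen14:
  assumes ab: "\<alpha> - \<alpha>' \<in> \<int>" "\<beta> - \<beta>' \<in> \<int>" "\<alpha> \<noteq> \<beta>"
  shows "kernel_int (gen14 \<sigma>) (bimonomial c 0 \<alpha> \<alpha>' \<beta> \<beta>') t s =
     (\<alpha> + 1 - \<sigma>) / (\<alpha> - \<beta>) * wd c (\<lambda>s. kernel_int F (bimonomial c 0 (\<alpha> - 1) \<alpha>' \<beta> \<beta>') t s) s
   + (\<beta> + 1 - \<sigma>) / (\<alpha> - \<beta>) * wd c (\<lambda>t. kernel_int F (bimonomial c 0 \<alpha> \<alpha>' (\<beta> - 1) \<beta>') t s) t"
proof -
  define A B where "A = (\<alpha> + 1 - \<sigma>) / (\<alpha> - \<beta>)" and "B = (\<beta> + 1 - \<sigma>) / (\<alpha> - \<beta>)"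
  have AB: "A - B = 1" "B * \<alpha> - A * \<beta> = 1 - \<sigma>"
  proof -
    show "A - B = 1" using ab(3) by (simp add: A_def B_def diff_divide_distrib[symmetric])
    have "(\<beta> + 1 - \<sigma>) * \<alpha> - (\<alpha> + 1 - \<sigma>) * \<beta> = (1 - \<sigma>) * (\<alpha> - \<beta>)"
      by (simp add: algebra_simps)
    then show "B * \<alpha> - A * \<beta> = 1 - \<sigma>"
      using ab(3) by (simp add: A_def B_def diff_divide_distrib[symmetric])
  qed
  let ?S = "\<lambda>p. (P 1 2 (Phi t s p) * cj c (snd (fst p) - t * fst (fst p)) + P 2 2 (Phi t s p) * cj c (fst (fst p)))
     * bimonomial c 0 (\<alpha> - 1) \<alpha>' \<beta> \<beta>' p"
  let ?T = "\<lambda>p. (- P 1 1 (Phi t s p) * cj c (fst (fst p)) - P 1 2 (Phi t s p) * cj c (snd p + s * fst (fst p)))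
     * bimonomial c 0 \<alpha> \<alpha>' (\<beta> - 1) \<beta>' p"
  let ?I = "v_divergence t s 1 (\<alpha> - 1) \<alpha>' \<beta> \<beta>'" and ?J = "u_divergence t s 1 \<alpha> \<alpha>' (\<beta> - 1) \<beta>'"
  have point: "gen14 \<sigma> (Phi t s p) * bimonomial c 0 \<alpha> \<alpha>' \<beta> \<beta>' p = A * ?S p + B * ?T p - A * ?I p + B * ?J p" for p
  proof (cases "p \<in> off_axes")
    case False
    show ?thesis
      unfolding gen14_def u_divergence_def v_divergence_def vanish_on_axes[OF False] mult_zero_left minus_zero diff_zero add_0 mult_zero_right ..
  next
    case True
    obtain w' u' v' where p: "p = ((w', u'), v')" by (metis surj_pair)
    define u v w where "u = cj c u'" and "v = cj c v'" and "w = cj c w'"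
    have nz: "u \<noteq> 0" "v \<noteq> 0" using True by (auto simp: p off_axes_def u_def v_def)
    define N where "N = bimonomial c 0 \<alpha> \<alpha>' \<beta> \<beta>' p"
    define f p11 p12 p22 where "f = F (Phi t s p)" and "p11 = P 1 1 (Phi t s p)" and "p12 = P 1 2 (Phi t s p)" and "p22 = P 2 2 (Phi t s p)"
    have S: "?S p = p12 * N + w / u * (p22 - cj c t * p12) * N"
    proof -
      have "?S p = (p12 * (u - cj c t * w) + p22 * w) * (N / u)"
        by (simp add: bimonomial_shift ab p p12_def p22_def N_def u_def w_def)
      also have "\<dots> = p12 * N + w / u * (p22 - cj c t * p12) * N"
        using nz by (simp add: field_simps)
      finally show ?thesis .
    qed
    have T: "?T p = - (p12 * N) - w / v * (p11 + cj c s * p12) * N"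
    proof -
      have "?T p = (- p11 * w - p12 * (v + cj c s * w)) * (N / v)"
        by (simp add: bimonomial_shift ab p p12_def p11_def N_def v_def w_def)
      also have "\<dots> = - (p12 * N) - w / v * (p11 + cj c s * p12) * N"
        using nz by (simp add: field_simps)
      finally show ?thesis .
    qed
    have I: "?I p = w / u * (p22 - cj c t * p12) * N + \<beta> * (w / (u * v) * f * N)"
    proof -
      have "?I p = (p22 - cj c t * p12) * (w * (N / u)) + f * (\<beta> / v * (w * (N / u)))"
        by (simp add: v_divergence_def bimonomial_1 bimonomial_shift ab p p12_def p22_def f_def N_def u_def v_def w_def)
      also have "\<dots> = w / u * (p22 - cj c t * p12) * N + \<beta> * (w / (u * v) * f * N)"
        using nz by (simp add: field_simps)
      finally show ?thesis .
    qed
    have J: "?J p = w / v * (p11 + cj c s * p12) * N + \<alpha> * (w / (u * v) * f * N)"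
    proof -
      have "?J p = (p11 + cj c s * p12) * (w * (N / v)) + f * (\<alpha> / u * (w * (N / v)))"
        by (simp add: u_divergence_def bimonomial_1 bimonomial_shift ab p p12_def p11_def f_def N_def u_def v_def w_def)
      also have "\<dots> = w / v * (p11 + cj c s * p12) * N + \<alpha> * (w / (u * v) * f * N)"
        using nz by (simp add: field_simps)
      finally show ?thesis .
    qed
    have L: "gen14 \<sigma> (Phi t s p) * N = p12 * N + (1 - \<sigma>) * (w / (u * v) * f * N)"
    proof -
      have "gen14 \<sigma> (Phi t s p) * N = (p12 + f * ((1 - \<sigma>) * (w / (u * v)))) * N"
        by (simp add: gen14_def p p12_def f_def u_def v_def w_def Phi_nth)
      also have "\<dots> = p12 * N + (1 - \<sigma>) * (w / (u * v) * f * N)"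
        using nz by (simp add: algebra_simps)
      finally show ?thesis .
    qed
    have alg: "x + (1 - \<sigma>) * g = A * (x + y) + B * (- x - z) - A * (y + \<beta> * g) + B * (z + \<alpha> * g)" for x y z g
    proof -
      have "A * (x + y) + B * (- x - z) - A * (y + \<beta> * g) + B * (z + \<alpha> * g) = (A - B) * x + (B * \<alpha> - A * \<beta>) * g"
        by (simp add: algebra_simps)
      then show ?thesis by (simp only: AB mult_1)
    qed
    show ?thesis unfolding N_def[symmetric] L S T I J by (rule alg)
  qed
  have cn: "continuous_on off_axes (bimonomial c 0 (\<alpha> - 1) \<alpha>' \<beta> \<beta>')" "continuous_on off_axes (bimonomial c 0 \<alpha> \<alpha>' (\<beta> - 1) \<beta>')"
    by (intro continuous_on_bimonomial shift_Ints ab)+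
  have iS: "integrable lborel ?S"
    unfolding distrib_right mult.assoc
    by (intro Bochner_Integration.integrable_add integrable_pullback P continuous_on_mult cn continuous_intros)
  have iT: "integrable lborel ?T"
    unfolding left_diff_distrib minus_mult_left[symmetric] mult.assoc
    by (intro Bochner_Integration.integrable_diff Bochner_Integration.integrable_minus integrable_pullback P continuous_on_mult cn continuous_intros)
  note I = v_divergence[OF shift_Ints(1)[OF ab(1)] ab(2), of t s 1] and J = u_divergence[OF ab(1) shift_Ints(1)[OF ab(2)], of t s 1]
  have "kernel_int (gen14 \<sigma>) (bimonomial c 0 \<alpha> \<alpha>' \<beta> \<beta>') t s = (\<integral>p. A * ?S p + B * ?T p - A * ?I p + B * ?J p \<partial>lborel)"
    unfolding kernel_int_def point ..
  also have "\<dots> = A * (\<integral>p. ?S p \<partial>lborel) + B * (\<integral>p. ?T p \<partial>lborel)"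
    using iS iT I J by simp
  finally show ?thesis
    unfolding wd_kernel_int_t[OF cn(2)] wd_kernel_int_s[OF cn(1)] A_def B_def .
qed

text \<open>In triangular coordinates \<open>e\<^sub>3\<^sub>2 F = - w (u \<partial>\<^sub>u + v \<partial>\<^sub>v + w \<partial>\<^sub>w) F - u v F\<^sub>1\<^sub>2 + (\<sigma> - 1) w F\<close>.
  Integrating the Euler field by parts gives \<open>\<alpha> + \<beta> + 4\<close> times \<open>w F\<close>, and the same quantities
  \<open>x = w u \<partial>\<^sub>u F\<close>, \<open>y = w v \<partial>\<^sub>v F\<close> and \<open>q = u v F\<^sub>1\<^sub>2\<close> occur in the derivatives of the kernel.\<close>

lemma kernel_int_gen32:
  assumes ab: "\<alpha> - \<alpha>' \<in> \<int>" "\<beta> - \<beta>' \<in> \<int>" "\<alpha> \<noteq> \<beta>"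
  shows "kernel_int (gen32 \<sigma>) (bimonomial c 0 \<alpha> \<alpha>' \<beta> \<beta>') t s =
     (\<alpha> + 2 + \<sigma>) / (\<alpha> - \<beta>) * wd c (\<lambda>t. kernel_int F (bimonomial c 0 (\<alpha> + 1) \<alpha>' \<beta> \<beta>') t s) t
   + (\<beta> + 2 + \<sigma>) / (\<alpha> - \<beta>) * wd c (\<lambda>s. kernel_int F (bimonomial c 0 \<alpha> \<alpha>' (\<beta> + 1) \<beta>') t s) s"
proof -
  define A B where "A = (\<alpha> + 2 + \<sigma>) / (\<alpha> - \<beta>)" and "B = (\<beta> + 2 + \<sigma>) / (\<alpha> - \<beta>)"
  have AB: "A - B = 1" "A * (\<alpha> + 1) - B * (\<beta> + 1) = \<alpha> + \<beta> + 3 + \<sigma>"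
  proof -
    show "A - B = 1" using ab(3) by (simp add: A_def B_def diff_divide_distrib[symmetric])
    have "(\<alpha> + 2 + \<sigma>) * (\<alpha> + 1) - (\<beta> + 2 + \<sigma>) * (\<beta> + 1) = (\<alpha> + \<beta> + 3 + \<sigma>) * (\<alpha> - \<beta>)"
      by (simp add: algebra_simps)
    then show "A * (\<alpha> + 1) - B * (\<beta> + 1) = \<alpha> + \<beta> + 3 + \<sigma>"
      using ab(3) by (simp add: A_def B_def diff_divide_distrib[symmetric])
  qed
  let ?T = "\<lambda>p. (- P 1 1 (Phi t s p) * cj c (fst (fst p)) - P 1 2 (Phi t s p) * cj c (snd p + s * fst (fst p)))
     * bimonomial c 0 (\<alpha> + 1) \<alpha>' \<beta> \<beta>' p"
  let ?S = "\<lambda>p. (P 1 2 (Phi t s p) * cj c (snd (fst p) - t * fst (fst p)) + P 2 2 (Phi t s p) * cj c (fst (fst p)))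
     * bimonomial c 0 \<alpha> \<alpha>' (\<beta> + 1) \<beta>' p"
  let ?I = "u_divergence t s 1 (\<alpha> + 1) \<alpha>' \<beta> \<beta>'" and ?J = "v_divergence t s 1 \<alpha> \<alpha>' (\<beta> + 1) \<beta>'" and ?H = "w_divergence t s 2 \<alpha> \<alpha>' \<beta> \<beta>'"
  have point: "gen32 \<sigma> (Phi t s p) * bimonomial c 0 \<alpha> \<alpha>' \<beta> \<beta>' p = A * ?T p + B * ?S p + (A - 1) * ?I p - (B + 1) * ?J p - ?H p" for p
  proof (cases "p \<in> off_axes")
    case False
    show ?thesis
      unfolding gen32_def u_divergence_def v_divergence_def w_divergence_def vanish_on_axes[OF False] mult_zero_left minus_zero diff_zero add_0 mult_zero_right ..
  next
    case True
    obtain w' u' v' where p: "p = ((w', u'), v')" by (metis surj_pair)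
    define u v w where "u = cj c u'" and "v = cj c v'" and "w = cj c w'"
    have nz: "u \<noteq> 0" "v \<noteq> 0" using True by (auto simp: p off_axes_def u_def v_def)
    define N where "N = bimonomial c 0 \<alpha> \<alpha>' \<beta> \<beta>' p"
    define f p11 p12 p21 p22 where "f = F (Phi t s p)" and "p11 = P 1 1 (Phi t s p)" and "p12 = P 1 2 (Phi t s p)"
      and "p21 = P 2 1 (Phi t s p)" and "p22 = P 2 2 (Phi t s p)"
    let ?fu = "p11 + cj c s * p12" and ?fv = "p22 - cj c t * p12"
    let ?fw = "p21 + cj c s * p22 - cj c t * p11 - cj c t * cj c s * p12"
    have T: "?T p = - (u * v * p12 * N) - w * u * ?fu * N"
    proof -
      have "?T p = (- p11 * w - p12 * (v + cj c s * w)) * (N * u)"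
        by (simp add: bimonomial_shift ab p p12_def p11_def N_def u_def v_def w_def)
      also have "\<dots> = - (u * v * p12 * N) - w * u * ?fu * N"
        using nz by (simp add: algebra_simps)
      finally show ?thesis .
    qed
    have S: "?S p = u * v * p12 * N + w * v * ?fv * N"
    proof -
      have "?S p = (p12 * (u - cj c t * w) + p22 * w) * (N * v)"
        by (simp add: bimonomial_shift ab p p12_def p22_def N_def u_def v_def w_def)
      also have "\<dots> = u * v * p12 * N + w * v * ?fv * N"
        using nz by (simp add: algebra_simps)
      finally show ?thesis .
    qed
    have I: "?I p = w * u * ?fu * N + (\<alpha> + 1) * (w * f * N)"
    proof -
      have "?I p = ?fu * (w * (N * u)) + f * ((\<alpha> + 1) / u * (w * (N * u)))"
        by (simp add: u_divergence_def bimonomial_1 bimonomial_shift ab p p12_def p11_def f_def N_def u_def v_def w_def)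
      also have "\<dots> = w * u * ?fu * N + (\<alpha> + 1) * (w * f * N)"
        using nz by (simp add: field_simps)
      finally show ?thesis .
    qed
    have J: "?J p = w * v * ?fv * N + (\<beta> + 1) * (w * f * N)"
    proof -
      have "?J p = ?fv * (w * (N * v)) + f * ((\<beta> + 1) / v * (w * (N * v)))"
        by (simp add: v_divergence_def bimonomial_1 bimonomial_shift ab p p12_def p22_def f_def N_def u_def v_def w_def)
      also have "\<dots> = w * v * ?fv * N + (\<beta> + 1) * (w * f * N)"
        using nz by (simp add: field_simps)
      finally show ?thesis .
    qed
    have H: "?H p = w\<^sup>2 * ?fw * N + 2 * (w * f * N)"
    proof -
      have "?H p = ?fw * (w\<^sup>2 * N) + f * (2 * (w * N))"
        by (simp add: w_divergence_def bimonomial_1 bimonomial_2 p p12_def p22_def p11_def p21_def f_def N_def w_def)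
      also have "\<dots> = w\<^sup>2 * ?fw * N + 2 * (w * f * N)"
        using nz by (simp add: algebra_simps)
      finally show ?thesis .
    qed
    have L: "gen32 \<sigma> (Phi t s p) * N = - (w * u * ?fu * N + w * v * ?fv * N + w\<^sup>2 * ?fw * N + u * v * p12 * N) + (\<sigma> - 1) * (w * f * N)"
    proof -
      have "gen32 \<sigma> (Phi t s p) * N = (- (p11 * ((u - cj c t * w) * w) + p12 * ((u - cj c t * w) * (v + cj c s * w)) + p21 * (w * w) + p22 * (w * (v + cj c s * w))) + f * ((\<sigma> - 1) * w)) * N"
        by (simp add: gen32_def p p12_def p22_def p11_def p21_def f_def u_def v_def w_def Phi_nth)
      also have "\<dots> = - (w * u * ?fu * N + w * v * ?fv * N + w\<^sup>2 * ?fw * N + u * v * p12 * N) + (\<sigma> - 1) * (w * f * N)"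
        using nz by (simp add: algebra_simps power2_eq_square)
      finally show ?thesis .
    qed
    have alg: "- (x + y + z + q) + (\<sigma> - 1) * g = A * (- q - x) + B * (q + y) + (A - 1) * (x + (\<alpha> + 1) * g)
        - (B + 1) * (y + (\<beta> + 1) * g) - (z + 2 * g)" for x y z q g
    proof -
      have "A * (- q - x) + B * (q + y) + (A - 1) * (x + (\<alpha> + 1) * g) - (B + 1) * (y + (\<beta> + 1) * g) - (z + 2 * g)
        = - (x + y + z) - (A - B) * q + (A * (\<alpha> + 1) - B * (\<beta> + 1)) * g - (\<alpha> + \<beta> + 4) * g"
        by (simp add: algebra_simps)
      also have "\<dots> = - (x + y + z + q) + (\<sigma> - 1) * g"
        unfolding AB by (simp add: algebra_simps)
      finally show ?thesis by simp
    qed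
    show ?thesis unfolding N_def[symmetric] L S T I J H by (rule alg)
  qed
  have cn: "continuous_on off_axes (bimonomial c 0 (\<alpha> + 1) \<alpha>' \<beta> \<beta>')" "continuous_on off_axes (bimonomial c 0 \<alpha> \<alpha>' (\<beta> + 1) \<beta>')"
    by (intro continuous_on_bimonomial shift_Ints ab)+
  have iS: "integrable lborel ?S"
    unfolding distrib_right mult.assoc
    by (intro Bochner_Integration.integrable_add integrable_pullback P continuous_on_mult cn continuous_intros)
  have iT: "integrable lborel ?T"
    unfolding left_diff_distrib minus_mult_left[symmetric] mult.assoc
    by (intro Bochner_Integration.integrable_diff Bochner_Integration.integrable_minus integrable_pullback P continuous_on_mult cn continuous_intros)
  note I = u_divergence[OF shift_Ints(2)[OF ab(1)] ab(2), of t s 1] and J = v_divergence[OF ab(1) shift_Ints(2)[OF ab(2)], of t s 1]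
    and H = w_divergence[OF ab(1,2), of t s 2]
  have "kernel_int (gen32 \<sigma>) (bimonomial c 0 \<alpha> \<alpha>' \<beta> \<beta>') t s = (\<integral>p. A * ?T p + B * ?S p + (A - 1) * ?I p - (B + 1) * ?J p - ?H p \<partial>lborel)"
    unfolding kernel_int_def point ..
  also have "\<dots> = A * (\<integral>p. ?T p \<partial>lborel) + B * (\<integral>p. ?S p \<partial>lborel)"
    using iS iT I J H by simp
  finally show ?thesis
    unfolding wd_kernel_int_t[OF cn(1)] wd_kernel_int_s[OF cn(2)] A_def B_def .
qed

end

section \<open>The generators of the overalgebra\<close>

lemma cs_GL2_add: "cs_GL2 f \<Longrightarrow> cs_GL2 g \<Longrightarrow> cs_GL2 (\<lambda>X. f X + g X)"
proof -
  assume f: "cs_GL2 f" and g: "cs_GL2 g"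
  obtain C D where C: "compact C" "C \<subseteq> GL2" "\<And>X. X \<notin> C \<Longrightarrow> f X = 0"
    and D: "compact D" "D \<subseteq> GL2" "\<And>X. X \<notin> D \<Longrightarrow> g X = 0"
    using f g unfolding cs_GL2_def by blast
  show ?thesis
    by (rule cs_GL2I[of "C \<union> D"])
       (use C D f g in \<open>auto simp: cs_GL2_def intro!: continuous_intros intro: continuous_on_subset\<close>)
qed

lemma cs_GL2_mult:
  assumes "cs_GL2 g" "continuous_on GL2 m"
  shows "cs_GL2 (\<lambda>X. g X * m X)"
proof -
  obtain C where C: "compact C" "C \<subseteq> GL2" "\<And>X. X \<notin> C \<Longrightarrow> g X = 0"
    using assms unfolding cs_GL2_def by blast
  have "continuous_on GL2 (\<lambda>X. g X * m X)"
    by (intro continuous_on_mult assms continuous_on_subset[OF cs_GL2_continuous[OF assms(1)]]) simp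
  then show ?thesis
    by (intro cs_GL2I[OF C(1,2)]) (simp_all add: C(3))
qed

lemma cs_GL2_minus: "cs_GL2 g \<Longrightarrow> cs_GL2 (\<lambda>X. - g X)"
  using cs_GL2_mult[of g "\<lambda>_. -1"] by simp

lemma det_one_plus_unit: "k \<noteq> l \<Longrightarrow> det (one_plus_unit k l \<epsilon>) = 1"
proof -
  assume "k \<noteq> l"
  have "one_plus_unit k l \<epsilon> = (\<chi> i. if i = k then row k (mat 1) + \<epsilon> *s row l (mat 1) else row i (mat 1 :: mat4))"
    using \<open>k \<noteq> l\<close> by (auto simp: one_plus_unit_def vec_eq_iff row_def mat_def)
  then show ?thesis
    using det_row_operation[OF \<open>k \<noteq> l\<close>, of "mat 1 :: mat4" \<epsilon>] by simp
qed

lemma mat_1_eq_mk2: "(mat 1 :: mat2) = mk2 1 0 0 1"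
  by (simp add: vec_eq_iff forall_2 mat_def)

lemma mk2_mult: "mk2 a b c d ** mk2 a' b' c' d' = mk2 (a * a' + b * c') (a * b' + b * d') (c * a' + d * c') (c * b' + d * d')"
  by (simp add: vec_eq_iff forall_2 matrix_matrix_mult_def sum_2)

lemma matrix_inv_unique:
  fixes A B :: mat2
  assumes "A ** B = mat 1" "B ** A = mat 1"
  shows "matrix_inv A = B"
proof -
  have "A ** matrix_inv A = mat 1 \<and> matrix_inv A ** A = mat 1"
    unfolding matrix_inv_def by (rule someI[of _ B]) (intro conjI assms)
  then have "matrix_inv A ** (A ** B) = B"
    unfolding matrix_mul_assoc by (metis matrix_mul_lid)
  then show ?thesis by (simp only: assms matrix_mul_rid)
qed

lemma U_rep_14:
  assumes X: "X \<in> GL2"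
  shows "U_rep \<sigma> \<sigma>' (one_plus_unit 1 4 \<epsilon>) F X =
    F (mk2 (X $ 1 $ 1) (X $ 1 $ 2 + \<epsilon>) (X $ 2 $ 1) (X $ 2 $ 2)) * bipow (1 - \<epsilon> * (X $ 2 $ 1 / det X)) (-1 + \<sigma>) (-1 + \<sigma>')"
proof -
  have "block upper_index upper_index (one_plus_unit 1 4 \<epsilon>) = mat 1"
    "block upper_index lower_index (one_plus_unit 1 4 \<epsilon>) = mk2 0 \<epsilon> 0 0"
    "block lower_index upper_index (one_plus_unit 1 4 \<epsilon>) = 0"
    "block lower_index lower_index (one_plus_unit 1 4 \<epsilon>) = mat 1"
    by (simp_all add: vec_eq_iff forall_2 block_def upper_index_def lower_index_def one_plus_unit_def mat_def)
  moreover have "matrix_inv (mat 1 :: mat2) = mat 1" by (rule matrix_inv_unique) simp_all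
  moreover have "mk2 0 \<epsilon> 0 0 + X = mk2 (X $ 1 $ 1) (X $ 1 $ 2 + \<epsilon>) (X $ 2 $ 1) (X $ 2 $ 2)"
    by (simp add: vec_eq_iff forall_2)
  moreover have "X ** (0 :: mat2) = 0" by (simp add: vec_eq_iff matrix_matrix_mult_def)
  moreover have "((X $ 1 $ 1) * (X $ 2 $ 2) - (X $ 1 $ 2 + \<epsilon>) * (X $ 2 $ 1)) / det X = 1 - \<epsilon> * (X $ 2 $ 1 / det X)"
    using X unfolding GL2_iff by (simp add: det_2 field_simps)
  ultimately show ?thesis
    by (simp add: U_rep_def Let_def det_one_plus_unit)
qed

lemma U_rep_32:
  assumes X: "X \<in> GL2" and \<epsilon>: "1 + \<epsilon> * X $ 2 $ 1 \<noteq> 0"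
  shows "U_rep \<sigma> \<sigma>' (one_plus_unit 3 2 \<epsilon>) F X =
    F (mk2 (X $ 1 $ 1 - \<epsilon> * X $ 1 $ 1 * (X $ 2 $ 1 / (1 + \<epsilon> * X $ 2 $ 1)))
           (X $ 1 $ 2 - \<epsilon> * X $ 1 $ 1 * (X $ 2 $ 2 / (1 + \<epsilon> * X $ 2 $ 1)))
           (X $ 2 $ 1 / (1 + \<epsilon> * X $ 2 $ 1)) (X $ 2 $ 2 / (1 + \<epsilon> * X $ 2 $ 1)))
      * bipow (1 + \<epsilon> * X $ 2 $ 1) (-1 + \<sigma>) (-1 + \<sigma>')"
proof -
  let ?d = "1 + \<epsilon> * X $ 2 $ 1"
  have "block upper_index upper_index (one_plus_unit 3 2 \<epsilon>) = mat 1"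
    "block upper_index lower_index (one_plus_unit 3 2 \<epsilon>) = 0"
    "block lower_index upper_index (one_plus_unit 3 2 \<epsilon>) = mk2 0 \<epsilon> 0 0"
    "block lower_index lower_index (one_plus_unit 3 2 \<epsilon>) = mat 1"
    by (simp_all add: vec_eq_iff forall_2 block_def upper_index_def lower_index_def one_plus_unit_def mat_def)
  moreover have "mat 1 + X ** mk2 0 \<epsilon> 0 0 = mk2 1 (\<epsilon> * X $ 1 $ 1) 0 ?d"
    by (simp add: vec_eq_iff forall_2 matrix_matrix_mult_def sum_2 mat_def)
  moreover have "matrix_inv (mk2 1 (\<epsilon> * X $ 1 $ 1) 0 ?d) = mk2 1 (- (\<epsilon> * X $ 1 $ 1) / ?d) 0 (1 / ?d)"
    using \<epsilon> by (intro matrix_inv_unique) (simp_all add: mk2_mult mat_1_eq_mk2 mk2_eq_iff)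
  moreover have "mk2 1 (- (\<epsilon> * X $ 1 $ 1) / ?d) 0 (1 / ?d) ** X =
    mk2 (X $ 1 $ 1 - \<epsilon> * X $ 1 $ 1 * (X $ 2 $ 1 / ?d)) (X $ 1 $ 2 - \<epsilon> * X $ 1 $ 1 * (X $ 2 $ 2 / ?d)) (X $ 2 $ 1 / ?d) (X $ 2 $ 2 / ?d)"
    by (simp add: vec_eq_iff forall_2 matrix_matrix_mult_def sum_2)
  moreover have "det X \<noteq> 0"
    using X by (simp add: GL2_iff)
  ultimately show ?thesis
    by (simp add: U_rep_def Let_def det_one_plus_unit)
qed

text \<open>The division by \<open>det X = 0\<close> yields \<open>0\<close>, and \<open>bipow\<close> vanishes at \<open>0\<close> for all exponents; hence the
  generators preserve the extension by zero to singular matrices.\<close>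

lemma U_rep_singular: "X \<notin> GL2 \<Longrightarrow> U_rep \<sigma> \<sigma>' g F X = 0"
  by (simp add: GL2_iff U_rep_def Let_def)

context C1_compact
begin

text \<open>The derivative along a curve \<open>\<gamma>\<close> in the group with multiplier \<open>r\<close>, both with
  complex-linear derivative at \<open>0\<close>: only the tangent vectors \<open>y\<close> and \<open>\<rho>\<close> matter.\<close>

lemma wd_U_rep:
  assumes \<sigma>: "\<sigma> - \<sigma>' \<in> \<int>"
    and X: "X = \<gamma> 0" and r: "r 0 = 1"
    and \<gamma>: "(\<gamma> has_derivative (\<lambda>h. mk2 (h * y11) (h * y12) (h * y21) (h * y22))) (at 0)"
    and r': "(r has_derivative (\<lambda>h. h * \<rho>)) (at 0)"
    and S: "open S" "0 \<in> S" "\<And>\<epsilon>. \<epsilon> \<in> S \<Longrightarrow> u \<epsilon> = F (\<gamma> \<epsilon>) * bipow (r \<epsilon>) (-1 + \<sigma>) (-1 + \<sigma>')"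
  shows "wd c u 0 = P 1 1 X * cj c y11 + P 1 2 X * cj c y12 + P 2 1 X * cj c y21 + P 2 2 X * cj c y22
     + F X * ((if c then \<sigma> else \<sigma>') - 1) * cj c \<rho>"
proof -
  let ?\<sigma> = "if c then \<sigma> else \<sigma>'" and ?\<sigma>' = "if c then \<sigma>' else \<sigma>"
  have \<sigma>1: "-1 + \<sigma> - (-1 + \<sigma>') \<in> \<int>" using \<sigma> by simp
  have 1: "((\<lambda>\<epsilon>. F (\<gamma> \<epsilon>)) has_derivative (\<lambda>h. mat_form c P Q X (mk2 (h * y11) (h * y12) (h * y21) (h * y22)))) (at 0)"
    unfolding X by (rule has_derivative_compose[OF \<gamma> deriv])
  have "((\<lambda>z. bipow z (-1 + \<sigma>) (-1 + \<sigma>')) has_derivative (\<lambda>h. (-1 + \<sigma>) * h + (-1 + \<sigma>') * cnj h)) (at (r 0))"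
    using has_derivative_bipow[OF _ \<sigma>1, of 1] unfolding r by (simp add: bipow_eq_exp)
  then have 2: "((\<lambda>\<epsilon>. bipow (r \<epsilon>) (-1 + \<sigma>) (-1 + \<sigma>')) has_derivative (\<lambda>h. (-1 + \<sigma>) * (h * \<rho>) + (-1 + \<sigma>') * cnj (h * \<rho>))) (at 0)"
    by (rule has_derivative_compose[OF r'])
  have b1: "bipow (r 0) (-1 + \<sigma>) (-1 + \<sigma>') = 1" by (simp add: r bipow_eq_exp)
  have "(u has_derivative (\<lambda>h. F (\<gamma> 0) * ((-1 + \<sigma>) * (h * \<rho>) + (-1 + \<sigma>') * cnj (h * \<rho>)) +
      mat_form c P Q X (mk2 (h * y11) (h * y12) (h * y21) (h * y22)) * bipow (r 0) (-1 + \<sigma>) (-1 + \<sigma>'))) (at 0)"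
    by (rule has_derivative_transform_within_open[OF has_derivative_mult[OF 1 2] S(1,2)]) (simp add: S(3))
  from this[unfolded b1] have "(u has_derivative (\<lambda>h. (P 1 1 X * cj c y11 + P 1 2 X * cj c y12 + P 2 1 X * cj c y21 + P 2 2 X * cj c y22
        + F X * (?\<sigma> - 1) * cj c \<rho>) * cj c h
      + (Q 1 1 X * cnj (cj c y11) + Q 1 2 X * cnj (cj c y12) + Q 2 1 X * cnj (cj c y21) + Q 2 2 X * cnj (cj c y22)
        + F X * (?\<sigma>' - 1) * cnj (cj c \<rho>)) * cnj (cj c h))) (at 0)"
    by (rule has_derivative_eq_rhs)
       (cases c; simp add: fun_eq_iff X[symmetric] mat_form_def sum_2 algebra_simps)
  then have "wd c u 0 = wirt c (\<lambda>h. (P 1 1 X * cj c y11 + P 1 2 X * cj c y12 + P 2 1 X * cj c y21 + P 2 2 X * cj c y22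
        + F X * (?\<sigma> - 1) * cj c \<rho>) * cj c h
      + (Q 1 1 X * cnj (cj c y11) + Q 1 2 X * cnj (cj c y12) + Q 2 1 X * cnj (cj c y21) + Q 2 2 X * cnj (cj c y22)
        + F X * (?\<sigma>' - 1) * cnj (cj c \<rho>)) * cnj (cj c h))"
    by (rule wd_has_derivative)
  then show ?thesis by (simp only: wirt_eq)
qed

lemma wd_singular: "X \<notin> GL2 \<Longrightarrow> wd c (\<lambda>\<epsilon>. U_rep \<sigma> \<sigma>' (g \<epsilon>) F X) 0 = 0"
  using wd_has_derivative[of "\<lambda>_. 0" "\<lambda>_. 0" 0 c] by (simp add: U_rep_singular wirt_def)

lemma zero_singular:
  assumes "X \<notin> GL2"
  shows "F X = 0" "P i j X = 0"
  using assms cs_GL2_zero[OF F] cs_GL2_zero[OF P] by (simp_all add: GL2_iff)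

lemma wd_U_rep_14:
  assumes \<sigma>: "\<sigma> - \<sigma>' \<in> \<int>"
  shows "wd c (\<lambda>\<epsilon>. U_rep \<sigma> \<sigma>' (one_plus_unit 1 4 \<epsilon>) F X) 0 = gen14 (if c then \<sigma> else \<sigma>') X"
proof (cases "X \<in> GL2")
  case True
  define \<tau> where "\<tau> = (if c then \<sigma> else \<sigma>')"
  have "wd c (\<lambda>\<epsilon>. U_rep \<sigma> \<sigma>' (one_plus_unit 1 4 \<epsilon>) F X) 0 =
     P 1 1 X * cj c 0 + P 1 2 X * cj c 1 + P 2 1 X * cj c 0 + P 2 2 X * cj c 0
     + F X * (\<tau> - 1) * cj c (- (X $ 2 $ 1 / det X))"
  proof (unfold \<tau>_def, rule wd_U_rep[OF \<sigma>, where S = UNIV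
        and \<gamma> = "\<lambda>\<epsilon>. mk2 (X $ 1 $ 1) (X $ 1 $ 2 + \<epsilon>) (X $ 2 $ 1) (X $ 2 $ 2)" and r = "\<lambda>\<epsilon>. 1 - \<epsilon> * (X $ 2 $ 1 / det X)"])
    show "((\<lambda>\<epsilon>. mk2 (X $ 1 $ 1) (X $ 1 $ 2 + \<epsilon>) (X $ 2 $ 1) (X $ 2 $ 2)) has_derivative (\<lambda>h. mk2 (h * 0) (h * 1) (h * 0) (h * 0))) (at 0)"
      by (rule has_derivative_mk2) (auto intro!: derivative_eq_intros)
    show "((\<lambda>\<epsilon>. 1 - \<epsilon> * (X $ 2 $ 1 / det X)) has_derivative (\<lambda>h. h * - (X $ 2 $ 1 / det X))) (at 0)"
      using True by (auto intro!: derivative_eq_intros simp: GL2_iff)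
  qed (simp_all add: U_rep_14[OF True])
  then show ?thesis
    unfolding \<tau>_def[symmetric] gen14_def by (simp add: algebra_simps del: cj_simps(5))
next
  case False
  then show ?thesis by (simp add: wd_singular gen14_def zero_singular)
qed

lemma wd_U_rep_32:
  assumes \<sigma>: "\<sigma> - \<sigma>' \<in> \<int>"
  shows "wd c (\<lambda>\<epsilon>. U_rep \<sigma> \<sigma>' (one_plus_unit 3 2 \<epsilon>) F X) 0 = gen32 (if c then \<sigma> else \<sigma>') X"
proof (cases "X \<in> GL2")
  case True
  define \<tau> where "\<tau> = (if c then \<sigma> else \<sigma>')"
  let ?d = "\<lambda>\<epsilon>. 1 + \<epsilon> * X $ 2 $ 1"
  let ?\<gamma> = "\<lambda>\<epsilon>. mk2 (X $ 1 $ 1 - \<epsilon> * X $ 1 $ 1 * (X $ 2 $ 1 / ?d \<epsilon>)) (X $ 1 $ 2 - \<epsilon> * X $ 1 $ 1 * (X $ 2 $ 2 / ?d \<epsilon>))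
           (X $ 2 $ 1 / ?d \<epsilon>) (X $ 2 $ 2 / ?d \<epsilon>)"
  have "wd c (\<lambda>\<epsilon>. U_rep \<sigma> \<sigma>' (one_plus_unit 3 2 \<epsilon>) F X) 0 =
     P 1 1 X * cj c (- (X $ 1 $ 1 * X $ 2 $ 1)) + P 1 2 X * cj c (- (X $ 1 $ 1 * X $ 2 $ 2))
     + P 2 1 X * cj c (- (X $ 2 $ 1 * X $ 2 $ 1)) + P 2 2 X * cj c (- (X $ 2 $ 1 * X $ 2 $ 2))
     + F X * (\<tau> - 1) * cj c (X $ 2 $ 1)"
  proof (unfold \<tau>_def, rule wd_U_rep[OF \<sigma>, where S = "{\<epsilon>. ?d \<epsilon> \<noteq> 0}" and \<gamma> = ?\<gamma> and r = ?d])
    show "(?\<gamma> has_derivative (\<lambda>h. mk2 (h * - (X $ 1 $ 1 * X $ 2 $ 1)) (h * - (X $ 1 $ 1 * X $ 2 $ 2))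
        (h * - (X $ 2 $ 1 * X $ 2 $ 1)) (h * - (X $ 2 $ 1 * X $ 2 $ 2)))) (at 0)"
      by (rule has_derivative_mk2) (auto intro!: derivative_eq_intros)
    show "(?d has_derivative (\<lambda>h. h * X $ 2 $ 1)) (at 0)"
      by (auto intro!: derivative_eq_intros)
    show "open {\<epsilon>. ?d \<epsilon> \<noteq> 0}"
      by (intro open_Collect_neq continuous_intros)
    show "U_rep \<sigma> \<sigma>' (one_plus_unit 3 2 \<epsilon>) F X = F (?\<gamma> \<epsilon>) * bipow (?d \<epsilon>) (-1 + \<sigma>) (-1 + \<sigma>')" if "\<epsilon> \<in> {\<epsilon>. ?d \<epsilon> \<noteq> 0}" for \<epsilon>
      using U_rep_32[OF True, of \<epsilon>] that by simp
  qed simp_all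
  then show ?thesis
    unfolding \<tau>_def[symmetric] gen32_def by (simp add: algebra_simps)
next
  case False
  then show ?thesis by (simp add: wd_singular gen32_def zero_singular)
qed

lemma cs_GL2_gen: "cs_GL2 (gen14 \<sigma>)" "cs_GL2 (gen32 \<sigma>)"
  unfolding gen14_def[abs_def] gen32_def[abs_def]
  by (intro cs_GL2_add cs_GL2_minus cs_GL2_mult F P continuous_intros; simp add: GL2_iff)+

end

text \<open>For the antiholomorphic half the exponents change places, since \<open>z\<close> to the power \<open>\<nu> \<parallel> \<nu>'\<close> equals
  \<open>cnj z\<close> to the power \<open>\<nu>' \<parallel> \<nu>\<close>.\<close>

lemma haar_dens_eq_bimonomial:
  assumes "\<alpha> - \<alpha>' \<in> \<int>" "\<beta> - \<beta>' \<in> \<int>"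
  shows "haar_dens \<alpha> \<alpha>' \<beta> \<beta>' = bimonomial True 0 \<alpha> \<alpha>' \<beta> \<beta>'"
    "haar_dens \<alpha> \<alpha>' \<beta> \<beta>' = bimonomial False 0 \<alpha>' \<alpha> \<beta>' \<beta>"
proof -
  have "\<alpha>' - \<alpha> \<in> \<int>" "\<beta>' - \<beta> \<in> \<int>" using assms by (metis Ints_minus minus_diff_eq)+
  then show "haar_dens \<alpha> \<alpha>' \<beta> \<beta>' = bimonomial False 0 \<alpha>' \<alpha> \<beta>' \<beta>"
    by (simp add: fun_eq_iff haar_dens_def bimonomial_def bp_def bipow_cnj)
qed (simp add: fun_eq_iff haar_dens_def bimonomial_def bp_def)

theorem mainTheorem2:
  fixes \<sigma> \<sigma>' :: complex and F :: "complex^2^2 \<Rightarrow> complex"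
    and \<mu>1 \<mu>1' \<mu>2 \<mu>2' t s :: complex
  assumes "Re \<sigma> = 0" and "Re \<sigma>' = 0" and "\<sigma> - \<sigma>' \<in> \<int>"
    and "F \<in> test_functions"
    and "(\<mu>1, \<mu>1', \<mu>2, \<mu>2') \<in> Delta"
  shows
    "(\<mu>1 \<noteq> \<mu>2 \<longrightarrow>
        K_F (e_gen \<sigma> \<sigma>' 1 4 F) t s \<mu>1 \<mu>1' \<mu>2 \<mu>2' = E14 \<sigma> (K_F F) t s \<mu>1 \<mu>1' \<mu>2 \<mu>2')
   \<and> (\<mu>1' \<noteq> \<mu>2' \<longrightarrow>
        K_F (e_gen_bar \<sigma> \<sigma>' 1 4 F) t s \<mu>1 \<mu>1' \<mu>2 \<mu>2' = E14_bar \<sigma>' (K_F F) t s \<mu>1 \<mu>1' \<mu>2 \<mu>2')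
   \<and> (\<mu>1 \<noteq> \<mu>2 \<longrightarrow>
        K_F (e_gen \<sigma> \<sigma>' 3 2 F) t s \<mu>1 \<mu>1' \<mu>2 \<mu>2' = E32 \<sigma> (K_F F) t s \<mu>1 \<mu>1' \<mu>2 \<mu>2')
   \<and> (\<mu>1' \<noteq> \<mu>2' \<longrightarrow>
        K_F (e_gen_bar \<sigma> \<sigma>' 3 2 F) t s \<mu>1 \<mu>1' \<mu>2 \<mu>2' = E32_bar \<sigma>' (K_F F) t s \<mu>1 \<mu>1' \<mu>2 \<mu>2')"
proof -
  have \<mu>: "\<mu>1 - \<mu>1' \<in> \<int>" "\<mu>2 - \<mu>2' \<in> \<int>" using assms(5) by (simp_all add: Delta_def)
  have \<mu>': "\<mu>1' - \<mu>1 \<in> \<int>" "\<mu>2' - \<mu>2 \<in> \<int>" using \<mu> by (metis Ints_minus minus_diff_eq)+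
  have sh: "a - 1 - b \<in> \<int>" "a + 1 - b \<in> \<int>" "a - (b - 1) \<in> \<int>" "a - (b + 1) \<in> \<int>" if "a - b \<in> \<int>" for a b :: complex
    using Ints_diff[OF that Ints_1] Ints_add[OF that Ints_1] by (simp_all add: algebra_simps)
  have KT: "K_F g t s \<nu>1 \<nu>1' \<nu>2 \<nu>2' = kernel_int g (bimonomial True 0 (\<nu>1 - 3/2) (\<nu>1' - 3/2) (\<nu>2 - 3/2) (\<nu>2' - 3/2)) t s"
    and KF: "K_F g t s \<nu>1 \<nu>1' \<nu>2 \<nu>2' = kernel_int g (bimonomial False 0 (\<nu>1' - 3/2) (\<nu>1 - 3/2) (\<nu>2' - 3/2) (\<nu>2 - 3/2)) t s"
    if "cs_GL2 g" "\<nu>1 - \<nu>1' \<in> \<int>" "\<nu>2 - \<nu>2' \<in> \<int>" for g t s \<nu>1 \<nu>1' \<nu>2 \<nu>2'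
    using K_F_eq[OF that] that by (simp_all add: haar_dens_eq_bimonomial[symmetric])
  have r: "a - 1 - 3/2 = a - 3/2 - 1" "a + 1 - 3/2 = a - 3/2 + 1" "-1/2 - b + a = a - 3/2 + 1 - b" "1/2 + a + b = a - 3/2 + 2 + b"
    for a b :: complex by simp_all
  have T: "(\<mu>1 \<noteq> \<mu>2 \<longrightarrow> K_F (e_gen \<sigma> \<sigma>' 1 4 F) t s \<mu>1 \<mu>1' \<mu>2 \<mu>2' = E14 \<sigma> (K_F F) t s \<mu>1 \<mu>1' \<mu>2 \<mu>2')
    \<and> (\<mu>1 \<noteq> \<mu>2 \<longrightarrow> K_F (e_gen \<sigma> \<sigma>' 3 2 F) t s \<mu>1 \<mu>1' \<mu>2 \<mu>2' = E32 \<sigma> (K_F F) t s \<mu>1 \<mu>1' \<mu>2 \<mu>2')"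
  proof -
    obtain P Q where "cs_GL2 F" "\<And>i j. cs_GL2 (P i j)" "\<And>i j. cs_GL2 (Q i j)"
      "\<And>X. (F has_derivative mat_form True P Q X) (at X)"
      using test_functions_derivative[OF assms(4), of True] by blast
    then interpret C1_compact True F P Q by unfold_locales
    have e: "e_gen \<sigma> \<sigma>' 1 4 F = gen14 \<sigma>" "e_gen \<sigma> \<sigma>' 3 2 F = gen32 \<sigma>"
      using wd_U_rep_14[OF assms(3)] wd_U_rep_32[OF assms(3)] by (simp_all add: fun_eq_iff e_gen_def wd_eq)
    have k: "K_F F t s (\<mu>1 - 1) \<mu>1' \<mu>2 \<mu>2' = kernel_int F (bimonomial True 0 (\<mu>1 - 1 - 3/2) (\<mu>1' - 3/2) (\<mu>2 - 3/2) (\<mu>2' - 3/2)) t s"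
      "K_F F t s \<mu>1 \<mu>1' (\<mu>2 - 1) \<mu>2' = kernel_int F (bimonomial True 0 (\<mu>1 - 3/2) (\<mu>1' - 3/2) (\<mu>2 - 1 - 3/2) (\<mu>2' - 3/2)) t s"
      "K_F F t s (\<mu>1 + 1) \<mu>1' \<mu>2 \<mu>2' = kernel_int F (bimonomial True 0 (\<mu>1 + 1 - 3/2) (\<mu>1' - 3/2) (\<mu>2 - 3/2) (\<mu>2' - 3/2)) t s"
      "K_F F t s \<mu>1 \<mu>1' (\<mu>2 + 1) \<mu>2' = kernel_int F (bimonomial True 0 (\<mu>1 - 3/2) (\<mu>1' - 3/2) (\<mu>2 + 1 - 3/2) (\<mu>2' - 3/2)) t s" for t s
      by (rule KT[OF F]; intro \<mu> sh)+
    have g: "K_F (gen14 x) t s \<mu>1 \<mu>1' \<mu>2 \<mu>2' = kernel_int (gen14 x) (bimonomial True 0 (\<mu>1 - 3/2) (\<mu>1' - 3/2) (\<mu>2 - 3/2) (\<mu>2' - 3/2)) t s"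
      "K_F (gen32 x) t s \<mu>1 \<mu>1' \<mu>2 \<mu>2' = kernel_int (gen32 x) (bimonomial True 0 (\<mu>1 - 3/2) (\<mu>1' - 3/2) (\<mu>2 - 3/2) (\<mu>2' - 3/2)) t s" for x
      by (rule KT[OF cs_GL2_gen(1) \<mu>], rule KT[OF cs_GL2_gen(2) \<mu>])
    show ?thesis
      unfolding e E14_def E32_def d_s_def d_t_def V1_inv_def V2_inv_def V1_def V2_def wd_eq[symmetric]
      using kernel_int_gen14[of "\<mu>1 - 3/2" "\<mu>1' - 3/2" "\<mu>2 - 3/2" "\<mu>2' - 3/2" \<sigma> t s]
        kernel_int_gen32[of "\<mu>1 - 3/2" "\<mu>1' - 3/2" "\<mu>2 - 3/2" "\<mu>2' - 3/2" \<sigma> t s] \<mu>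
      by (simp only: k g r) simp
  qed
  have B: "(\<mu>1' \<noteq> \<mu>2' \<longrightarrow> K_F (e_gen_bar \<sigma> \<sigma>' 1 4 F) t s \<mu>1 \<mu>1' \<mu>2 \<mu>2' = E14_bar \<sigma>' (K_F F) t s \<mu>1 \<mu>1' \<mu>2 \<mu>2')
    \<and> (\<mu>1' \<noteq> \<mu>2' \<longrightarrow> K_F (e_gen_bar \<sigma> \<sigma>' 3 2 F) t s \<mu>1 \<mu>1' \<mu>2 \<mu>2' = E32_bar \<sigma>' (K_F F) t s \<mu>1 \<mu>1' \<mu>2 \<mu>2')"
  proof -
    obtain P Q where "cs_GL2 F" "\<And>i j. cs_GL2 (P i j)" "\<And>i j. cs_GL2 (Q i j)"
      "\<And>X. (F has_derivative mat_form False P Q X) (at X)"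
      using test_functions_derivative[OF assms(4), of False] by blast
    then interpret C1_compact False F P Q by unfold_locales
    have e: "e_gen_bar \<sigma> \<sigma>' 1 4 F = gen14 \<sigma>'" "e_gen_bar \<sigma> \<sigma>' 3 2 F = gen32 \<sigma>'"
      using wd_U_rep_14[OF assms(3)] wd_U_rep_32[OF assms(3)] by (simp_all add: fun_eq_iff e_gen_bar_def wd_eq)
    have k: "K_F F t s \<mu>1 (\<mu>1' - 1) \<mu>2 \<mu>2' = kernel_int F (bimonomial False 0 (\<mu>1' - 1 - 3/2) (\<mu>1 - 3/2) (\<mu>2' - 3/2) (\<mu>2 - 3/2)) t s"
      "K_F F t s \<mu>1 \<mu>1' \<mu>2 (\<mu>2' - 1) = kernel_int F (bimonomial False 0 (\<mu>1' - 3/2) (\<mu>1 - 3/2) (\<mu>2' - 1 - 3/2) (\<mu>2 - 3/2)) t s"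
      "K_F F t s \<mu>1 (\<mu>1' + 1) \<mu>2 \<mu>2' = kernel_int F (bimonomial False 0 (\<mu>1' + 1 - 3/2) (\<mu>1 - 3/2) (\<mu>2' - 3/2) (\<mu>2 - 3/2)) t s"
      "K_F F t s \<mu>1 \<mu>1' \<mu>2 (\<mu>2' + 1) = kernel_int F (bimonomial False 0 (\<mu>1' - 3/2) (\<mu>1 - 3/2) (\<mu>2' + 1 - 3/2) (\<mu>2 - 3/2)) t s" for t s
      by (rule KF[OF F]; intro \<mu> sh)+
    have g: "K_F (gen14 x) t s \<mu>1 \<mu>1' \<mu>2 \<mu>2' = kernel_int (gen14 x) (bimonomial False 0 (\<mu>1' - 3/2) (\<mu>1 - 3/2) (\<mu>2' - 3/2) (\<mu>2 - 3/2)) t s"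
      "K_F (gen32 x) t s \<mu>1 \<mu>1' \<mu>2 \<mu>2' = kernel_int (gen32 x) (bimonomial False 0 (\<mu>1' - 3/2) (\<mu>1 - 3/2) (\<mu>2' - 3/2) (\<mu>2 - 3/2)) t s" for x
      by (rule KF[OF cs_GL2_gen(1) \<mu>], rule KF[OF cs_GL2_gen(2) \<mu>])
    show ?thesis
      unfolding e E14_bar_def E32_bar_def d_s_bar_def d_t_bar_def V1'_inv_def V2'_inv_def V1'_def V2'_def wd_eq[symmetric]
      using kernel_int_gen14[of "\<mu>1' - 3/2" "\<mu>1 - 3/2" "\<mu>2' - 3/2" "\<mu>2 - 3/2" \<sigma>' t s]
        kernel_int_gen32[of "\<mu>1' - 3/2" "\<mu>1 - 3/2" "\<mu>2' - 3/2" "\<mu>2 - 3/2" \<sigma>' t s] \<mu>'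
      by (simp only: k g r) simp
  qed
  from T B show ?thesis by blast
qed

end
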